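(* Let $M$ be a simple binary matroid. The following are equivalent. (i) $M$ is $GF(2)$-chordal. (ii) $M$ has no induced minor isomorphic to a member of $\{M(C_4),M(K_4)\}$. (iii) $M$ has no induced restriction isomorphic to a member of $\{M(C_n):n\geq 4\}\cup\{M(K_4),M^*(K_{3,3})\}$.
   Context: All matroids are finite and simple; every contraction is immediately followed by simplification, so $M/X$ means $\mathrm{si}(M/X)$. An induced restriction of $M$ is a matroid $M|F$ with $F$ a flat of $M$. An induced minor of $M$ is any matroid obtained from $M$ by a sequence of contractions (followed by simplification) and restrictions to flats. $C_n$ is the $n$-edge cycle, so $M(C_n)\cong U_{n-1,n}$; $K_4$ and $K_{3,3}$ are the usual graphs and $M^*$ denotes the dual. Generalized parallel connection: if $M_1,M_2$ are matroids with $E(M_1)\cap E(M_2)=T$, $M_1|T=M_2|T=N$, and $T$ is a modular flat of $M_1$ (a flat $T$ is modular if $r(T)+r(F)=r(T\cap F)+r(T\cup F)$ for every flat $F$), then $P_N(M_1,M_2)$ is the matroid on $E(M_1)\cup E(M_2)$ whose flats are exactly the sets $F$ such that $F\cap E(M_i)$ is a flat of $M_i$ for $i=1,2$. For a prime power $q$, a matroid is $GF(q)$-chordal if it can be obtained, starting from projective geometries over $GF(q)$, by repeatedly taking generalized parallel connections $P_N(M_1,M_2)$ of previously obtained matroids across a common restriction $N$ that is a projective geometry over $GF(q)$. *)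

theory Defs
  imports Main "HOL-Library.Z2"
begin

section \<open>Matroids\<close>

record 'a matroid =
  ground :: "'a set"
  indep :: "'a set set"

locale matroid =
  fixes M :: "'a matroid"
  assumes finite_ground: "finite (ground M)"
    and indep_subset: "X \<in> indep M \<Longrightarrow> X \<subseteq> ground M"
    and indep_empty: "{} \<in> indep M"
    and indep_mono: "X \<in> indep M \<Longrightarrow> Y \<subseteq> X \<Longrightarrow> Y \<in> indep M"
    and indep_augment: "X \<in> indep M \<Longrightarrow> Y \<in> indep M \<Longrightarrow> card X < card Y
      \<Longrightarrow> \<exists>y \<in> Y - X. insert y X \<in> indep M"

definition matroid_iso :: "'a matroid \<Rightarrow> 'b matroid \<Rightarrow> bool" where
  "matroid_iso M N \<longleftrightarrow>
     (\<exists>f. bij_betw f (ground M) (ground N) \<and>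
          (\<forall>X \<subseteq> ground M. X \<in> indep M \<longleftrightarrow> f ` X \<in> indep N))"

definition rank :: "'a matroid \<Rightarrow> 'a set \<Rightarrow> nat" where
  "rank M X = Max (card ` {I \<in> indep M. I \<subseteq> X})"

definition closure :: "'a matroid \<Rightarrow> 'a set \<Rightarrow> 'a set" where
  "closure M X = {x \<in> ground M. rank M (insert x X) = rank M X}"

definition flat :: "'a matroid \<Rightarrow> 'a set \<Rightarrow> bool" where
  "flat M F \<longleftrightarrow> F \<subseteq> ground M \<and> closure M F = F"

definition modular_flat :: "'a matroid \<Rightarrow> 'a set \<Rightarrow> bool" where
  "modular_flat M T \<longleftrightarrow> flat M T \<and>
     (\<forall>F. flat M F \<longrightarrow> rank M T + rank M F = rank M (T \<inter> F) + rank M (T \<union> F))"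

definition basis :: "'a matroid \<Rightarrow> 'a set \<Rightarrow> bool" where
  "basis M B \<longleftrightarrow> B \<in> indep M \<and> (\<forall>X \<in> indep M. B \<subseteq> X \<longrightarrow> X = B)"

definition dual :: "'a matroid \<Rightarrow> 'a matroid" where
  "dual M = \<lparr>ground = ground M,
             indep = {X. X \<subseteq> ground M \<and> (\<exists>B. basis M B \<and> B \<inter> X = {})}\<rparr>"

definition restriction :: "'a matroid \<Rightarrow> 'a set \<Rightarrow> 'a matroid" where
  "restriction M X = \<lparr>ground = X, indep = {I \<in> indep M. I \<subseteq> X}\<rparr>"

text \<open>The contraction proper, without the subsequent simplification.\<close>

definition contraction :: "'a matroid \<Rightarrow> 'a set \<Rightarrow> 'a matroid" where
  "contraction M X = \<lparr>ground = ground M - X,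
     indep = {I. I \<subseteq> ground M - X \<and> (\<exists>B. basis (restriction M X) B \<and> B \<union> I \<in> indep M)}\<rparr>"

definition loop :: "'a matroid \<Rightarrow> 'a \<Rightarrow> bool" where
  "loop M x \<longleftrightarrow> x \<in> ground M \<and> {x} \<notin> indep M"

text \<open>Parallelism is taken to be reflexive on non-loops, so its classes partition them.\<close>

definition parallel :: "'a matroid \<Rightarrow> 'a \<Rightarrow> 'a \<Rightarrow> bool" where
  "parallel M x y \<longleftrightarrow> {x} \<in> indep M \<and> {y} \<in> indep M \<and> (x = y \<or> {x, y} \<notin> indep M)"

definition simple_matroid :: "'a matroid \<Rightarrow> bool" where
  "simple_matroid M \<longleftrightarrow> (\<forall>x. \<not> loop M x) \<and> (\<forall>x y. parallel M x y \<longrightarrow> x = y)"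

text \<open>
  A simplification depends on the choice of one representative from every parallel class, and is
  unique only up to isomorphism; hence a relation.
\<close>

definition is_simplification :: "'a matroid \<Rightarrow> 'a matroid \<Rightarrow> bool" where
  "is_simplification M N \<longleftrightarrow>
     (\<exists>X \<subseteq> ground M. N = restriction M X \<and> (\<forall>x \<in> X. \<not> loop M x) \<and>
        (\<forall>y \<in> ground M. \<not> loop M y \<longrightarrow> (\<exists>!x. x \<in> X \<and> parallel M x y)))"


section \<open>Induced restrictions and induced minors\<close>

definition induced_restriction :: "'a matroid \<Rightarrow> 'a matroid \<Rightarrow> bool" where
  "induced_restriction M N \<longleftrightarrow> (\<exists>F. flat M F \<and> N = restriction M F)"

inductive induced_minor :: "'a matroid \<Rightarrow> 'a matroid \<Rightarrow> bool" for M where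
  refl: "induced_minor M M"
| contract: "induced_minor M N \<Longrightarrow> X \<subseteq> ground N \<Longrightarrow> is_simplification (contraction N X) N'
    \<Longrightarrow> induced_minor M N'"
| restrict: "induced_minor M N \<Longrightarrow> induced_restriction N N' \<Longrightarrow> induced_minor M N'"


section \<open>Representable matroids and projective geometries\<close>

text \<open>
  The vector matroid of a family of vectors \<open>v e\<close> of length \<open>n\<close>, indexed by the ground set; only
  the coordinates below \<open>n\<close> matter. Independence is that of families, so repeated vectors are
  dependent.
\<close>

definition vector_matroid :: "nat \<Rightarrow> ('e \<Rightarrow> nat \<Rightarrow> 'f::field) \<Rightarrow> 'e set \<Rightarrow> 'e matroid" where
  "vector_matroid n v E = \<lparr>ground = E,
     indep = {X. X \<subseteq> E \<and>
       (\<forall>c. (\<forall>i<n. (\<Sum>x\<in>X. c x * v x i) = 0) \<longrightarrow> (\<forall>x\<in>X. c x = 0))}\<rparr>"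

definition representable :: "'f::field itself \<Rightarrow> 'a matroid \<Rightarrow> bool" where
  "representable _ M \<longleftrightarrow> (\<exists>n (v :: 'a \<Rightarrow> nat \<Rightarrow> 'f). M = vector_matroid n v (ground M))"

instance bit :: finite
proof
  have "(UNIV :: bit set) = {0, 1}"
    by (auto simp: bit_not_zero_iff)
  then show "finite (UNIV :: bit set)"
    by (metis finite.emptyI finite_insert)
qed

text \<open>\<open>GF(2)\<close> is the type \<^typ>\<open>bit\<close> of the library.\<close>

abbreviation binary :: "'a matroid \<Rightarrow> bool" where
  "binary \<equiv> representable TYPE(bit)"

text \<open>
  The matroid \<open>V(n, F)\<close> of all vectors of length \<open>n\<close> (functions vanishing from \<open>n\<close> on).
  Its simplification is the projective geometry \<open>PG(n - 1, F)\<close>: the zero vector is deleted and one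
  vector is kept from every one-dimensional subspace. The case \<open>n = 0\<close> is the empty matroid.
\<close>

definition full_vector_matroid :: "nat \<Rightarrow> (nat \<Rightarrow> 'f::field) matroid" where
  "full_vector_matroid n = vector_matroid n (\<lambda>v. v) {v. \<forall>i\<ge>n. v i = 0}"

definition projective_geometry :: "'f::{field, finite} itself \<Rightarrow> 'a matroid \<Rightarrow> bool" where
  "projective_geometry _ M \<longleftrightarrow> matroid M \<and>
     (\<exists>n (N :: (nat \<Rightarrow> 'f) matroid). is_simplification (full_vector_matroid n) N \<and> matroid_iso M N)"


section \<open>Generalized parallel connection and \<open>GF(q)\<close>-chordal matroids\<close>

text \<open>
  \<open>M\<close> is the generalized parallel connection of \<open>M\<^sub>1\<close> and \<open>M\<^sub>2\<close> across the restriction of either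
  to \<open>T = E(M\<^sub>1) \<inter> E(M\<^sub>2)\<close>. A matroid is determined by its ground set and its flats.
\<close>

definition gen_parallel_connection :: "'a matroid \<Rightarrow> 'a matroid \<Rightarrow> 'a matroid \<Rightarrow> bool" where
  "gen_parallel_connection M1 M2 M \<longleftrightarrow>
     (let T = ground M1 \<inter> ground M2 in
        restriction M1 T = restriction M2 T \<and> modular_flat M1 T \<and>
        matroid M \<and> ground M = ground M1 \<union> ground M2 \<and>
        (\<forall>F \<subseteq> ground M. flat M F \<longleftrightarrow> flat M1 (F \<inter> ground M1) \<and> flat M2 (F \<inter> ground M2)))"

inductive gf_chordal :: "'f::{field, finite} itself \<Rightarrow> 'a matroid \<Rightarrow> bool"
  for F :: "'f itself" where
  projective: "projective_geometry F M \<Longrightarrow> gf_chordal F M"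
| connection: "gf_chordal F M1 \<Longrightarrow> gf_chordal F M2
    \<Longrightarrow> projective_geometry F (restriction M1 (ground M1 \<inter> ground M2))
    \<Longrightarrow> gen_parallel_connection M1 M2 M \<Longrightarrow> gf_chordal F M"


section \<open>Graphic matroids\<close>

text \<open>
  A simple graph is given by its set of edges, each a two-element set of vertices; isolated vertices
  play no role for the cycle matroid. Consecutive vertices of the list, cyclically, are joined.
\<close>

definition cycle_edges :: "'v list \<Rightarrow> 'v set set" where
  "cycle_edges vs = {{vs ! i, vs ! (Suc i mod length vs)} |i. i < length vs}"

definition cycle_matroid :: "'v set set \<Rightarrow> 'v set matroid" where
  "cycle_matroid G = \<lparr>ground = G,
     indep = {X. X \<subseteq> G \<and>
       \<not> (\<exists>vs. distinct vs \<and> 3 \<le> length vs \<and> cycle_edges vs \<subseteq> X)}\<rparr>"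

definition cycle_graph :: "nat \<Rightarrow> nat set set" where
  "cycle_graph n = cycle_edges [0..<n]"

definition K4 :: "nat set set" where
  "K4 = {{u, v} |u v. u < 4 \<and> v < 4 \<and> u \<noteq> v}"

definition K33 :: "nat set set" where
  "K33 = {{u, v} |u v. u < 3 \<and> 3 \<le> v \<and> v < 6}"

end

theory Submission
  imports Defs "HOL-Library.Function_Algebras" "HOL-Library.Set_Algebras"
begin

text \<open>
  A simple binary matroid is a finite set of nonzero vectors over \<open>GF(2)\<close>; let \<open>S\<close> be this set
  together with \<open>0\<close>. Contracting a set of elements with span \<open>W\<close> replaces \<open>S\<close> by \<open>S + W\<close>, and the
  generalized parallel connections of chordality amount to unions \<open>S1 \<union> S2\<close> such that
  \<open>sp S1 \<inter> sp S2 = S1 \<inter> S2\<close>. A circuit \<open>{x, y, w, x + y + w}\<close> has the three diagonals \<open>x + y\<close>,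
  \<open>x + w\<close>, \<open>y + w\<close>; no diagonal in \<open>S\<close> gives \<open>M(C\<^sub>4)\<close>, two give \<open>M(K\<^sub>4)\<close>. So (ii) says that in
  every contraction all these circuits have an odd number of diagonals.

  Such an \<open>S\<close> that is not a subspace is separated by the span \<open>G\<close> of some of its elements; take \<open>G\<close>
  minimal. Like the minimal separators of a chordal graph, it is complete, \<open>G \<subseteq> S\<close>: if \<open>f, g \<in> S \<inter> G\<close> and
  \<open>f + g \<notin> S\<close>, then shortest circuits through \<open>f\<close> and \<open>g\<close> on the two sides of \<open>G\<close> close up, after
  a contraction, to a circuit of four elements without diagonals. Hence \<open>S\<close> splits along \<open>G\<close>, and
  (i) follows by induction. For (iii) one contracts a single element \<open>e\<close> and lifts an obstruction in
  the contraction: from a 4-circuit with an even number of diagonals one gets another such circuit, a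
  chordless 5-circuit through \<open>e\<close>, or \<open>M\<^sup>*(K\<^sub>3\<^sub>,\<^sub>3)\<close>; chordless circuits lift to chordless circuits and
  copies of \<open>M\<^sup>*(K\<^sub>3\<^sub>,\<^sub>3)\<close> to copies of \<open>M\<^sup>*(K\<^sub>3\<^sub>,\<^sub>3)\<close>.
\<close>

subsection \<open>Vector spaces over the two-element field\<close>

text \<open>One diagonal exhibits a 4-circuit as two triangles glued along it, and three diagonals
  complete it to a Fano plane; both are chordal. A contraction can only add diagonals to a
  4-circuit, so the danger is a second one appearing beside the first. Contracting an element of
  M*(K_{3,3}) does create a 4-circuit with exactly two diagonals, which is why (iii) must list this
  matroid; the long cycles are listed because only contraction brings them down to four elements.
  Two devices keep the linear algebra light. Quotient spaces and choices of representatives are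
  avoided: \<open>S\<close> contains 0 and is saturated under a kernel \<open>U\<close> that grows
  under contraction, while the map from elements to vectors stays the same. And ranks are read off
  from the sizes of spans, which are powers of two times \<open>card U\<close>. Chordality of
  matroids, by contrast, is given through flats of abstract matroids. Flats must first be shown to
  determine a matroid; only then are the pieces of a connection recognised as restrictions,
  represented by the same map.\<close>

class xor_group = ab_group_add +
  assumes add_self [simp]: "x + x = 0"
begin

lemma add_self_left [simp]: "x + (x + y) = y"
  by (simp flip: add.assoc)

lemma add_eq_0_iff_eq: "x + y = 0 \<longleftrightarrow> x = y"
  by (metis add_0_right add_self_left add_self)

end

instance bit :: xor_group
  by standard simp

instance "fun" :: (type, xor_group) xor_group
  by standard (simp add: fun_eq_iff)

abbreviation symdiff :: "'a set \<Rightarrow> 'a set \<Rightarrow> 'a set" where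
  "symdiff A B \<equiv> (A - B) \<union> (B - A)"

lemma sum_symdiff:
  fixes f :: "'a \<Rightarrow> 'v::xor_group"
  assumes "finite A" "finite B"
  shows "sum f (symdiff A B) = sum f A + sum f B"
proof -
  have "sum f A = sum f (A - B) + sum f (A \<inter> B)"
    using assms by (metis Int_Diff_disjoint Un_Diff_Int add.commute finite_Diff finite_Int inf_commute sum.union_disjoint sup_commute)
  moreover have "sum f B = sum f (B - A) + sum f (A \<inter> B)"
    using assms by (metis Int_Diff_disjoint Un_Diff_Int add.commute finite_Diff finite_Int inf_commute sum.union_disjoint sup_commute)
  moreover have "sum f (symdiff A B) = sum f (A - B) + sum f (B - A)"
    using assms by (intro sum.union_disjoint) auto
  ultimately show ?thesis
    by (simp add: ac_simps)
qed

text \<open>Exponent two makes a group a vector space over GF(2) whose subspaces are its subgroups;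
  linear combinations are sums over subsets.\<close>

definition subsp :: "'v::xor_group set \<Rightarrow> bool" where
  "subsp W \<longleftrightarrow> 0 \<in> W \<and> (\<forall>x\<in>W. \<forall>y\<in>W. x + y \<in> W)"

definition sp :: "'v::xor_group set \<Rightarrow> 'v set" where
  "sp X = \<Inter>{W. subsp W \<and> X \<subseteq> W}"

lemma subsp_0: "subsp W \<Longrightarrow> 0 \<in> W"
  and subsp_add: "subsp W \<Longrightarrow> x \<in> W \<Longrightarrow> y \<in> W \<Longrightarrow> x + y \<in> W"
  by (auto simp: subsp_def)

lemma subsp_add_cancel:
  assumes "subsp W" "x \<in> W"
  shows "x + y \<in> W \<longleftrightarrow> y \<in> W" "y + x \<in> W \<longleftrightarrow> y \<in> W"
  using subsp_add[OF assms(1,2)] by (metis add_self_left, metis add_self_left add.commute)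

lemma subsp_sum: "subsp W \<Longrightarrow> (\<And>x. x \<in> X \<Longrightarrow> f x \<in> W) \<Longrightarrow> sum f X \<in> W"
  by (induction X rule: infinite_finite_induct) (auto simp: subsp_0 subsp_add)

lemma subsp_Int: "subsp V \<Longrightarrow> subsp W \<Longrightarrow> subsp (V \<inter> W)"
  by (auto simp: subsp_def)

lemma subsp_sp: "subsp (sp X)"
  by (auto simp: subsp_def sp_def)

lemma sp_superset: "X \<subseteq> sp X"
  by (auto simp: sp_def)

lemma sp_incl: "x \<in> X \<Longrightarrow> x \<in> sp X"
  by (auto simp: sp_def)

lemma sp_least: "subsp W \<Longrightarrow> X \<subseteq> W \<Longrightarrow> sp X \<subseteq> W"
  by (auto simp: sp_def)

lemma sp_mono: "X \<subseteq> Y \<Longrightarrow> sp X \<subseteq> sp Y"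
  by (meson sp_least sp_superset subset_trans subsp_sp)

lemma sp_eq: "subsp W \<Longrightarrow> sp W = W"
  by (simp add: sp_least sp_superset subset_antisym)

lemma zero_in_sp: "0 \<in> sp X"
  by (simp add: subsp_0 subsp_sp)

lemma sp_add: "x \<in> sp X \<Longrightarrow> y \<in> sp X \<Longrightarrow> x + y \<in> sp X"
  by (simp add: subsp_add subsp_sp)

lemma subsp_singleton: "subsp {0}"
  by (simp add: subsp_def)

lemma sp_empty: "sp {} = {0}"
  using sp_least[OF subsp_singleton] zero_in_sp by blast

lemma subsp_plus: "subsp V \<Longrightarrow> subsp W \<Longrightarrow> subsp (V + W)"
  unfolding subsp_def
proof (intro conjI ballI; elim conjE)
  assume "0 \<in> V" "0 \<in> W"
  then show "0 \<in> V + W" using set_plus_intro[of 0 V 0 W] by simp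
next
  fix x y assume VW: "\<forall>x\<in>V. \<forall>y\<in>V. x + y \<in> V" "\<forall>x\<in>W. \<forall>y\<in>W. x + y \<in> W"
  assume "x \<in> V + W" "y \<in> V + W"
  then obtain a b c d where "x = a + b" "y = c + d" "a \<in> V" "b \<in> W" "c \<in> V" "d \<in> W"
    by (metis set_plus_elim)
  then have "(a + c) + (b + d) \<in> V + W" "x + y = (a + c) + (b + d)"
    using VW by (blast intro: set_plus_intro, simp add: ac_simps)
  then show "x + y \<in> V + W" by simp
qed

text \<open>Here \<open>v + s\<close> is also the difference of \<open>v\<close> and
  \<open>s\<close>, so membership in \<open>S + W\<close> means congruence modulo \<open>W\<close>
  to a member of \<open>S\<close>.\<close>

lemma mem_plus_iff: "v \<in> S + (W :: 'v::xor_group set) \<longleftrightarrow> (\<exists>s\<in>S. v + s \<in> W)"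
proof
  assume "v \<in> S + W"
  then obtain s w where "v = s + w" "s \<in> S" "w \<in> W" by (rule set_plus_elim)
  then show "\<exists>s\<in>S. v + s \<in> W" by (intro bexI[of _ s]) (simp_all add: ac_simps)
next
  assume "\<exists>s\<in>S. v + s \<in> W"
  then obtain s where "s \<in> S" "v + s \<in> W" by blast
  then have "s + (v + s) \<in> S + W" by (rule set_plus_intro)
  then show "v \<in> S + W" by (simp add: ac_simps)
qed

lemma subset_plus: "subsp W \<Longrightarrow> S \<subseteq> S + W"
  using mem_plus_iff[of _ S W] by (metis add_self subsetI subsp_0)

lemma mem_plus_shift:
  assumes "subsp W" "w \<in> W"
  shows "v + w \<in> S + W \<longleftrightarrow> v \<in> S + W"
proof -
  have "v + w + s \<in> W \<longleftrightarrow> v + s \<in> W" for s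
    using subsp_add_cancel(2)[OF assms, of "v + s"] by (simp add: ac_simps)
  then show ?thesis by (simp add: mem_plus_iff)
qed

lemma sp_Un: "sp (X \<union> Y) = sp X + sp Y"
proof
  show "sp (X \<union> Y) \<subseteq> sp X + sp Y"
  proof (rule sp_least)
    show "X \<union> Y \<subseteq> sp X + sp Y"
      using subset_plus[OF subsp_sp, of "sp X" Y] subset_plus[OF subsp_sp, of "sp Y" X] sp_superset[of X] sp_superset[of Y]
      by (metis Un_least add.commute subset_trans)
  qed (simp add: subsp_plus subsp_sp)
  show "sp X + sp Y \<subseteq> sp (X \<union> Y)"
    using sp_mono[of X "X \<union> Y"] sp_mono[of Y "X \<union> Y"]
    by (auto elim!: set_plus_elim intro!: sp_add)
qed

lemma zero_plus_set: "{0} + A = (A :: 'a::comm_monoid_add set)"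
  by simp

lemma subsp_pair: "subsp {0, x}"
  by (auto simp: subsp_def)

lemma sp_single: "sp {x} = {0, x}"
proof
  show "sp {x} \<subseteq> {0, x}" by (intro sp_least subsp_pair) simp
qed (simp add: zero_in_sp sp_incl)

lemma sp_insert: "sp (insert x X) = {0, x} + sp X"
  using sp_Un[of "{x}" X] by (simp add: sp_single)

lemma sp_insert_zero: "sp (insert 0 X) = sp X"
  by (simp add: sp_insert zero_plus_set)

lemma mem_pair_plus: "v \<in> {0, x} + W \<longleftrightarrow> v \<in> W \<or> v + (x::'v::xor_group) \<in> W"
  by (auto simp: mem_plus_iff)

lemma mem_plus_pair: "v \<in> S + {0, x} \<longleftrightarrow> v \<in> S \<or> v + (x::'v::xor_group) \<in> S"
  by (metis add.commute mem_pair_plus)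

lemma mem_sp_insert: "v \<in> sp (insert x X) \<longleftrightarrow> v \<in> sp X \<or> v + x \<in> sp X"
  by (simp add: sp_insert mem_pair_plus)

text \<open>Subset sums are closed under addition, by passing to symmetric differences. Index sets
  are used because \<open>f\<close> may repeat a vector, as it does on parallel elements.\<close>

lemma sp_image_eq:
  assumes "finite X"
  shows "v \<in> sp (f ` X) \<longleftrightarrow> (\<exists>Y\<subseteq>X. v = sum f Y)"
proof
  have "subsp {v. \<exists>Y\<subseteq>X. v = sum f Y}"
    unfolding subsp_def
  proof (intro conjI ballI)
    show "0 \<in> {v. \<exists>Y\<subseteq>X. v = sum f Y}" by (auto intro!: exI[of _ "{}"])
    fix x y assume "x \<in> {v. \<exists>Y\<subseteq>X. v = sum f Y}" "y \<in> {v. \<exists>Y\<subseteq>X. v = sum f Y}"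
    then obtain A B where "A \<subseteq> X" "B \<subseteq> X" "x = sum f A" "y = sum f B" by auto
    moreover have "finite A" "finite B" using calculation assms finite_subset by blast+
    ultimately show "x + y \<in> {v. \<exists>Y\<subseteq>X. v = sum f Y}"
      using sum_symdiff[of A B f] by (intro CollectI exI[of _ "symdiff A B"]) auto
  qed
  moreover have "f ` X \<subseteq> {v. \<exists>Y\<subseteq>X. v = sum f Y}"
  proof
    fix v assume "v \<in> f ` X"
    then obtain x where "x \<in> X" "v = f x" by blast
    then show "v \<in> {v. \<exists>Y\<subseteq>X. v = sum f Y}"
      by (intro CollectI exI[of _ "{x}"]) simp
  qed
  ultimately have "sp (f ` X) \<subseteq> {v. \<exists>Y\<subseteq>X. v = sum f Y}" by (rule sp_least)
  then show "v \<in> sp (f ` X) \<Longrightarrow> \<exists>Y\<subseteq>X. v = sum f Y" by auto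
next
  assume "\<exists>Y\<subseteq>X. v = sum f Y"
  then show "v \<in> sp (f ` X)"
    by (elim exE conjE, simp, intro subsp_sum subsp_sp sp_incl) auto
qed

lemma sp_sums: "finite X \<Longrightarrow> v \<in> sp X \<longleftrightarrow> (\<exists>Y\<subseteq>X. v = \<Sum>Y)"
  using sp_image_eq[of X v "\<lambda>x. x"] by simp

lemma sum_in_sp: "Y \<subseteq> X \<Longrightarrow> \<Sum>Y \<in> sp X"
  by (intro subsp_sum subsp_sp sp_incl) auto

lemma finite_sp: "finite X \<Longrightarrow> finite (sp X)"
proof -
  assume "finite X"
  then have "sp X \<subseteq> (\<lambda>Y. \<Sum>Y) ` Pow X" by (auto simp: sp_sums)
  with \<open>finite X\<close> show ?thesis by (meson finite_Pow_iff finite_imageI finite_subset)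
qed

subsection \<open>Circuits relative to a subspace\<close>

text \<open>The circuits of the vectors read in the quotient by \<open>Q\<close>; a single vector of
  \<open>Q\<close> is a circuit, namely a loop.\<close>

definition circ :: "'v::xor_group set \<Rightarrow> 'v set \<Rightarrow> bool" where
  "circ Q C \<longleftrightarrow> finite C \<and> C \<noteq> {} \<and> \<Sum>C \<in> Q \<and> (\<forall>D. D \<subset> C \<longrightarrow> \<Sum>D \<in> Q \<longrightarrow> D = {})"

lemma circ_subset_eq: "circ Q C \<Longrightarrow> circ Q D \<Longrightarrow> D \<subseteq> C \<Longrightarrow> D = C"
  unfolding circ_def by blast

text \<open>A relation that is not minimal splits into two smaller relations, one of which still
  contains \<open>a\<close>.\<close>

lemma circ_contains:
  assumes "subsp Q" "finite A" "\<Sum>A \<in> Q" "a \<in> A"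
  shows "\<exists>C. circ Q C \<and> a \<in> C \<and> C \<subseteq> A"
  using assms(2-)
proof (induction "card A" arbitrary: A rule: less_induct)
  case less
  show ?case
  proof (cases "circ Q A")
    case False
    then obtain D where D: "D \<subset> A" "\<Sum>D \<in> Q" "D \<noteq> {}"
      using less.prems by (auto simp: circ_def)
    have fin: "finite D" "finite (A - D)" using D less.prems finite_subset by auto
    have "\<Sum>A = \<Sum>(A - D) + \<Sum>D"
      using D less.prems by (intro sum.subset_diff) auto
    then have "\<Sum>(A - D) \<in> Q"
      using subsp_add_cancel(2)[OF assms(1) D(2), of "\<Sum>(A-D)"] less.prems by simp
    moreover have "card D < card A" "card (A - D) < card A"
      using D less.prems by (auto intro!: psubset_card_mono)
    ultimately show ?thesis
      using less.hyps[of D] less.hyps[of "A - D"] D fin less.prems by blast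
  qed (use less.prems in auto)
qed

text \<open>Lying on a common circuit is transitive, as in any matroid. Cancelling the overlap of
  \<open>C1\<close> and \<open>C2\<close> leaves circuits \<open>D1\<close> through \<open>e\<close>
  and \<open>D2\<close> through \<open>b\<close>; by minimality each meets the other original
  circuit. If \<open>D1\<close> misses part of \<open>C1 - C2\<close>, then \<open>D1\<close> and
  \<open>C2\<close> have a smaller union. Otherwise \<open>D1\<close> and \<open>D2\<close> meet,
  and their union has lost the overlap.\<close>

lemma circ_trans:
  assumes "subsp Q" "circ Q C1" "circ Q C2" "C1 \<inter> C2 \<noteq> {}" "e \<in> C1" "b \<in> C2"
  shows "\<exists>C. circ Q C \<and> e \<in> C \<and> b \<in> C \<and> C \<subseteq> C1 \<union> C2"
  using assms(2-)
proof (induction "card (C1 \<union> C2)" arbitrary: C1 C2 rule: less_induct)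
  case less
  have fin: "finite C1" "finite C2" using less.prems by (auto simp: circ_def)
  have sums: "\<Sum>(symdiff C1 C2) \<in> Q"
    using sum_symdiff[of C1 C2 "\<lambda>x. x"] fin less.prems(1,2) assms(1) subsp_add by (auto simp: circ_def)
  consider "e \<in> C2" | "b \<in> C1" | "e \<notin> C2" "b \<notin> C1" by blast
  then show ?case
  proof cases
    case 3
    obtain D1 where D1: "circ Q D1" "e \<in> D1" "D1 \<subseteq> symdiff C1 C2"
      using circ_contains[OF assms(1) _ sums, of e] fin 3 less.prems by auto
    obtain D2 where D2: "circ Q D2" "b \<in> D2" "D2 \<subseteq> symdiff C1 C2"
      using circ_contains[OF assms(1) _ sums, of b] fin 3 less.prems by auto
    have D1': "D1 \<inter> C2 \<noteq> {}"
    proof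
      assume "D1 \<inter> C2 = {}"
      then have "D1 \<subseteq> C1" using D1 by auto
      then have "D1 = C1" using circ_subset_eq less.prems(1) D1(1) by blast
      then show False using \<open>D1 \<inter> C2 = {}\<close> less.prems by auto
    qed
    have D2': "D2 \<inter> C1 \<noteq> {}"
    proof
      assume "D2 \<inter> C1 = {}"
      then have "D2 \<subseteq> C2" using D2 by auto
      then have "D2 = C2" using circ_subset_eq less.prems(2) D2(1) by blast
      then show False using \<open>D2 \<inter> C1 = {}\<close> less.prems by auto
    qed
    show ?thesis
    proof (cases "C1 - C2 \<subseteq> D1")
      case False
      then have "D1 \<union> C2 \<subset> C1 \<union> C2" using D1 by auto
      then have "card (D1 \<union> C2) < card (C1 \<union> C2)" using fin by (auto intro: psubset_card_mono)
      from less.hyps[OF this D1(1) less.prems(2) D1' D1(2) less.prems(5)] D1(3) show ?thesis by blast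
    next
      case True
      then have "D1 \<inter> D2 \<noteq> {}" using D2' D2(3) by auto
      moreover have "D1 \<union> D2 \<subset> C1 \<union> C2" using D1 D2 less.prems(3) by auto
      then have "card (D1 \<union> D2) < card (C1 \<union> C2)" using fin by (auto intro: psubset_card_mono)
      ultimately show ?thesis
        using less.hyps[of D1 D2] D1 D2 by blast
    qed
  qed (use less.prems in blast)+
qed

text \<open>\<open>A1\<close> is the connected component of \<open>f\<close> modulo
  \<open>Q\<close>. No circuit runs between components, so a relation between the spans of
  \<open>A1\<close> and \<open>A2\<close> is trivial on each side.\<close>

lemma circ_split:
  assumes "subsp Q" "finite A" "f \<in> A" "g \<in> A" "f \<noteq> g"
    and no: "\<And>C. circ Q C \<Longrightarrow> C \<subseteq> A \<Longrightarrow> f \<in> C \<Longrightarrow> g \<notin> C"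
  obtains A1 A2 where "A = A1 \<union> A2" "A1 \<inter> A2 = {}" "f \<in> A1" "g \<in> A2"
    "\<And>v w. v \<in> sp A1 \<Longrightarrow> w \<in> sp A2 \<Longrightarrow> v + w \<in> Q \<Longrightarrow> v \<in> Q"
proof -
  define A1 where "A1 = {e\<in>A. e = f \<or> (\<exists>C. circ Q C \<and> C \<subseteq> A \<and> f \<in> C \<and> e \<in> C)}"
  define A2 where "A2 = A - A1"
  have fin: "finite A1" "finite A2" using assms by (auto simp: A1_def A2_def)
  \<comment> \<open>Induction on the size of \<open>Y1\<close>: a circuit of the relation through
    some \<open>y\<close> in \<open>Y1\<close> stays in the component by \<open>circ_trans\<close>,
    hence inside \<open>Y1\<close>, and can be removed.\<close>
  have *: "\<Sum>Y1 \<in> Q" if "Y1 \<subseteq> A1" "Y2 \<subseteq> A2" "\<Sum>Y1 + \<Sum>Y2 \<in> Q" for Y1 Y2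
    using that
  proof (induction "card Y1" arbitrary: Y1 rule: less_induct)
    case less
    have finY: "finite Y1" "finite Y2" using less.prems fin finite_subset by auto
    have disj: "Y1 \<inter> Y2 = {}" using less.prems by (auto simp: A2_def)
    have sumU: "\<Sum>(Y1 \<union> Y2) = \<Sum>Y1 + \<Sum>Y2" using finY disj by (intro sum.union_disjoint)
    show ?case
    proof (cases "Y1 = {}")
      case True then show ?thesis using assms(1) by (simp add: subsp_0)
    next
      case False
      then obtain y where y: "y \<in> Y1" by auto
      obtain D where D: "circ Q D" "y \<in> D" "D \<subseteq> Y1 \<union> Y2"
        using circ_contains[OF assms(1), of "Y1 \<union> Y2" y] finY sumU less.prems y by auto
      have "D \<subseteq> A" using D less.prems by (auto simp: A1_def A2_def)
      have "D \<subseteq> A1"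
      proof
        fix d assume d: "d \<in> D"
        show "d \<in> A1"
        proof (cases "y = f")
          case True then show ?thesis using D d \<open>D \<subseteq> A\<close> by (auto simp: A1_def)
        next
          case False
          then obtain C where C: "circ Q C" "C \<subseteq> A" "f \<in> C" "y \<in> C"
            using y less.prems by (auto simp: A1_def)
          then obtain C' where "circ Q C'" "f \<in> C'" "d \<in> C'" "C' \<subseteq> C \<union> D"
            using circ_trans[OF assms(1) C(1) D(1) _ C(3) d] D by blast
          moreover have "C' \<subseteq> A" using C \<open>D \<subseteq> A\<close> calculation by blast
          ultimately show ?thesis using \<open>D \<subseteq> A\<close> d unfolding A1_def by blast
        qed
      qed
      then have DY: "D \<subseteq> Y1" using D less.prems by (auto simp: A2_def)
      have s: "\<Sum>Y1 = \<Sum>(Y1 - D) + \<Sum>D" using DY finY by (intro sum.subset_diff)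
      have DQ: "\<Sum>D \<in> Q" using D by (simp add: circ_def)
      have "\<Sum>(Y1 - D) + \<Sum>Y2 \<in> Q"
        using less.prems(3) subsp_add_cancel(2)[OF assms(1) DQ, of "\<Sum>(Y1 - D) + \<Sum>Y2"] s by (simp add: ac_simps)
      moreover have "card (Y1 - D) < card Y1"
        using finY DY D y by (intro psubset_card_mono) auto
      ultimately have "\<Sum>(Y1 - D) \<in> Q"
        using less.hyps[of "Y1 - D"] less.prems by blast
      then show ?thesis using s DQ assms(1) subsp_add by auto
    qed
  qed
  show ?thesis
  proof
    show "A = A1 \<union> A2" "A1 \<inter> A2 = {}" "f \<in> A1" "g \<in> A2"
      using assms(3-5) no by (auto simp: A1_def A2_def)
    show "v \<in> Q" if "v \<in> sp A1" "w \<in> sp A2" "v + w \<in> Q" for v w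
      using that * fin by (auto simp: sp_sums)
  qed
qed

subsection \<open>Chordal sets of vectors\<close>

text \<open>The nested equivalence says that an odd number of its three sides is true. When 0 is in
  \<open>S\<close>, degenerate quadruples satisfy it automatically, so distinctness need not be
  required.\<close>

definition odd_diag :: "'v::xor_group set \<Rightarrow> bool" where
  "odd_diag S \<longleftrightarrow> (\<forall>x\<in>S. \<forall>y\<in>S. \<forall>w\<in>S. x + y + w \<in> S \<longrightarrow>
     (x + y \<in> S \<longleftrightarrow> (x + w \<in> S \<longleftrightarrow> y + w \<in> S)))"

definition odd_minors :: "'v::xor_group set \<Rightarrow> bool" where
  "odd_minors S \<longleftrightarrow> (\<forall>X\<subseteq>S. odd_diag (S + sp X))"

text \<open>As \<open>S1 \<inter> S2\<close> always lies in both spans, the condition of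
  \<open>glue\<close> makes it equal to the subspace \<open>sp S1 \<inter> sp S2\<close>: this is
  the common projective geometry.\<close>

inductive chordal :: "'v::xor_group set \<Rightarrow> bool" where
  subspace: "subsp W \<Longrightarrow> chordal W"
| glue: "chordal S1 \<Longrightarrow> chordal S2 \<Longrightarrow> sp S1 \<inter> sp S2 \<subseteq> S1 \<inter> S2 \<Longrightarrow> chordal (S1 \<union> S2)"

lemma odd_diagD:
  "odd_diag S \<Longrightarrow> x \<in> S \<Longrightarrow> y \<in> S \<Longrightarrow> w \<in> S \<Longrightarrow> x + y + w \<in> S \<Longrightarrow>
     (x + y \<in> S \<longleftrightarrow> (x + w \<in> S \<longleftrightarrow> y + w \<in> S))"
  unfolding odd_diag_def by blast

lemma chordal_0: "chordal S \<Longrightarrow> 0 \<in> S"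
  by (induction rule: chordal.induct) (auto simp: subsp_0)

lemma chordal_Int_subsp:
  assumes "chordal S" "subsp W" shows "chordal (S \<inter> W)"
  using assms(1)
proof (induction rule: chordal.induct)
  case (subspace V)
  then show ?case using assms(2) by (simp add: chordal.subspace subsp_Int)
next
  case (glue S1 S2)
  have "sp (S1 \<inter> W) \<inter> sp (S2 \<inter> W) \<subseteq> (S1 \<inter> W) \<inter> (S2 \<inter> W)"
    using glue.hyps(3) sp_mono[of "S1 \<inter> W" S1] sp_mono[of "S2 \<inter> W" S2]
      sp_least[OF assms(2), of "S1 \<inter> W"] by blast
  then have "chordal ((S1 \<inter> W) \<union> (S2 \<inter> W))"
    using glue.IH by (rule chordal.glue[rotated 2])
  then show ?case by (simp add: Int_Un_distrib2)
qed

text \<open>The alternative \<open>x \<notin> sp S\<close> is there for the induction: an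
  \<open>x\<close> of \<open>S1\<close> outside \<open>S2\<close> cannot lie in
  \<open>sp S2\<close>, because it would then lie in both spans.\<close>

lemma chordal_contract:
  assumes "chordal S" "x \<in> S \<or> x \<notin> sp S" shows "chordal (S + {0, x})"
  using assms
proof (induction rule: chordal.induct)
  case (subspace V)
  then show ?case by (intro chordal.subspace subsp_plus subsp_pair)
next
  case (glue S1 S2)
  have "S1 \<subseteq> sp S1" "S2 \<subseteq> sp S2" by (rule sp_superset)+
  moreover have "sp S1 \<subseteq> sp (S1 \<union> S2)" "sp S2 \<subseteq> sp (S1 \<union> S2)" by (intro sp_mono; blast)+
  ultimately have x12: "x \<in> S1 \<or> x \<notin> sp S1" "x \<in> S2 \<or> x \<notin> sp S2"
    using glue.prems glue.hyps(3) by blast+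
  have sp_plus: "v \<in> sp T \<or> v + x \<in> sp T" if "v \<in> sp (T + {0, x})" for v T
  proof -
    have "sp (T + {0, x}) \<subseteq> sp T + {0, x}"
      by (intro sp_least subsp_plus subsp_sp subsp_pair set_plus_mono2 sp_superset order_refl)
    then show ?thesis using that by (auto simp: mem_plus_pair)
  qed
  have "v \<in> (S1 + {0, x}) \<inter> (S2 + {0, x})"
    if v1: "v \<in> sp (S1 + {0, x})" and v2: "v \<in> sp (S2 + {0, x})" for v
  proof -
    have cancel: "v + x \<in> sp T \<longleftrightarrow> v \<in> sp T" if "x \<in> T" for T
      using that by (simp add: subsp_add_cancel(2)[OF subsp_sp sp_incl])
    \<comment> \<open>If the two sides see different lifts \<open>v\<close> and
      \<open>v + x\<close>, then \<open>x\<close> is in the span of the union and hence a member of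
      one side. On that side \<open>v\<close> and \<open>v + x\<close> may be exchanged, which
      produces a common lift.\<close>
    have "x \<in> S1 \<union> S2" if "v \<in> sp S1" "v + x \<in> sp S2"
    proof -
      have "v + (v + x) \<in> sp (S1 \<union> S2)"
        using that \<open>sp S1 \<subseteq> sp (S1 \<union> S2)\<close> \<open>sp S2 \<subseteq> sp (S1 \<union> S2)\<close> by (intro sp_add[of v _ "v + x"]) auto
      then show ?thesis using glue.prems by simp
    qed
    moreover have "x \<in> S1 \<union> S2" if "v \<in> sp S2" "v + x \<in> sp S1"
    proof -
      have "v + (v + x) \<in> sp (S1 \<union> S2)"
        using that \<open>sp S1 \<subseteq> sp (S1 \<union> S2)\<close> \<open>sp S2 \<subseteq> sp (S1 \<union> S2)\<close> by (intro sp_add[of v _ "v + x"]) auto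
      then show ?thesis using glue.prems by simp
    qed
    ultimately have "(v \<in> sp S1 \<and> v \<in> sp S2) \<or> (v + x \<in> sp S1 \<and> v + x \<in> sp S2)"
      using sp_plus[OF v1] sp_plus[OF v2] cancel[of S1] cancel[of S2] by blast
    then have "v \<in> S1 \<inter> S2 \<or> v + x \<in> S1 \<inter> S2" using glue.hyps(3) by blast
    then show ?thesis by (auto simp: mem_plus_pair)
  qed
  then have "chordal ((S1 + {0, x}) \<union> (S2 + {0, x}))"
    using glue.IH x12 by (intro chordal.glue) auto
  moreover have "(S1 + {0, x}) \<union> (S2 + {0, x}) = (S1 \<union> S2) + {0, x}"
    by (auto simp: mem_plus_pair)
  ultimately show ?case by simp
qed

text \<open>A 4-circuit lies on one side of the gluing or is split two and two. In the second case
  the diagonal joining the equal-sided pairs lies in both spans and so in \<open>S\<close>, and the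
  other two diagonals cross the separator and are absent.\<close>

lemma chordal_odd_diag: "chordal S \<Longrightarrow> odd_diag S"
proof (induction rule: chordal.induct)
  case (subspace W)
  then show ?case by (auto simp: odd_diag_def subsp_add)
next
  case (glue S1 S2)
  have sub: "S1 \<subseteq> sp S1" "S2 \<subseteq> sp S2" by (rule sp_superset)+
  have in1: "v \<in> S1 \<union> S2 \<longleftrightarrow> v \<in> S1" if "v \<in> sp S1" for v
    using that glue.hyps(3) sub by blast
  have in2: "v \<in> S1 \<union> S2 \<longleftrightarrow> v \<in> S2" if "v \<in> sp S2" for v
    using that glue.hyps(3) sub by blast
  show ?case
    unfolding odd_diag_def
  proof (intro ballI impI)
    fix x y w assume S: "x \<in> S1 \<union> S2" "y \<in> S1 \<union> S2" "w \<in> S1 \<union> S2" "x + y + w \<in> S1 \<union> S2"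
    define v where "v = x + y + w"
    have all_one: "x + y \<in> S1 \<union> S2 \<longleftrightarrow> (x + w \<in> S1 \<union> S2 \<longleftrightarrow> y + w \<in> S1 \<union> S2)"
      if "x \<in> sp T" "y \<in> sp T" "w \<in> sp T" "odd_diag T" "\<And>v. v \<in> sp T \<Longrightarrow> v \<in> S1 \<union> S2 \<longleftrightarrow> v \<in> T" for T
      using odd_diagD[OF that(4), of x y w] that S by (simp add: sp_add)
    have cross: "a + b \<notin> S1 \<union> S2"
      if "a \<in> sp S1" "a \<notin> sp S2" "b \<in> sp S2" "b \<notin> sp S1" for a b
      using subsp_add_cancel[OF subsp_sp that(1), of b] subsp_add_cancel[OF subsp_sp that(3), of a] that sub by blast
    have both: "a \<in> S1 \<union> S2" if "a \<in> sp S1" "a \<in> sp S2" for a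
      using that glue.hyps(3) by blast
    have side: "a \<in> sp S1 \<or> a \<in> sp S2" if "a \<in> S1 \<union> S2" for a
      using that sub by blast
    have add: "a \<in> sp T \<Longrightarrow> b \<in> sp T \<Longrightarrow> a + b \<in> sp T" for a b T by (rule sp_add)
    have v: "v \<in> S1 \<union> S2" "x + y = w + v" "x + w = y + v" "y + w = x + v"
      using S by (simp_all add: v_def ac_simps)
    \<comment> \<open>The four vectors sum to 0, so any three of them in a subspace bring in the
      fourth.\<close>
    have three: "x \<in> sp T \<and> y \<in> sp T \<and> w \<in> sp T"
      if "x \<in> sp T \<and> y \<in> sp T \<and> w \<in> sp T \<or> x \<in> sp T \<and> y \<in> sp T \<and> v \<in> sp T \<or>
         x \<in> sp T \<and> w \<in> sp T \<and> v \<in> sp T \<or> y \<in> sp T \<and> w \<in> sp T \<and> v \<in> sp T" for T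
      using that v(2-4) subsp_add_cancel[OF subsp_sp, of _ T] by metis
    show "x + y \<in> S1 \<union> S2 \<longleftrightarrow> (x + w \<in> S1 \<union> S2 \<longleftrightarrow> y + w \<in> S1 \<union> S2)"
    proof (cases "(x \<in> sp S1 \<and> y \<in> sp S1 \<and> w \<in> sp S1) \<or> (x \<in> sp S2 \<and> y \<in> sp S2 \<and> w \<in> sp S2)")
      case True
      then show ?thesis
        using all_one[of S1] all_one[of S2] glue.IH in1 in2 by blast
    next
      case False
      note s = side[OF S(1)] side[OF S(2)] side[OF S(3)] side[OF v(1)]
      consider "x \<in> sp S1" "y \<in> sp S1" "w \<in> sp S2" "v \<in> sp S2"
        | "x \<in> sp S2" "y \<in> sp S2" "w \<in> sp S1" "v \<in> sp S1"
        | "x \<in> sp S1" "w \<in> sp S1" "y \<in> sp S2" "v \<in> sp S2"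
        | "x \<in> sp S2" "w \<in> sp S2" "y \<in> sp S1" "v \<in> sp S1"
        | "y \<in> sp S1" "w \<in> sp S1" "x \<in> sp S2" "v \<in> sp S2"
        | "y \<in> sp S2" "w \<in> sp S2" "x \<in> sp S1" "v \<in> sp S1"
        using False three[of S1] three[of S2] s by metis
      then show ?thesis
      proof cases
        case 1
        then have "x + y \<in> S1 \<union> S2" using both add v by metis
        moreover have "x \<notin> sp S2" "y \<notin> sp S2" "w \<notin> sp S1" using 1 False three[of S1] three[of S2] by blast+
        ultimately show ?thesis using cross 1 by blast
      next
        case 2
        then have "x + y \<in> S1 \<union> S2" using both add v by metis
        moreover have "x \<notin> sp S1" "y \<notin> sp S1" "w \<notin> sp S2" using 2 False three[of S1] three[of S2] by blast+
        ultimately show ?thesis using cross[of w x] cross[of w y] 2 by (simp add: add.commute)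
      next
        case 3
        then have "x + w \<in> S1 \<union> S2" using both add v by metis
        moreover have "x \<notin> sp S2" "w \<notin> sp S2" "y \<notin> sp S1" using 3 False three[of S1] three[of S2] by blast+
        ultimately show ?thesis using cross[of x y] cross[of w y] 3 by (simp add: add.commute)
      next
        case 4
        then have "x + w \<in> S1 \<union> S2" using both add v by metis
        moreover have "x \<notin> sp S1" "w \<notin> sp S1" "y \<notin> sp S2" using 4 False three[of S1] three[of S2] by blast+
        ultimately show ?thesis using cross[of y x] cross[of y w] 4 by (simp add: add.commute)
      next
        case 5
        then have "y + w \<in> S1 \<union> S2" using both add v by metis
        moreover have "y \<notin> sp S2" "w \<notin> sp S2" "x \<notin> sp S1" using 5 False three[of S1] three[of S2] by blast+
        ultimately show ?thesis using cross[of y x] cross[of w x] 5 by (simp add: add.commute)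
      next
        case 6
        then have "y + w \<in> S1 \<union> S2" using both add v by metis
        moreover have "y \<notin> sp S1" "w \<notin> sp S1" "x \<notin> sp S2" using 6 False three[of S1] three[of S2] by blast+
        ultimately show ?thesis using cross[of x y] cross[of x w] 6 by (simp add: add.commute)
      qed
    qed
  qed
qed

lemma chordal_contract_sp:
  assumes "chordal S" "X \<subseteq> S" "finite X" shows "chordal (S + sp X)"
  using assms(3,2)
proof (induction X rule: finite_induct)
  case empty
  have "S + {0} = S" by simp
  then show ?case using assms(1) by (simp add: sp_empty)
next
  case (insert x X)
  have "chordal ((S + sp X) + {0, x})"
    using insert subset_plus[OF subsp_sp] by (intro chordal_contract) blast+
  moreover have "(S + sp X) + {0, x} = S + sp (insert x X)"
    by (simp add: sp_insert ac_simps)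
  ultimately show ?case by simp
qed

subsection \<open>Odd minors imply chordality\<close>

text \<open>For \<open>X\<close> inside \<open>W\<close> the modular law lets contraction and
  intersection commute: \<open>S \<inter> W + sp X\<close> is the part of \<open>S + sp X\<close> in
  \<open>W\<close>.\<close>

lemma odd_minors_Int_subsp:
  assumes "odd_minors S" "subsp W" shows "odd_minors (S \<inter> W)"
  unfolding odd_minors_def
proof (intro allI impI)
  fix X assume X: "X \<subseteq> S \<inter> W"
  have "sp X \<subseteq> W" using X assms(2) by (intro sp_least) auto
  then have eq: "v \<in> S \<inter> W + sp X \<longleftrightarrow> v \<in> S + sp X \<and> v \<in> W" for v
  proof -
    have "s \<in> W \<longleftrightarrow> v \<in> W" if "v + s \<in> W" for s
      using that subsp_add_cancel[OF assms(2)] by blast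
    then show ?thesis
      unfolding mem_plus_iff using \<open>sp X \<subseteq> W\<close> by blast
  qed
  have "odd_diag (S + sp X)" using assms(1) X by (auto simp: odd_minors_def)
  moreover have "x + y \<in> S \<inter> W + sp X \<longleftrightarrow> x + y \<in> S + sp X"
    if "x \<in> S \<inter> W + sp X" "y \<in> S \<inter> W + sp X" for x y
    using that subsp_add[OF assms(2)] by (simp only: eq) blast
  ultimately show "odd_diag (S \<inter> W + sp X)"
    unfolding odd_diag_def using eq by blast
qed

(* X is maximal such that f + g stays a non-element after contraction. *)
lemma odd_minors_corank_two:
  assumes "odd_minors S" "finite S" "f \<in> S" "g \<in> S" "f + g \<notin> S"
  obtains X where "X \<subseteq> S" "f + g \<notin> S + sp X"
    "\<And>s. s \<in> S \<Longrightarrow> s \<in> sp X \<or> s + f \<in> sp X \<or> s + g \<in> sp X"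
proof -
  define z where "z = f + g"
  define F where "F = {X. X \<subseteq> S \<and> z \<notin> S + sp X}"
  have "finite F" using assms(2) by (simp add: F_def)
  moreover have "{} \<in> F"
    using assms(5) by (auto simp: F_def sp_empty mem_plus_iff add_eq_0_iff_eq z_def)
  ultimately obtain X0 where X0: "X0 \<in> F" "\<forall>Y\<in>F. X0 \<subseteq> Y \<longrightarrow> X0 = Y"
    using finite_has_maximal[of F] by blast
  obtain X where X: "X \<subseteq> S" "z \<notin> S + sp X"
    and max: "\<And>Y. Y \<subseteq> S \<Longrightarrow> z \<notin> S + sp Y \<Longrightarrow> X \<subseteq> Y \<Longrightarrow> Y = X"
    using X0 that[of X0] unfolding F_def by blast
  define S' where "S' = S + sp X"
  have in_S': "v + r \<in> S' \<longleftrightarrow> v \<in> S'" if "r \<in> sp X" for v r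
    unfolding S'_def using that by (rule mem_plus_shift[OF subsp_sp])
  have SS': "S \<subseteq> S'" unfolding S'_def by (rule subset_plus[OF subsp_sp])
  have zS': "z \<notin> S'" using X by (simp add: S'_def)
  \<comment> \<open>By maximality, adding \<open>s\<close> to \<open>X\<close> makes
    \<open>z\<close> a member. As \<open>z\<close> is not in \<open>S'\<close>, its translate by
    \<open>s\<close> is, and \<open>s\<close> may be replaced by the congruent
    \<open>e\<close>.\<close>
  have shift: "e + z \<in> S'" if e: "e \<in> S'" "e \<notin> sp X" for e
  proof -
    obtain s where s: "s \<in> S" "e + s \<in> sp X" using e(1) by (auto simp: S'_def mem_plus_iff)
    have "s \<notin> sp X" using s(2) e(2) subsp_add_cancel(2)[OF subsp_sp, of s X e] by blast
    then have "insert s X \<noteq> X" by (metis insertI1 sp_incl)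
    then have "z \<in> S + sp (insert s X)" using max[of "insert s X"] X(1) s(1) by blast
    then have "z \<in> S' \<or> z + s \<in> S'"
      by (auto simp: S'_def mem_plus_iff mem_sp_insert ac_simps)
    then have "s + z \<in> S'" using zS' by (simp add: add.commute)
    then have "(s + z) + (e + s) \<in> S'" using in_S'[OF s(2)] by blast
    then show ?thesis by (simp add: ac_simps)
  qed
  have odd: "odd_diag S'" using assms(1) X(1) by (auto simp: odd_minors_def S'_def)
  \<comment> \<open>The circuit \<open>f, g, s, f + g + s\<close> lacks the diagonal
    \<open>f + g\<close>, so exactly one of \<open>f + s\<close> and \<open>g + s\<close> is in
    \<open>S'\<close>. But \<open>shift\<close> carries each of these to the other.\<close>
  have cover: "s \<in> sp X \<or> s + f \<in> sp X \<or> s + g \<in> sp X" if s: "s \<in> S" for s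
  proof (rule ccontr)
    assume *: "\<not> ?thesis"
    have fg: "f \<in> S'" "g \<in> S'" "s \<in> S'" using assms s SS' by auto
    have "f + g + s \<in> S'" using shift[OF fg(3)] * by (simp add: z_def ac_simps)
    then have "(f + s \<in> S') \<noteq> (g + s \<in> S')"
      using odd_diagD[OF odd fg] zS' by (simp add: z_def)
    moreover have "f + s \<in> S' \<Longrightarrow> f + s + z \<in> S'" "g + s \<in> S' \<Longrightarrow> g + s + z \<in> S'"
      using * shift[of "f + s"] shift[of "g + s"] by (simp_all add: add.commute)
    ultimately show False by (auto simp: z_def ac_simps)
  qed
  show ?thesis using that[of X] X cover by (simp add: z_def)
qed

text \<open>A separation along \<open>G\<close>: modulo \<open>G\<close> the spans of
  \<open>K\<close> and of the rest meet only in 0. As in a graph, \<open>K\<close> is one side of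
  the separator and may consist of several components.\<close>

definition part :: "'v::xor_group set \<Rightarrow> 'v set \<Rightarrow> 'v set \<Rightarrow> bool" where
  "part S G K \<longleftrightarrow> K \<subseteq> S - G \<and> K \<noteq> {} \<and> S - G - K \<noteq> {} \<and>
     (\<forall>v\<in>sp K. \<forall>w\<in>sp (S - K). v + w \<in> G \<longrightarrow> v \<in> G)"

lemma partD:
  assumes "part S G K" "subsp G" "v \<in> sp K" "w \<in> sp (S - K)" "v + w \<in> G"
  shows "v \<in> G" "w \<in> G"
proof -
  show "v \<in> G" using assms by (auto simp: part_def)
  then show "w \<in> G" using subsp_add_cancel(1)[OF assms(2), of v w] assms(5) by simp
qed

(* f, g, f + g represent the three nonzero cosets of H in G. By minimality of G and of K, some circuit
   modulo H inside K \<union> {f, g} contains both f and g; a shortest one is Y \<union> {a, b, f, g}. *)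
lemma minimal_part_shortcut:
  fixes S :: "'v::xor_group set"
  assumes S: "finite S" "0 \<in> S" and G: "G = sp X" and GS: "G \<subseteq> sp S"
    and min: "\<And>Y K. Y \<subseteq> S \<Longrightarrow> sp Y \<subset> G \<Longrightarrow> \<not> part S (sp Y) K"
    and K: "part S G K" and Kmin: "\<And>K'. K' \<subset> K \<Longrightarrow> \<not> part S G K'"
    and f: "f \<in> S" "f \<in> G" "f \<notin> H" and g: "g \<in> S" "g \<in> G" "g \<notin> H"
    and H: "H = sp X'" "X' \<subseteq> S" "H \<subseteq> G" and z: "f + g \<notin> S + H"
    and cosets: "\<And>v. v \<in> G \<Longrightarrow> v \<in> H \<or> v + f \<in> H \<or> v + g \<in> H \<or> v + (f + g) \<in> H"
  obtains Y a b where "Y \<subseteq> K" "a \<in> K" "b \<in> K" "a + b + (f + g) \<in> H + sp Y"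
    "a \<notin> G + sp Y" "sp Y \<inter> G = {0}" "f + g \<notin> S + (H + sp Y)"
proof -
  define z where "z = f + g"
  have subG: "subsp G" and subH: "subsp H" by (simp_all add: G H subsp_sp)
  note HG = subsetD[OF H(3)]
  have zG: "z \<in> G" using f g subsp_add[OF subG] by (simp add: z_def)
  have zH: "z \<notin> H" using z S(2) by (auto simp: z_def mem_plus_iff)
  have KS: "K \<subseteq> S - G" "K \<noteq> {}" "S - G - K \<noteq> {}" using K by (auto simp: part_def)
  have finK: "finite K" using S KS finite_subset by blast
  have fK: "f \<notin> K" "g \<notin> K" "f \<noteq> g" using KS f g zH subH by (auto simp: z_def subsp_0)
  \<comment> \<open>If all of \<open>K\<close> is on the side of \<open>f\<close>, then already the
    span of \<open>H\<close> and \<open>f\<close>, a proper subspace of \<open>G\<close>, separates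
    \<open>K\<close> from the rest, against the minimality of \<open>G\<close>.\<close>
  have one_side: False
    if sub: "K \<subseteq> A1" "f \<in> A1" "g \<in> A2" and fg: "f \<in> S" "f \<in> G" "f \<notin> H" "g \<in> G" "g \<notin> H" "f + g \<notin> H"
      and cosets: "\<And>v. v \<in> G \<Longrightarrow> v \<in> H \<or> v + f \<in> H \<or> v + g \<in> H \<or> v + (f + g) \<in> H"
      and split: "\<And>v w. v \<in> sp A1 \<Longrightarrow> w \<in> sp A2 \<Longrightarrow> v + w \<in> H \<Longrightarrow> v \<in> H" for A1 A2 f g
  proof -
    let ?Gf = "sp (insert f X')"
    have memGf: "v \<in> ?Gf \<longleftrightarrow> v \<in> H \<or> v + f \<in> H" for v
      by (simp add: mem_sp_insert H)
    have "?Gf \<subseteq> G"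
      using HG subsp_add_cancel(2)[OF subG fg(2)] memGf by blast
    moreover have "g \<notin> ?Gf" using fg by (simp add: memGf add.commute)
    ultimately have "?Gf \<subset> G" using fg(4) by blast
    moreover have "part S ?Gf K"
      unfolding part_def
    proof (intro conjI ballI impI)
      show "K \<subseteq> S - ?Gf" "K \<noteq> {}" "S - ?Gf - K \<noteq> {}" using KS \<open>?Gf \<subseteq> G\<close> by blast+
      fix v w assume vw: "v \<in> sp K" "w \<in> sp (S - K)" "v + w \<in> ?Gf"
      then have "v \<in> G" using partD(1)[OF K subG vw(1,2)] \<open>?Gf \<subseteq> G\<close> by blast
      moreover have vA: "v \<in> sp A1" "v + f \<in> sp A1" "g \<in> sp A2"
        using vw(1) sp_mono[OF sub(1)] sub by (blast intro: sp_add sp_incl)+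
      then have "v + g \<in> H \<Longrightarrow> v \<in> H" "v + f + g \<in> H \<Longrightarrow> v + f \<in> H" using split by blast+
      ultimately show "v \<in> ?Gf" using cosets[of v] by (auto simp: memGf add.assoc)
    qed
    ultimately show False using min[of "insert f X'" K] fg(1) H(2) by blast
  qed
  obtain C where C: "circ H C" "C \<subseteq> K \<union> {f, g}" "f \<in> C" "g \<in> C"
  proof (rule ccontr)
    assume "\<not> thesis"
    then have no: "\<And>C. circ H C \<Longrightarrow> C \<subseteq> K \<union> {f, g} \<Longrightarrow> f \<in> C \<Longrightarrow> g \<notin> C" using that by blast
    obtain A1 A2 where A: "K \<union> {f, g} = A1 \<union> A2" "A1 \<inter> A2 = {}" "f \<in> A1" "g \<in> A2"
      and split: "\<And>v w. v \<in> sp A1 \<Longrightarrow> w \<in> sp A2 \<Longrightarrow> v + w \<in> H \<Longrightarrow> v \<in> H"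
      using circ_split[OF subH _ _ _ \<open>f \<noteq> g\<close>, of "K \<union> {f, g}"] finK no by blast
    have split': "v \<in> H" if "v \<in> sp A2" "w \<in> sp A1" "v + w \<in> H" for v w
      using split[OF that(2,1)] that(3) subsp_add_cancel(2)[OF subH, of w v] by (simp add: add.commute)
    define K1 K2 where "K1 = K \<inter> A1" and "K2 = K \<inter> A2"
    have "K = K1 \<union> K2" "K1 \<inter> K2 = {}" using A by (auto simp: K1_def K2_def)
    consider "K2 = {}" | "K1 = {}" | "K1 \<noteq> {}" "K2 \<noteq> {}" by blast
    then show False
    proof cases
      case 1
      then have "K \<subseteq> A1" using A by (auto simp: K2_def)
      then show False
        using one_side[where ?A1.0 = A1 and ?A2.0 = A2 and f = f and g = g] A f g zH cosets split by (auto simp: z_def)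
    next
      case 2
      then have "K \<subseteq> A2" using A by (auto simp: K1_def)
      then show False
        using one_side[where ?A1.0 = A2 and ?A2.0 = A1 and f = g and g = f] A f g zH cosets split' by (auto simp: z_def add.commute)
    next
      case 3
      \<comment> \<open>If \<open>K\<close> meets both classes and no circuit joins them, its trace
        on one class is a smaller part.\<close>
      have "part S G K1"
        unfolding part_def
      proof (intro conjI ballI impI)
        show "K1 \<subseteq> S - G" "K1 \<noteq> {}" "S - G - K1 \<noteq> {}" using 3 KS \<open>K = K1 \<union> K2\<close> \<open>K1 \<inter> K2 = {}\<close> by blast+
        fix v w assume v: "v \<in> sp K1" and "w \<in> sp (S - K1)" and vw: "v + w \<in> G"
        moreover have "S - K1 = K2 \<union> (S - K)" using KS \<open>K = K1 \<union> K2\<close> \<open>K1 \<inter> K2 = {}\<close> by blast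
        ultimately obtain w1 w2 where w: "w = w1 + w2" "w1 \<in> sp K2" "w2 \<in> sp (S - K)"
          by (metis set_plus_elim sp_Un)
        have "v \<in> sp K" "w1 \<in> sp K" using v w(2) sp_mono[of K1 K] sp_mono[of K2 K] by (auto simp: \<open>K = K1 \<union> K2\<close>)
        then have "v + w1 \<in> G" using partD(1)[OF K subG _ w(3), of "v + w1"] vw w(1) by (simp add: sp_add add.assoc)
        then have "v + w1 \<in> H \<or> (v + f) + w1 \<in> H \<or> v + (w1 + g) \<in> H \<or> (v + f) + (w1 + g) \<in> H"
          using cosets[of "v + w1"] by (simp add: ac_simps)
        moreover have "v \<in> sp A1" "v + f \<in> sp A1" "w1 \<in> sp A2" "w1 + g \<in> sp A2"
          using v w(2) A(3,4) sp_mono[of K1 A1] sp_mono[of K2 A2] unfolding K1_def K2_def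
          by (blast intro: sp_add sp_incl)+
        ultimately have "v \<in> H \<or> v + f \<in> H" using split by blast
        then show "v \<in> G" using HG subsp_add_cancel(2)[OF subG f(2)] by blast
      qed
      then show False using Kmin[of K1] 3 \<open>K = K1 \<union> K2\<close> \<open>K1 \<inter> K2 = {}\<close> by blast
    qed
  qed
  \<comment> \<open>The analogue of an induced path through \<open>K\<close>: with \<open>z\<close>
    it closes up modulo \<open>H\<close>, and no proper nonempty subset sums into the
    separator.\<close>
  define path where "path Y \<longleftrightarrow> Y \<subseteq> K \<and> \<Sum>Y + z \<in> H \<and> (\<forall>D. D \<subset> Y \<longrightarrow> \<Sum>D \<in> G \<longrightarrow> D = {})" for Y
  have finC: "finite C" and CH: "\<Sum>C \<in> H" and Cmin: "\<And>D. D \<subset> C \<Longrightarrow> \<Sum>D \<in> H \<Longrightarrow> D = {}"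
    using C(1) by (auto simp: circ_def)
  have "path (C - {f, g})"
    unfolding path_def
  proof (intro conjI allI impI)
    show "C - {f, g} \<subseteq> K" using C by blast
    have "\<Sum>C = \<Sum>(C - {f, g}) + \<Sum>{f, g}" using finC C by (intro sum.subset_diff) auto
    then show "\<Sum>(C - {f, g}) + z \<in> H" using CH \<open>f \<noteq> g\<close> by (simp add: z_def)
    \<comment> \<open>A partial sum in \<open>G\<close> lies in one of the four cosets of
      \<open>H\<close>. Adding \<open>f\<close>, \<open>g\<close>, both or neither moves it into
      \<open>H\<close>, which the minimality of \<open>C\<close> forbids.\<close>
    fix D assume D: "D \<subset> C - {f, g}" "\<Sum>D \<in> G"
    have finD: "finite D" using D finC finite_subset by blast
    have fgD: "f \<notin> D" "g \<notin> D" using D(1) by blast+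
    have "\<Sum>D + f = \<Sum>(insert f D)" "\<Sum>D + g = \<Sum>(insert g D)" "\<Sum>D + (f + g) = \<Sum>(insert f (insert g D))"
      using finD fgD \<open>f \<noteq> g\<close> by (simp_all add: ac_simps)
    then have "\<Sum>D \<in> H \<or> \<Sum>(insert f D) \<in> H \<or> \<Sum>(insert g D) \<in> H \<or> \<Sum>(insert f (insert g D)) \<in> H"
      using cosets[OF D(2)] by simp
    moreover have "D \<subset> C" "insert f D \<subset> C" "insert g D \<subset> C" "insert f (insert g D) \<subset> C"
      using D(1) C(3,4) \<open>f \<noteq> g\<close> by blast+
    ultimately have "D = {} \<or> insert f D = {} \<or> insert g D = {} \<or> insert f (insert g D) = {}"
      using Cmin by meson
    then show "D = {}" by simp
  qed
  then obtain Y where Y: "path Y" and Ymin: "\<And>Z. path Z \<Longrightarrow> card Y \<le> card Z"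
    using arg_min_nat_lemma[of path "C - {f, g}" card] by blast
  have YK: "Y \<subseteq> K" and Yz: "\<Sum>Y + z \<in> H" and Yind: "\<And>D. D \<subset> Y \<Longrightarrow> \<Sum>D \<in> G \<Longrightarrow> D = {}"
    using Y by (auto simp: path_def)
  have finY: "finite Y" using YK finK finite_subset by blast
  have "Y \<noteq> {}" using Yz zH by auto
  moreover have "Y \<noteq> {y}" for y
  proof
    assume "Y = {y}"
    then have "z + y \<in> H" "y \<in> S" using Yz YK KS by (auto simp: add.commute)
    then show False using z by (auto simp: z_def mem_plus_iff)
  qed
  ultimately obtain a b where ab: "a \<in> Y" "b \<in> Y" "a \<noteq> b" by blast
  \<comment> \<open>A path has at least two elements, because \<open>z\<close> is not in
    \<open>S + H\<close>. All but two are contracted, and these two form a triangle with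
    \<open>z\<close>.\<close>
  define R where "R = Y - {a, b}"
  have finR: "finite R" using finY by (simp add: R_def)
  have "\<Sum>Y = \<Sum>R + \<Sum>{a, b}" unfolding R_def using finY ab by (intro sum.subset_diff) auto
  then have Yab: "\<Sum>Y = \<Sum>R + (a + b)" using ab by simp
  have RG: "Z = {}" if "Z \<subseteq> R" "\<Sum>Z \<in> G" for Z
    using that ab Yind[of Z] by (auto simp: R_def)
  show ?thesis
  proof (rule that)
    show "R \<subseteq> K" "a \<in> K" "b \<in> K" using YK ab by (auto simp: R_def)
    show "a + b + (f + g) \<in> H + sp R"
      unfolding mem_plus_iff
      using Yz Yab by (intro bexI[of _ "\<Sum>Y + z"]) (auto simp: z_def ac_simps intro!: sum_in_sp)
    show "a \<notin> G + sp R"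
    proof
      assume "a \<in> G + sp R"
      then obtain Z where Z: "Z \<subseteq> R" "a + \<Sum>Z \<in> G"
        using finR by (auto simp: add.commute[of G] mem_plus_iff sp_sums)
      then have "\<Sum>(insert a Z) \<in> G" using finR finite_subset by (subst sum.insert) (auto simp: R_def)
      moreover have "insert a Z \<subset> Y" using Z ab by (auto simp: R_def)
      ultimately show False using Yind by blast
    qed
    show "sp R \<inter> G = {0}"
    proof (intro equalityI subsetI)
      fix v assume "v \<in> sp R \<inter> G"
      then obtain Z where "Z \<subseteq> R" "v = \<Sum>Z" "\<Sum>Z \<in> G" using finR by (auto simp: sp_sums)
      then have "Z = {}" using RG by blast
      then show "v \<in> {0}" using \<open>v = \<Sum>Z\<close> by simp
    qed (simp add: zero_in_sp subsp_0[OF subG])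
    \<comment> \<open>A witness \<open>s\<close> would be a shortcut: it lies in \<open>K\<close>
      and forms, with a subset of \<open>R\<close>, a path that has fewer elements than
      \<open>Y\<close>.\<close>
    show "f + g \<notin> S + (H + sp R)"
    proof
      assume "f + g \<in> S + (H + sp R)"
      then obtain s Z where s: "s \<in> S" "Z \<subseteq> R" "z + s + \<Sum>Z \<in> H"
        using finR by (auto simp: z_def mem_plus_iff add.commute[of H] sp_sums)
      have finZ: "finite Z" using s(2) finR finite_subset by blast
      have ZK: "Z \<subseteq> K" using s(2) YK by (auto simp: R_def)
      have sZ: "s + \<Sum>Z \<in> G"
        using HG[OF s(3)] subsp_add_cancel(1)[OF subG zG, of "s + \<Sum>Z"] by (simp add: ac_simps)
      have "s \<in> K"
      proof (rule ccontr)
        assume "s \<notin> K"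
        then have "\<Sum>Z \<in> G"
          using partD(1)[OF K subG, of "\<Sum>Z" s] s(1) sZ ZK by (simp add: sum_in_sp sp_incl add.commute)
        then have "Z = {}" using RG s(2) by blast
        then show False using s z by (auto simp: z_def mem_plus_iff)
      qed
      have "s \<notin> Z"
      proof
        assume "s \<in> Z"
        then have eq: "\<Sum>(Z - {s}) = s + \<Sum>Z" using finZ sum.remove[of Z s "\<lambda>x. x"] by simp
        then have "Z - {s} = {}" using RG[of "Z - {s}"] sZ s(2) by auto
        then have "s + \<Sum>Z = 0" using eq by (metis sum.empty)
        then show False using s(3) zH by (simp add: add.assoc)
      qed
      have "path (insert s Z)"
        unfolding path_def
      proof (intro conjI allI impI)
        show "insert s Z \<subseteq> K" using \<open>s \<in> K\<close> ZK by blast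
        show "\<Sum>(insert s Z) + z \<in> H" using s(3) finZ \<open>s \<notin> Z\<close> by (simp add: ac_simps)
        fix D assume D: "D \<subset> insert s Z" "\<Sum>D \<in> G"
        show "D = {}"
        proof (cases "s \<in> D")
          case False
          then have "D \<subseteq> R" using D s(2) by blast
          then show ?thesis using RG D(2) by blast
        next
          case True
          define D' where "D' = D - {s}"
          have D': "D = insert s D'" "s \<notin> D'" "D' \<subset> Z" using True D \<open>s \<notin> Z\<close> by (auto simp: D'_def)
          have "finite D'" using D' finZ finite_subset by blast
          then have "\<Sum>D = s + \<Sum>D'" using D' by simp
          moreover have "\<Sum>Z = \<Sum>(Z - D') + \<Sum>D'" using D' finZ by (intro sum.subset_diff) auto
          \<comment> \<open>The complement of \<open>D\<close> in the new path also sums into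
            \<open>G\<close> and lies in \<open>R\<close>, so it is empty.\<close>
          ultimately have "\<Sum>(Z - D') = (s + \<Sum>Z) + \<Sum>D" by (simp add: ac_simps)
          then have "\<Sum>(Z - D') \<in> G" using subsp_add[OF subG sZ D(2)] by simp
          then have "Z - D' = {}" using RG s(2) by blast
          then show ?thesis using D' by blast
        qed
      qed
      moreover have "card (insert s Z) < card Y"
      proof -
        have "R \<subset> Y - {a}" using ab by (auto simp: R_def)
        then have "card R < card (Y - {a})" using finY by (intro psubset_card_mono) auto
        moreover have "card (Y - {a}) < card Y" using finY ab by (intro psubset_card_mono) auto
        ultimately have "Suc (card R) < card Y" by linarith
        moreover have "card Z \<le> card R" using s(2) finR by (rule card_mono[rotated])
        ultimately show ?thesis using finZ \<open>s \<notin> Z\<close> by simp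
      qed
      ultimately show False using Ymin[of "insert s Z"] by simp
    qed
  qed
qed

text \<open>Some separator exists: \<open>S\<close> is covered by the span of \<open>X\<close> with
  \<open>f\<close> and the span of \<open>X\<close> with \<open>g\<close>, which meet only in
  \<open>sp X\<close>. The elements congruent to \<open>f\<close> form one side.\<close>

lemma corank_two_part:
  fixes S :: "'v::xor_group set"
  assumes "odd_minors S" "finite S" "0 \<in> S" "f \<in> S" "g \<in> S" "f + g \<notin> S"
  shows "\<exists>X K. X \<subseteq> S \<and> part S (sp X) K"
proof -
  obtain X where X: "X \<subseteq> S" "f + g \<notin> S + sp X"
    and cover: "\<And>s. s \<in> S \<Longrightarrow> s \<in> sp X \<or> s + f \<in> sp X \<or> s + g \<in> sp X"
    using odd_minors_corank_two[OF assms(1,2,4,5,6)] by blast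
  have fX: "f \<notin> sp X" and gX: "g \<notin> sp X" and fgX: "f + g \<notin> sp X"
    using X(2) assms(3-5) by (auto simp: mem_plus_iff ac_simps)
  define K where "K = {s\<in>S. s \<notin> sp X \<and> s + f \<in> sp X}"
  have "part S (sp X) K"
    unfolding part_def
  proof (intro conjI ballI impI)
    show "K \<subseteq> S - sp X" by (auto simp: K_def)
    have "f \<in> K" using fX assms(4) by (simp add: K_def zero_in_sp)
    then show "K \<noteq> {}" by blast
    have "g \<in> S - sp X - K" using gX fgX assms(5) by (auto simp: K_def add.commute)
    then show "S - sp X - K \<noteq> {}" by blast
    fix v w assume v: "v \<in> sp K" and w: "w \<in> sp (S - K)" and vw: "v + w \<in> sp X"
    have "sp K \<subseteq> sp (insert f X)"
      by (intro sp_least subsp_sp) (auto simp: K_def mem_sp_insert)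
    moreover have "sp (S - K) \<subseteq> sp (insert g X)"
      using cover by (intro sp_least subsp_sp) (unfold K_def, blast intro: mem_sp_insert[THEN iffD2])
    ultimately have "v \<in> sp X \<or> v + f \<in> sp X" and wg: "w \<in> sp X \<or> w + g \<in> sp X"
      using v w by (auto simp: mem_sp_insert)
    moreover have False if "v + f \<in> sp X"
    proof -
      have "w + f \<in> sp X" using sp_add[OF that vw] by (simp add: ac_simps)
      then show False
        using wg fX fgX sp_add[of w X "w + f"] sp_add[of "w + g" X "w + f"] by (auto simp: ac_simps)
    qed
    ultimately show "v \<in> sp X" by blast
  qed
  then show ?thesis using X(1) by blast
qed

text \<open>Members of \<open>S\<close> inside \<open>G\<close> vanish modulo \<open>G\<close>, on
  whichever side they are counted. Thus a shortcut can be found on both sides.\<close>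

lemma part_complement:
  assumes "part S G K" "subsp G"
  shows "part S G (S - G - K)"
  unfolding part_def
proof (intro conjI ballI impI)
  show "S - G - K \<subseteq> S - G" "S - G - K \<noteq> {}" "S - G - (S - G - K) \<noteq> {}"
    using assms(1) by (auto simp: part_def)
  fix v w assume v: "v \<in> sp (S - G - K)" and w: "w \<in> sp (S - (S - G - K))" and vw: "v + w \<in> G"
  have "K \<subseteq> S - G" using assms(1) by (simp add: part_def)
  then have "S - (S - G - K) = K \<union> (S \<inter> G)" by blast
  then obtain w1 w2 where "w = w1 + w2" "w1 \<in> sp K" "w2 \<in> sp (S \<inter> G)"
    using w by (metis set_plus_elim sp_Un)
  moreover have "w2 \<in> G" using sp_least[OF assms(2), of "S \<inter> G"] calculation by blast
  moreover have "v \<in> sp (S - K)" using v sp_mono[of "S - G - K" "S - K"] by blast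
  ultimately show "v \<in> G"
    using partD(2)[OF assms(1,2), of w1 v] vw subsp_add_cancel(2)[OF assms(2), of w2 "v + w1"]
    by (simp add: ac_simps)
qed

lemma minimal_part:
  assumes "part S G K" "finite S"
  obtains L where "L \<subseteq> K" "part S G L" "\<And>K'. K' \<subset> L \<Longrightarrow> \<not> part S G K'"
proof -
  have "finite K" using assms finite_subset by (auto simp: part_def)
  then have "finite {L. L \<subseteq> K \<and> part S G L}" by simp
  moreover have "K \<in> {L. L \<subseteq> K \<and> part S G L}" using assms(1) by simp
  ultimately obtain L where "L \<in> {L. L \<subseteq> K \<and> part S G L}" "\<forall>K'\<in>{L. L \<subseteq> K \<and> part S G L}. K' \<subseteq> L \<longrightarrow> L = K'"
    using finite_has_minimal[of "{L. L \<subseteq> K \<and> part S G L}"] by blast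
  then show ?thesis using that[of L] by blast
qed

(* Modulo H + sp Y + sp Y' the two shortcuts form the circuit {a, b, a', b'}, which has no diagonals. *)
lemma crossing_circuit_not_odd:
  fixes S :: "'v::xor_group set"
  assumes odd: "odd_minors S" and subG: "subsp G" and K: "part S G K" and L: "L \<subseteq> S - G - K"
    and H: "H = sp X" "X \<subseteq> S" "H \<subseteq> G" and zG: "z \<in> G"
    and Y: "Y \<subseteq> K" "a \<in> K" "b \<in> K" "a + b + z \<in> H + sp Y"
      "a \<notin> G + sp Y" "sp Y \<inter> G = {0}" "z \<notin> S + (H + sp Y)"
    and Y': "Y' \<subseteq> L" "a' \<in> L" "b' \<in> L" "a' + b' + z \<in> H + sp Y'"
      "a' \<notin> G + sp Y'" "sp Y' \<inter> G = {0}" "z \<notin> S + (H + sp Y')"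
  shows False
proof -
  have subH: "subsp H" by (simp add: H subsp_sp)
  have KS: "K \<subseteq> S - G" using K by (simp add: part_def)
  define R where "R = sp (X \<union> Y \<union> Y')"
  have R_eq: "R = H + sp Y + sp Y'" by (simp add: R_def sp_Un H)
  have subR: "subsp R" by (simp add: R_def subsp_sp)
  have HYR: "H + sp Y \<subseteq> R" "H + sp Y' \<subseteq> R"
    unfolding R_def H sp_Un[symmetric] by (intro sp_mono; blast)+
  have "X \<union> Y \<union> Y' \<subseteq> S" using H(2) Y(1) Y'(1) KS L by blast
  then have odd': "odd_diag (S + R)" using odd by (auto simp: odd_minors_def R_def)
  have memR: "\<exists>s\<in>S. \<exists>y\<in>sp Y. \<exists>y'\<in>sp Y'. v + s + y + y' \<in> H" if v: "v \<in> S + R" for v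
  proof -
    obtain s where s: "s \<in> S" "v + s \<in> R" using v by (auto simp: mem_plus_iff)
    then obtain h y y' where "v + s = h + y + y'" "h \<in> H" "y \<in> sp Y" "y' \<in> sp Y'"
      unfolding R_eq by (metis set_plus_elim)
    then show ?thesis using s(1) by (intro bexI[of _ s] bexI[of _ y] bexI[of _ y']) (simp_all add: ac_simps)
  qed
  have YK: "sp Y \<subseteq> sp K" "sp Y' \<subseteq> sp (S - K)" using Y(1) Y'(1) L by (intro sp_mono; blast)+
  have in_spK: "v \<in> sp K" if "v \<in> K" for v using that by (rule sp_incl)
  have in_spL: "v \<in> sp (S - K)" if "v \<in> S" "v \<notin> K" for v using that by (auto intro: sp_incl)
  have zR: "z \<notin> S + R"
  \<comment> \<open>The witness \<open>s\<close> counts for one side, so the contribution of the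
    opposite shortcut lies in \<open>G\<close> and is 0, as \<open>sp Y\<close> and
    \<open>sp Y'\<close> meet \<open>G\<close> trivially. What remains is excluded by the hypothesis
    on a single side.\<close>
  proof
    assume "z \<in> S + R"
    then obtain s y y' where s: "s \<in> S" "y \<in> sp Y" "y' \<in> sp Y'" "z + s + y + y' \<in> H"
      using memR by blast
    then have G: "s + y + y' \<in> G"
      using H(3) subsp_add_cancel(1)[OF subG zG, of "s + y + y'"] by (auto simp: ac_simps)
    show False
    proof (cases "s \<in> K")
      case True
      then have "y' \<in> G"
        using partD(2)[OF K subG, of "s + y" y'] s YK G in_spK by (auto intro: sp_add)
      then have "y' = 0" using Y'(6) s by blast
      then have "z \<in> S + (H + sp Y)" using s by (auto simp: mem_plus_iff add.commute[of H])
      then show False using Y(7) by blast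
    next
      case False
      then have "y \<in> G"
        using partD(1)[OF K subG, of y "s + y'"] s YK G in_spL by (auto intro: sp_add simp: ac_simps)
      then have "y = 0" using Y(6) s by blast
      then have "z \<in> S + (H + sp Y')" using s by (auto simp: mem_plus_iff add.commute[of H])
      then show False using Y'(7) by blast
    qed
  qed
  \<comment> \<open>For the crossing diagonals the separation isolates \<open>c\<close> or
    \<open>a'\<close>, whichever is on the side without the witness \<open>s\<close>; but neither
    becomes an element of \<open>G\<close> after adding its own shortcut.\<close>
  have a'K: "a' \<in> S" "a' \<notin> K" using Y'(2) L by auto
  have cross: "c + a' \<notin> S + R" if c: "c \<in> K" "c \<notin> G + sp Y" for c
  proof
    assume "c + a' \<in> S + R"
    then obtain s y y' where s: "s \<in> S" "y \<in> sp Y" "y' \<in> sp Y'" "c + a' + s + y + y' \<in> H"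
      using memR by blast
    then have G: "c + a' + s + y + y' \<in> G" using H(3) by blast
    show False
    proof (cases "s \<in> K")
      case True
      then have "a' + y' \<in> G"
        using partD(2)[OF K subG, of "c + s + y" "a' + y'"] s YK G in_spK c in_spL a'K
        by (auto intro!: sp_add simp: ac_simps)
      then show False using Y'(5) s(3) by (auto simp: add.commute[of G] mem_plus_iff)
    next
      case False
      then have "c + y \<in> G"
        using partD(1)[OF K subG, of "c + y" "a' + s + y'"] s YK G in_spK c in_spL a'K
        by (auto intro!: sp_add simp: ac_simps)
      then show False using c(2) s(2) by (auto simp: add.commute[of G] mem_plus_iff)
    qed
  qed
  have bG: "b \<notin> G + sp Y"
  proof
    assume "b \<in> G + sp Y"
    moreover have "a + b + z \<in> G + sp Y" using Y(4) H(3) set_plus_mono2[of H G "sp Y" "sp Y"] by blast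
    moreover have "z \<in> G + sp Y" using zG subset_plus[OF subsp_sp] by blast
    ultimately have "(a + b + z) + (b + z) \<in> G + sp Y"
      using subsp_add[OF subsp_plus[OF subG subsp_sp[of Y]]] by blast
    then show False using Y(5) by (simp add: ac_simps)
  qed
  have SR: "S \<subseteq> S + R" by (rule subset_plus[OF subR])
  have abz: "a + b + z \<in> R" and abz': "a' + b' + z \<in> R" using Y(4) Y'(4) HYR by blast+
  \<comment> \<open>Both \<open>a + b\<close> and \<open>a' + b'\<close> are congruent to
    \<open>z\<close>, so the fourth vector of the circuit is \<open>b'\<close> and the diagonal
    \<open>a + b\<close> amounts to \<open>z\<close>.\<close>
  have "a + b + a' \<in> S + R"
    unfolding mem_plus_iff
  proof
    show "b' \<in> S" using Y'(3) L by blast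
    show "a + b + a' + b' \<in> R" using subsp_add[OF subR abz abz'] by (simp add: ac_simps)
  qed
  moreover have "a + b \<notin> S + R"
    using mem_plus_shift[OF subR abz, of z S] zR by (simp add: ac_simps)
  ultimately show False
    using odd_diagD[OF odd', of a b a'] cross[OF Y(2,5)] cross[OF Y(3) bG] SR Y(2,3) KS a'K by blast
qed

theorem odd_minors_chordal:
  fixes S :: "'v::xor_group set"
  assumes "finite S" "0 \<in> S" "odd_minors S"
  shows "chordal S"
  using assms
proof (induction "card S" arbitrary: S rule: less_induct)
  case less
  show ?case
  proof (cases "subsp S")
    case False
    then obtain f g where fg: "f \<in> S" "g \<in> S" "f + g \<notin> S" using less.prems(2) by (auto simp: subsp_def)
    define sep where "sep X \<longleftrightarrow> X \<subseteq> S \<and> (\<exists>K. part S (sp X) K)" for X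
    obtain X0 where "sep X0"
      using corank_two_part[OF less.prems(3,1,2) fg] by (auto simp: sep_def)
    then obtain X where X: "sep X" and Xmin: "\<And>Y. sep Y \<Longrightarrow> card (sp X) \<le> card (sp Y)"
      using arg_min_nat_lemma[of sep _ "\<lambda>X. card (sp X)"] by blast
    define G where "G = sp X"
    have XS: "X \<subseteq> S" using X by (simp add: sep_def)
    have subG: "subsp G" by (simp add: G_def subsp_sp)
    have finG: "finite G" using finite_sp finite_subset[OF XS less.prems(1)] by (simp add: G_def)
    have GS: "G \<subseteq> sp S" using XS by (simp add: G_def sp_mono)
    obtain K0 where K0: "part S G K0" using X by (auto simp: sep_def G_def)
    have min: "\<not> part S (sp Y) K" if "Y \<subseteq> S" "sp Y \<subset> G" for Y K
      using Xmin[of Y] psubset_card_mono[OF finG that(2)] that(1) by (auto simp: sep_def G_def)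
    have "G \<subseteq> S"
    proof (rule ccontr)
      assume "\<not> G \<subseteq> S"
      have "\<not> subsp (S \<inter> G)"
      proof
        assume "subsp (S \<inter> G)"
        moreover have "X \<subseteq> S \<inter> G" using XS sp_superset by (auto simp: G_def)
        ultimately show False using \<open>\<not> G \<subseteq> S\<close> sp_least by (auto simp: G_def)
      qed
      then obtain f g where fg: "f \<in> S \<inter> G" "g \<in> S \<inter> G" "f + g \<notin> S \<inter> G"
        using less.prems(2) subsp_0[OF subG] by (auto simp: subsp_def)
      then have zG: "f + g \<in> G" using subsp_add[OF subG] by blast
      obtain X' where X': "X' \<subseteq> S \<inter> G" "f + g \<notin> S \<inter> G + sp X'"
        and cover: "\<And>s. s \<in> S \<inter> G \<Longrightarrow> s \<in> sp X' \<or> s + f \<in> sp X' \<or> s + g \<in> sp X'"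
        using odd_minors_corank_two[OF odd_minors_Int_subsp[OF less.prems(3) subG] _ fg] less.prems(1) by blast
      have HG: "sp X' \<subseteq> G" using X'(1) by (intro sp_least[OF subG]) blast
      \<comment> \<open>\<open>X'\<close> was chosen inside \<open>S \<inter> G\<close>; any witness
        from \<open>S\<close> would automatically lie in \<open>G\<close>.\<close>
      have z: "f + g \<notin> S + sp X'"
      proof
        assume "f + g \<in> S + sp X'"
        then obtain s where s: "s \<in> S" "f + g + s \<in> sp X'" by (auto simp: mem_plus_iff)
        then have "s \<in> G" using HG subsp_add_cancel(1)[OF subG zG, of s] by blast
        then show False using X'(2) s by (auto simp: mem_plus_iff)
      qed
      have fH: "f \<notin> sp X'" "g \<notin> sp X'" using z fg by (auto simp: mem_plus_iff ac_simps)
      \<comment> \<open>The generators of \<open>G\<close> lie in three cosets of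
        \<open>sp X'\<close>, so \<open>G\<close> has rank two over it, as the shortcut lemma
        requires.\<close>
      have "sp X \<subseteq> sp (insert f (insert g X'))"
        using cover XS sp_superset[of X]
        by (intro sp_least subsp_sp) (auto simp: mem_sp_insert G_def subset_iff ac_simps)
      then have cosets: "v \<in> sp X' \<or> v + f \<in> sp X' \<or> v + g \<in> sp X' \<or> v + (f + g) \<in> sp X'" if "v \<in> G" for v
        using that by (auto simp: G_def mem_sp_insert ac_simps)
      obtain K where K: "part S G K" and Kmin: "\<And>K'. K' \<subset> K \<Longrightarrow> \<not> part S G K'"
        using minimal_part[OF K0 less.prems(1)] by blast
      have "part S G (S - G - K)" using part_complement[OF K subG] by blast
      then obtain L where L: "L \<subseteq> S - G - K" "part S G L" and Lmin: "\<And>K'. K' \<subset> L \<Longrightarrow> \<not> part S G K'"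
        using minimal_part[OF _ less.prems(1)] by blast
      have X'S: "X' \<subseteq> S" using X'(1) by blast
      have fg': "f \<in> S" "f \<in> G" "g \<in> S" "g \<in> G" using fg by auto
      note shortcut = minimal_part_shortcut[OF less.prems(1,2) G_def GS min _ _ fg'(1,2) fH(1) fg'(3,4) fH(2) HOL.refl X'S HG z cosets]
      obtain Y a b where Y: "Y \<subseteq> K" "a \<in> K" "b \<in> K" "a + b + (f + g) \<in> sp X' + sp Y"
          "a \<notin> G + sp Y" "sp Y \<inter> G = {0}" "f + g \<notin> S + (sp X' + sp Y)"
        using shortcut[OF _ _ K Kmin] by blast
      obtain Y' a' b' where Y': "Y' \<subseteq> L" "a' \<in> L" "b' \<in> L" "a' + b' + (f + g) \<in> sp X' + sp Y'"
          "a' \<notin> G + sp Y'" "sp Y' \<inter> G = {0}" "f + g \<notin> S + (sp X' + sp Y')"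
        using shortcut[OF _ _ L(2) Lmin] by blast
      show False
        by (rule crossing_circuit_not_odd[OF less.prems(3) subG K L(1) HOL.refl X'S HG zG Y Y'])
    qed
    define S1 S2 where "S1 = K0 \<union> G" and "S2 = S - K0"
    have K0S: "K0 \<subseteq> S - G" "K0 \<noteq> {}" "S - G - K0 \<noteq> {}" using K0 by (auto simp: part_def)
    have S12: "S = S1 \<union> S2" "S1 \<subset> S" "S2 \<subset> S" and GS12: "G \<subseteq> S1 \<inter> S2"
      using K0S \<open>G \<subseteq> S\<close> by (auto simp: S1_def S2_def)
    have int: "v \<in> G" if v: "v \<in> sp S1" "v \<in> sp S2" for v
    proof -
      obtain k g where "v = k + g" "k \<in> sp K0" "g \<in> G"
        using v(1) unfolding S1_def sp_Un sp_eq[OF subG] by (rule set_plus_elim)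
      then show ?thesis using partD(2)[OF K0 subG, of k v] v(2) by (simp add: S2_def)
    qed
    have sub: "S1 \<subseteq> sp S1" "S2 \<subseteq> sp S2" by (rule sp_superset)+
    \<comment> \<open>Both pieces are restrictions to flats and so inherit
      \<open>odd_minors\<close>.\<close>
    have "S \<inter> sp S1 = S1" "S \<inter> sp S2 = S2"
      using S12 sub int GS12 by blast+
    then have "odd_minors S1" "odd_minors S2"
      using odd_minors_Int_subsp[OF less.prems(3) subsp_sp] by metis+
    moreover have "finite S1" "finite S2" using S12(1) less.prems(1) by simp_all
    moreover have "0 \<in> S1" "0 \<in> S2" using GS12 subsp_0[OF subG] by blast+
    ultimately have "chordal S1" "chordal S2"
      using less.hyps psubset_card_mono[OF less.prems(1)] S12(2,3) by blast+
    then have "chordal (S1 \<union> S2)" using int GS12 by (intro glue) blast+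
    then show ?thesis using S12 by simp
  qed (rule subspace)
qed

subsection \<open>Lifting obstructions through a contraction\<close>

text \<open>\<open>U\<close> is the kernel of the contraction, and \<open>S\<close> a union of its cosets.\<close>

definition chordless :: "'v::xor_group set \<Rightarrow> 'v set \<Rightarrow> 'v set \<Rightarrow> bool" where
  "chordless S U C \<longleftrightarrow> finite C \<and> C \<subseteq> S - U \<and> 4 \<le> card C \<and> \<Sum>C \<in> U \<and>
     (\<forall>D\<subseteq>C. \<Sum>D \<in> S \<longrightarrow> card D \<le> 1 \<or> card (C - D) \<le> 1)"

text \<open>
  A copy of \<open>M\<^sup>*(K\<^sub>3\<^sub>,\<^sub>3)\<close>: the nine vectors form a 3-by-3 array whose rows and columns, the vertex stars
  of \<open>K\<^sub>3\<^sub>,\<^sub>3\<close>, sum to zero; the other six nonzero vectors of the span are absent.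
\<close>

definition grid :: "'v::xor_group set \<Rightarrow> 'v set \<Rightarrow> 'v \<Rightarrow> 'v \<Rightarrow> 'v \<Rightarrow> 'v \<Rightarrow> bool" where
  "grid S U a b c d \<longleftrightarrow>
     {a, b, a + b, c, d, c + d, a + c, b + d, a + b + c + d} \<subseteq> S - U \<and>
     {a + d, b + c, a + b + c, a + b + d, a + c + d, b + c + d} \<inter> S = {}"

text \<open>The obstructions of (iii) in vector form, relative to a kernel; \<open>odd_diag\<close>
  covers M(C_4) and M(K_4) together.\<close>

definition no_induced :: "'v::xor_group set \<Rightarrow> 'v set \<Rightarrow> bool" where
  "no_induced S U \<longleftrightarrow> odd_diag S \<and> (\<forall>C. \<not> chordless S U C) \<and> (\<forall>a b c d. \<not> grid S U a b c d)"

text \<open>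
  For the contraction of \<open>e\<close>, the variables \<open>p\<close> and \<open>pe\<close> stand for \<open>p \<in> S\<close> and \<open>p + e \<in> S\<close>. The
  conditions \<open>line\<close> come from the 4-circuits in the span of a line \<open>{p, q, p + q}\<close> and \<open>e\<close>, the
  conditions \<open>corner\<close> from the 4-circuits lifting \<open>{r, r', s, s'}\<close> with \<open>r + r' = s + s' = q\<close>, whose
  two other diagonals are absent.
\<close>

definition line :: "bool \<Rightarrow> bool \<Rightarrow> bool \<Rightarrow> bool \<Rightarrow> bool \<Rightarrow> bool \<Rightarrow> bool" where
  "line p pe q qe r re \<longleftrightarrow>
     (pe \<and> qe \<and> re \<longrightarrow> (p \<longleftrightarrow> (q \<longleftrightarrow> r))) \<and>
     (pe \<and> q \<and> r \<longrightarrow> (p \<longleftrightarrow> (qe \<longleftrightarrow> re))) \<and>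
     (qe \<and> p \<and> r \<longrightarrow> (q \<longleftrightarrow> (pe \<longleftrightarrow> re))) \<and>
     (re \<and> p \<and> q \<longrightarrow> (r \<longleftrightarrow> (pe \<longleftrightarrow> qe))) \<and>
     (q \<and> qe \<and> r \<and> re \<longrightarrow> (p \<longleftrightarrow> pe)) \<and>
     (p \<and> pe \<and> r \<and> re \<longrightarrow> (q \<longleftrightarrow> qe)) \<and>
     (p \<and> pe \<and> q \<and> qe \<longrightarrow> (r \<longleftrightarrow> re))"

definition corner :: "bool \<Rightarrow> bool \<Rightarrow> bool \<Rightarrow> bool \<Rightarrow> bool \<Rightarrow> bool \<Rightarrow> bool \<Rightarrow> bool \<Rightarrow> bool \<Rightarrow> bool \<Rightarrow> bool" where
  "corner q qe r re r' re' s se s' se' \<longleftrightarrow>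
     ((r \<and> r' \<or> re \<and> re') \<and> (s \<and> s' \<or> se \<and> se') \<longrightarrow> q) \<and>
     ((r \<and> re' \<or> re \<and> r') \<and> (s \<and> se' \<or> se \<and> s') \<longrightarrow> qe)"

text \<open>The propositional core of \<open>not_grid_contract\<close>. \<open>A00\<close> and
  \<open>B00\<close> say that entry 00 of the array, or its translate by \<open>e\<close>, is in
  \<open>S\<close>, and likewise for the other entries; rows and columns are lines. The lifts of the
  generators at 00, 01, 10, 11 are chosen by \<open>i\<close>, \<open>j\<close>, \<open>k\<close>,
  \<open>l\<close>; all others follow by exclusive or.\<close>

lemma grid_lift_bool:
  assumes "A00 \<or> B00" "A01 \<or> B01" "A02 \<or> B02" "A10 \<or> B10" "A11 \<or> B11" "A12 \<or> B12" "A20 \<or> B20" "A21 \<or> B21" "A22 \<or> B22"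
    "line A00 B00 A01 B01 A02 B02" "line A10 B10 A11 B11 A12 B12" "line A20 B20 A21 B21 A22 B22"
    "line A00 B00 A10 B10 A20 B20" "line A01 B01 A11 B11 A21 B21" "line A02 B02 A12 B12 A22 B22"
    "corner A00 B00 A01 B01 A02 B02 A10 B10 A20 B20"
    "corner A01 B01 A00 B00 A02 B02 A11 B11 A21 B21"
    "corner A02 B02 A00 B00 A01 B01 A12 B12 A22 B22"
    "corner A10 B10 A11 B11 A12 B12 A00 B00 A20 B20"
    "corner A11 B11 A10 B10 A12 B12 A01 B01 A21 B21"
    "corner A12 B12 A10 B10 A11 B11 A02 B02 A22 B22"
    "corner A20 B20 A21 B21 A22 B22 A00 B00 A10 B10"
    "corner A21 B21 A20 B20 A22 B22 A01 B01 A11 B11"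
    "corner A22 B22 A20 B20 A21 B21 A02 B02 A12 B12"
  shows "\<exists>i j k l. (if i then B00 else A00) \<and>
    (if j then B01 else A01) \<and>
    (if (i \<noteq> j) then B02 else A02) \<and>
    (if k then B10 else A10) \<and>
    (if l then B11 else A11) \<and>
    (if (k \<noteq> l) then B12 else A12) \<and>
    (if (i \<noteq> k) then B20 else A20) \<and>
    (if (j \<noteq> l) then B21 else A21) \<and>
    (if ((i \<noteq> j) \<noteq> (k \<noteq> l)) then B22 else A22)"
proof (rule ccontr)
  assume "\<not> ?thesis"
  \<comment> \<open>Sixteen ground instances replace the quantifiers, leaving a propositional
    problem.\<close>
  note neg = this[unfolded ex_bool_eq if_True if_False simp_thms]
  show False using neg assms unfolding line_def corner_def by argo
qed

lemma xor_swap: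
  fixes x :: "'v::xor_group"
  shows "x + y + w + v = 0 \<longleftrightarrow> v = x + y + w"
  by (metis add_eq_0_iff_eq)

section \<open>Contraction of a single element \<open>e\<close>\<close>

context
  fixes S U :: "'v::xor_group set" and e :: 'v
  assumes U: "subsp U" and US: "U \<subseteq> S" and SU: "\<And>s u. s \<in> S \<Longrightarrow> u \<in> U \<Longrightarrow> s + u \<in> S"
    and no: "no_induced S U" and eS: "e \<in> S"
begin

lemma odd4:
  assumes "x + y + w + v = 0" "x \<in> S" "y \<in> S" "w \<in> S" "v \<in> S"
  shows "x + y \<in> S \<longleftrightarrow> (x + w \<in> S \<longleftrightarrow> y + w \<in> S)"
  using odd_diagD[of S x y w] no assms by (simp add: no_induced_def xor_swap)

text \<open>A vector \<open>u\<close> of a configuration is seen to lie outside \<open>U\<close> by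
  naming an \<open>s\<close> in \<open>S\<close> with \<open>s + u\<close> not in
  \<open>S\<close>.\<close>

lemma notU: "u \<in> U \<Longrightarrow> s \<in> S \<Longrightarrow> s + u \<notin> S \<Longrightarrow> False"
  using SU by blast

text \<open>The only diagonal in \<open>S\<close> is \<open>x + y\<close>, and contracting
  \<open>e\<close> adds just \<open>x + w\<close>. Further 4-circuits decide which translates by
  \<open>e\<close> occur. If \<open>y + e\<close> is in \<open>S\<close>, one of them is even.
  Otherwise the rows \<open>x, y, x + y\<close>; \<open>e, x + y + w + e, x + y + w\<close>;
  \<open>x + e, x + w + e, w\<close> form a grid.\<close>

lemma four_circuit_aux2:
  assumes "x \<in> S" "y \<in> S" "w \<in> S" "x + y + w \<in> S"
    and "x + y \<in> S" "x + w \<notin> S" "x + w + e \<in> S" "y + w \<notin> S" "y + w + e \<notin> S"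
    and "x + e \<in> S"
  shows False
proof -
  have w: "w + e \<notin> S"
    using odd4[of x w e "x + w + e"] assms eS by (simp add: ac_simps)
  have yv: "y + e \<in> S \<longleftrightarrow> x + y + w + e \<notin> S"
    using odd4[of y "x + y + w" e "x + w + e"] assms eS by (simp add: ac_simps)
  show False
  proof (cases "y + e \<in> S")
    case True
    have "x + y + e \<in> S"
      using odd4[of "x + e" y "x" "y + e"] True assms eS by (simp add: ac_simps)
    then show False
      using odd4[of w "x + y + w" "x + e" "y + e"] True assms eS w yv by (simp add: ac_simps)
  next
    case False
    then have v: "x + y + w + e \<in> S" using yv by blast
    have "x + y + e \<notin> S"
    proof
      assume "x + y + e \<in> S"
      then show False using odd4[of x y e "x + y + e"] False assms eS by (simp add: ac_simps)
    qed
    moreover have "x \<notin> U" "y \<notin> U" "x + y \<notin> U" "e \<notin> U" "x + y + w + e \<notin> U" "x + y + w \<notin> U"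
       "x + e \<notin> U" "x + w + e \<notin> U" "w \<notin> U"
      using notU[of x w] notU[of y w] notU[of "x + y" e] notU[of e y] notU[of "x + y + w + e" x]
        notU[of "x + y + w" y] notU[of "x + e" y] notU[of "x + w + e" e] notU[of w x] assms v eS False calculation
      by (auto simp: ac_simps)
    ultimately have "grid S U x y e (x + y + w + e)"
      unfolding grid_def using assms eS False v w by (auto simp: ac_simps)
    then show False using no by (auto simp: no_induced_def)
  qed
qed

text \<open>The circuit \<open>x, w, e, x + w + e\<close> puts exactly one of \<open>x + e\<close>
  and \<open>w + e\<close> into \<open>S\<close>. In the second case exchange \<open>x\<close> with
  \<open>w\<close> and \<open>y\<close> with \<open>x + y + w\<close>; the three diagonals stay the
  same.\<close>

lemma four_circuit_aux:
  assumes "x \<in> S" "y \<in> S" "w \<in> S" "x + y + w \<in> S"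
    and "x + y \<in> S" "x + w \<notin> S" "x + w + e \<in> S" "y + w \<notin> S" "y + w + e \<notin> S"
  shows False
proof (cases "x + e \<in> S")
  case True
  then show False using four_circuit_aux2 assms by blast
next
  case False
  then have "w + e \<in> S"
    using odd4[of x w e "x + w + e"] assms eS by (simp add: ac_simps)
  then show False
    using four_circuit_aux2[of w "x + y + w" x] assms by (simp add: ac_simps)
qed

abbreviation (input) "S' \<equiv> S + {0, e}"

text \<open>Diagonals are only gained, so an odd number turns even only from one to two. Up to the
  six orders of \<open>x, y, w\<close> this is \<open>four_circuit_aux\<close>.\<close>

lemma four_circuit:
  assumes "x \<in> S" "y \<in> S" "w \<in> S" "x + y + w \<in> S"
  shows "x + y \<in> S' \<longleftrightarrow> (x + w \<in> S' \<longleftrightarrow> y + w \<in> S')"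
proof (rule ccontr)
  assume "\<not> ?thesis"
  then have neg: "\<not> ((x + y \<in> S \<or> x + y + e \<in> S) = ((x + w \<in> S \<or> x + w + e \<in> S) = (y + w \<in> S \<or> y + w + e \<in> S)))"
    by (simp add: mem_plus_pair)
  have odd: "x + y \<in> S \<longleftrightarrow> (x + w \<in> S \<longleftrightarrow> y + w \<in> S)"
    using odd4[of x y w "x + y + w"] assms by simp
  note aux = four_circuit_aux[of x y w] four_circuit_aux[of y x w] four_circuit_aux[of x w y]
    four_circuit_aux[of w x y] four_circuit_aux[of y w x] four_circuit_aux[of w y x]
  show False
    using neg odd aux assms by (simp add: ac_simps) argo
qed

text \<open>The rows of the array are \<open>x, y, x + y\<close>;
  \<open>w, x + y + w + e, x + y + e\<close>; \<open>x + w, x + w + e, e\<close>.\<close>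

lemma five_circuit_grid:
  assumes "x \<in> S" "y \<in> S" "w \<in> S" "x + y + w + e \<in> S"
    and "x + e \<notin> S" "y + e \<notin> S" "w + e \<notin> S" "x + y + w \<notin> S"
    and "x + y \<in> S" "x + y + e \<in> S" "x + w \<in> S" "x + w + e \<in> S" "y + w \<notin> S" "y + w + e \<notin> S"
  shows False
proof -
  have "x \<notin> U" "y \<notin> U" "w \<notin> U" "x + y + w + e \<notin> U" "x + y \<notin> U" "x + w \<notin> U"
    "x + w + e \<notin> U" "x + y + e \<notin> U" "e \<notin> U"
    using notU[of x e] notU[of y e] notU[of w e] notU[of "x + y + w + e" e] notU[of "x + y" w]
      notU[of "x + w" y] notU[of "x + w + e" w] notU[of "x + y + e" x] notU[of e x] assms eS
    by (auto simp: ac_simps)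
  then have "grid S U x y w (x + y + w + e)"
    unfolding grid_def using assms eS by (auto simp: ac_simps)
  then show False using no by (auto simp: no_induced_def)
qed

text \<open>Any splitting of five elements has a part of at most two, and the two parts have equal
  sums, so excluding sums of pairs excludes all chords.\<close>

lemma five_circuit_chordless:
  assumes C: "card C = 5" "C \<subseteq> S" "\<Sum>C = 0" and chord: "\<And>p q. p \<in> C \<Longrightarrow> q \<in> C \<Longrightarrow> p \<noteq> q \<Longrightarrow> p + q \<notin> S"
  shows False
proof -
  have fin: "finite C" using C(1) by (metis card.infinite zero_neq_numeral)
  have two: "\<Sum>D \<notin> S" if "D \<subseteq> C" "card D = 2" for D
    using that chord by (auto simp: card_2_iff)
  have "c \<notin> U" if c: "c \<in> C" for c
  proof
    assume cU: "c \<in> U"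
    have "C \<noteq> {c}" using C(1) by auto
    then obtain p where "p \<in> C" "p \<noteq> c" using c by blast
    then show False using chord[of p c] SU[of p c] c cU C(2) by blast
  qed
  moreover have "card D \<le> 1 \<or> card (C - D) \<le> 1" if D: "D \<subseteq> C" "\<Sum>D \<in> S" for D
  proof (rule ccontr)
    assume *: "\<not> ?thesis"
    have "finite D" using D fin finite_subset by blast
    then have "card (C - D) = 5 - card D" using D C by (simp add: card_Diff_subset)
    then have "card D = 2 \<or> card (C - D) = 2" using * by linarith
    moreover have "\<Sum>C = \<Sum>(C - D) + \<Sum>D" using D fin by (intro sum.subset_diff) auto
    then have "\<Sum>(C - D) = \<Sum>D" using C(3) by (simp add: add_eq_0_iff_eq)
    ultimately show False using two[of D] two[of "C - D"] D by auto
  qed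
  ultimately have "chordless S U C"
    unfolding chordless_def using fin C subsp_0[OF U] by auto
  then show False using no by (auto simp: no_induced_def)
qed

text \<open>No vector of the contracted 4-circuit has a second lift here, and the four lifts close
  up only together with \<open>e\<close>. Without diagonals this 5-circuit would be chordless, with
  two it would give a grid; so one or three remain.\<close>

lemma five_circuit:
  assumes S: "x \<in> S" "y \<in> S" "w \<in> S" "x + y + w + e \<in> S"
    and single: "x + e \<notin> S" "y + e \<notin> S" "w + e \<notin> S" "x + y + w \<notin> S"
  shows "x + y \<in> S' \<longleftrightarrow> (x + w \<in> S' \<longleftrightarrow> y + w \<in> S')"
proof -
  \<comment> \<open>The circuits \<open>r, t, e, p + q\<close> and \<open>p, q, e, p + q + e\<close>
    each have two absent diagonals involving \<open>e\<close>. Their third diagonal must therefore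
    be present, which yields the two implications.\<close>
  have pair: "p + q \<in> S \<longleftrightarrow> p + q + e \<in> S"
    if "p + q + r + t = e" "{p, q, r, t} \<subseteq> S" "p + e \<notin> S" "q + e \<notin> S" "r + e \<notin> S" "t + e \<notin> S" for p q r t
  proof -
    have rt: "r + t = p + q + e" using that(1) by (metis add.assoc add.left_commute add_self_left)
    show ?thesis
    proof
      assume "p + q \<in> S"
      moreover have "r + t + e + (p + q) = 0" using rt by (simp add: ac_simps)
      ultimately show "p + q + e \<in> S"
        using odd4[of r t e "p + q"] that eS rt by auto
    next
      assume "p + q + e \<in> S"
      then show "p + q \<in> S"
        using odd4[of p q e "p + q + e"] that eS by (auto simp: ac_simps)
    qed
  qed
  have xy: "x + y \<in> S \<longleftrightarrow> x + y + e \<in> S"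
    using S single by (intro pair[of x y w "x + y + w + e"]) (auto simp: ac_simps)
  have xw: "x + w \<in> S \<longleftrightarrow> x + w + e \<in> S"
    using S single by (intro pair[of x w y "x + y + w + e"]) (auto simp: ac_simps)
  have yw: "y + w \<in> S \<longleftrightarrow> y + w + e \<in> S"
    using S single by (intro pair[of y w x "x + y + w + e"]) (auto simp: ac_simps)
  have "False" if none: "x + y \<notin> S" "x + w \<notin> S" "y + w \<notin> S"
  proof -
    have 0: "0 \<in> S" using US subsp_0[OF U] by blast
    define v where "v = x + y + w + e"
    have sums: "x + v = y + w + e" "y + v = x + w + e" "w + v = x + y + e" "e + v = x + y + w"
      by (simp_all add: v_def ac_simps)
    have pairs: "x + e \<notin> S" "y + e \<notin> S" "w + e \<notin> S" "e + v \<notin> S" "x + y \<notin> S" "x + w \<notin> S" "y + w \<notin> S"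
      "x + v \<notin> S" "y + v \<notin> S" "w + v \<notin> S"
      unfolding sums using single none xy xw yw by auto
    then have dist: "x \<noteq> e" "y \<noteq> e" "w \<noteq> e" "e \<noteq> v" "x \<noteq> y" "x \<noteq> w" "y \<noteq> w" "x \<noteq> v" "y \<noteq> v" "w \<noteq> v"
      using 0 by auto
    then have dist': "e \<noteq> x" "e \<noteq> y" "e \<noteq> w" "v \<noteq> e" "y \<noteq> x" "w \<noteq> x" "w \<noteq> y" "v \<noteq> x" "v \<noteq> y" "v \<noteq> w"
      by auto
    show False
    proof (rule five_circuit_chordless)
      show "card {x, y, w, v, e} = 5" using dist dist' by simp
      show "{x, y, w, v, e} \<subseteq> S" using S eS by (simp add: v_def)
      have "\<Sum>{x, y, w, v, e} = x + (y + (w + (v + e)))" using dist dist' by simp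
      then show "\<Sum>{x, y, w, v, e} = 0" by (simp add: v_def ac_simps)
      show "p + q \<notin> S" if "p \<in> {x, y, w, v, e}" "q \<in> {x, y, w, v, e}" "p \<noteq> q" for p q
        using that pairs by (elim insertE emptyE; simp add: add.commute)
    qed
  qed
  moreover have "\<not> (x + y \<in> S \<and> x + w \<in> S \<and> y + w \<notin> S)"
    using five_circuit_grid[of x y w] assms xy xw yw by blast
  moreover have "\<not> (x + y \<in> S \<and> y + w \<in> S \<and> x + w \<notin> S)"
    using five_circuit_grid[of y x w] assms xy xw yw by (auto simp: ac_simps)
  moreover have "\<not> (x + w \<in> S \<and> y + w \<in> S \<and> x + y \<notin> S)"
    using five_circuit_grid[of w x y] assms xy xw yw by (auto simp: ac_simps)
  ultimately show ?thesis
    using xy xw yw by (simp add: mem_plus_pair) blast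
qed

text \<open>Lift three vectors to \<open>S\<close>. If their sum reaches \<open>S\<close> only after
  adding \<open>e\<close>, a second lift of any one of them repairs it; if there is none,
  \<open>five_circuit\<close> applies.\<close>

lemma odd_diag_contract: "odd_diag S'"
proof -
  have shift: "v + e \<in> S' \<longleftrightarrow> v \<in> S'" for v by (auto simp: mem_plus_pair ac_simps)
  have *: "x + y \<in> S' \<longleftrightarrow> (x + w \<in> S' \<longleftrightarrow> y + w \<in> S')"
    if S: "x \<in> S" "y \<in> S" "w \<in> S" "x + y + w \<in> S'" for x y w
  proof (cases "x + y + w \<in> S")
    case True
    then show ?thesis using four_circuit S by blast
  next
    case False
    then have v: "x + y + w + e \<in> S" using S(4) by (simp add: mem_plus_pair)
    consider "x + e \<in> S" | "y + e \<in> S" | "w + e \<in> S" | "x + e \<notin> S" "y + e \<notin> S" "w + e \<notin> S" by blast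
    then show ?thesis
    proof cases
      case 1
      then show ?thesis
        using four_circuit[of "x + e" y w] S v shift[of "x + y"] shift[of "x + w"] by (simp add: ac_simps)
    next
      case 2
      then show ?thesis
        using four_circuit[of x "y + e" w] S v shift[of "x + y"] shift[of "y + w"] by (simp add: ac_simps)
    next
      case 3
      then show ?thesis
        using four_circuit[of x y "w + e"] S v shift[of "x + w"] shift[of "y + w"] by (simp add: ac_simps)
    next
      case 4
      then show ?thesis using five_circuit S v False by blast
    qed
  qed
  show ?thesis
    unfolding odd_diag_def
  proof (intro ballI impI)
    fix x y w assume xyw: "x \<in> S'" "y \<in> S'" "w \<in> S'" "x + y + w \<in> S'"
    have "\<exists>i\<in>{0, e}. v + i \<in> S" if "v \<in> S'" for v using that by (auto simp: mem_plus_pair)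
    then obtain i j k where ijk: "i \<in> {0, e}" "j \<in> {0, e}" "k \<in> {0, e}" "x + i \<in> S" "y + j \<in> S" "w + k \<in> S"
      using xyw by meson
    have sh: "v + i \<in> S' \<longleftrightarrow> v \<in> S'" "v + j \<in> S' \<longleftrightarrow> v \<in> S'" "v + k \<in> S' \<longleftrightarrow> v \<in> S'" for v
      using ijk(1-3) by (auto simp only: shift insert_iff empty_iff add_0_right)
    have "(x + i) + (y + j) \<in> S' \<longleftrightarrow> x + y \<in> S'" "(x + i) + (w + k) \<in> S' \<longleftrightarrow> x + w \<in> S'"
      "(y + j) + (w + k) \<in> S' \<longleftrightarrow> y + w \<in> S'" "(x + i) + (y + j) + (w + k) \<in> S' \<longleftrightarrow> x + y + w \<in> S'"
      using sh(1)[of "x + y"] sh(2)[of "x + y + i"] sh(1)[of "x + w"] sh(3)[of "x + w + i"]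
        sh(2)[of "y + w"] sh(3)[of "y + w + j"] sh(1)[of "x + y + w"] sh(2)[of "x + y + w + i"] sh(3)[of "x + y + w + i + j"]
      by (simp_all add: ac_simps)
    then show "x + y \<in> S' \<longleftrightarrow> (x + w \<in> S' \<longleftrightarrow> y + w \<in> S')"
      using *[OF ijk(4-6)] xyw(4) by simp
  qed
qed

abbreviation (input) "U' \<equiv> U + {0, e}"

lemma mem_shift:
  assumes "i \<in> {0, e}" shows "v + i \<in> S' \<longleftrightarrow> v \<in> S'" "v + i \<in> U' \<longleftrightarrow> v \<in> U'"
  using assms by (auto simp: mem_plus_pair ac_simps)

lemma lift_sum:
  assumes "finite D" "\<And>c. c \<in> D \<Longrightarrow> l c + c \<in> {0, e}"
  shows "sum l D + \<Sum>D \<in> {0, e}"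
  using subsp_sum[OF subsp_pair, of D "\<lambda>c. l c + c"] assms by (simp add: sum.distrib)

text \<open>After contraction \<open>c\<close> and \<open>c + e\<close> are the same element, so
  lifts may be exchanged. Equal lifts of \<open>c\<close> and \<open>d\<close> would make
  \<open>{c, d}\<close> a chord, as the circuit has at least four elements.\<close>

lemma chordless_replace:
  assumes C: "chordless S' U' C" and l: "\<And>c. c \<in> C \<Longrightarrow> l c + c \<in> {0, e}"
  shows "chordless S' U' (l ` C)" "\<Sum>(l ` C) = sum l C" "inj_on l C"
proof -
  have fin: "finite C" and card4: "4 \<le> card C" and CS: "C \<subseteq> S' - U'" and sumC: "\<Sum>C \<in> U'"
    and chord: "\<And>D. D \<subseteq> C \<Longrightarrow> \<Sum>D \<in> S' \<Longrightarrow> card D \<le> 1 \<or> card (C - D) \<le> 1"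
    using C by (auto simp: chordless_def)
  have 0: "0 \<in> S" using US subsp_0[OF U] by blast
  show inj: "inj_on l C"
  proof (rule inj_onI, rule ccontr)
    fix c d assume cd: "c \<in> C" "d \<in> C" "l c = l d" "c \<noteq> d"
    have "(l c + c) + (l d + d) \<in> {0, e}"
      using subsp_add[OF subsp_pair l[OF cd(1)] l[OF cd(2)]] by simp
    then have "c + d \<in> {0, e}" using cd(3) by (simp add: ac_simps)
    then have "\<Sum>{c, d} \<in> S'" using 0 eS cd(4) by (auto simp: mem_plus_pair)
    moreover have "card (C - {c, d}) = card C - 2" using cd fin by (simp add: card_Diff_subset)
    ultimately show False using chord[of "{c, d}"] cd card4 by simp
  qed
  then show sum_image: "\<Sum>(l ` C) = sum l C" by (simp add: sum.reindex)
  have shift: "sum l D \<in> S' \<longleftrightarrow> \<Sum>D \<in> S'" "sum l D \<in> U' \<longleftrightarrow> \<Sum>D \<in> U'" if "D \<subseteq> C" for D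
  proof -
    have "finite D" using that fin finite_subset by blast
    then have "sum l D + \<Sum>D \<in> {0, e}" using l that by (intro lift_sum) auto
    from mem_shift[OF this, of "\<Sum>D"]
    show "sum l D \<in> S' \<longleftrightarrow> \<Sum>D \<in> S'" "sum l D \<in> U' \<longleftrightarrow> \<Sum>D \<in> U'"
      by (simp_all add: add.left_commute)
  qed
  show "chordless S' U' (l ` C)"
    unfolding chordless_def
  proof (intro conjI allI impI)
    show "finite (l ` C)" "4 \<le> card (l ` C)" using fin card4 inj by (simp_all add: card_image)
    show "l ` C \<subseteq> S' - U'"
    proof
      fix v assume "v \<in> l ` C"
      then obtain c where c: "c \<in> C" "v = l c" by blast
      then show "v \<in> S' - U'" using shift[of "{c}"] CS by auto
    qed
    show "\<Sum>(l ` C) \<in> U'" using sum_image shift(2)[of C] sumC by simp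
    fix D' assume "D' \<subseteq> l ` C" "\<Sum>D' \<in> S'"
    then obtain D where D: "D \<subseteq> C" "D' = l ` D" by (metis subset_imageE)
    then have injD: "inj_on l D" using inj inj_on_subset by blast
    then have "\<Sum>D \<in> S'" using shift(1)[OF D(1)] \<open>\<Sum>D' \<in> S'\<close> by (simp add: D sum.reindex)
    moreover have "card D' = card D" using injD by (simp add: D card_image)
    moreover have "l ` C - D' = l ` (C - D)" using inj D by (simp add: inj_on_image_set_diff)
    then have "card (l ` C - D') = card (C - D)" using inj by (simp add: card_image inj_on_diff)
    ultimately show "card D' \<le> 1 \<or> card (l ` C - D') \<le> 1" using chord[OF D(1)] by simp
  qed
qed

lemma not_chordless_sum_in_U:
  assumes "chordless S' U' C" "C \<subseteq> S" "\<Sum>C \<in> U"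
  shows False
proof -
  have "S \<subseteq> S'" "U \<subseteq> U'" by (auto simp: mem_plus_pair)
  then have "chordless S U C" using assms unfolding chordless_def by blast
  then show False using no by (auto simp: no_induced_def)
qed

text \<open>If the sum of \<open>C\<close> is not in \<open>U\<close>, it differs from
  \<open>U\<close> by \<open>e\<close>. A member with a second lift corrects this; if there is none,
  \<open>C\<close> together with \<open>e\<close> is a chordless circuit of
  \<open>S\<close>.\<close>

lemma not_chordless_subset:
  assumes C: "chordless S' U' C" "C \<subseteq> S"
  shows False
proof (cases "\<Sum>C \<in> U")
  case True
  then show False using not_chordless_sum_in_U C by blast
next
  case False
  have fin: "finite C" and card4: "4 \<le> card C" and CS: "C \<subseteq> S' - U'" and sumC: "\<Sum>C \<in> U'"
    and chord: "\<And>D. D \<subseteq> C \<Longrightarrow> \<Sum>D \<in> S' \<Longrightarrow> card D \<le> 1 \<or> card (C - D) \<le> 1"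
    using C(1) by (auto simp: chordless_def)
  have eC: "\<Sum>C + e \<in> U" using False sumC by (simp add: mem_plus_pair)
  show False
  proof (cases "\<exists>c\<in>C. c + e \<in> S")
    case True
    then obtain c where c: "c \<in> C" "c + e \<in> S" by blast
    define l where "l x = (if x = c then c + e else x)" for x
    have l: "l x + x \<in> {0, e}" if "x \<in> C" for x by (simp add: l_def ac_simps)
    have "sum l C = l c + sum l (C - {c})" using fin c by (simp add: sum.remove)
    moreover have "sum l (C - {c}) = \<Sum>(C - {c})" by (intro sum.cong) (auto simp: l_def)
    moreover have "\<Sum>C = c + \<Sum>(C - {c})" using fin c by (simp add: sum.remove)
    ultimately have "sum l C = \<Sum>C + e" by (simp add: l_def ac_simps)
    then have "\<Sum>(l ` C) \<in> U" using eC chordless_replace(2)[OF C(1) l] by simp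
    moreover have "l ` C \<subseteq> S" using c C(2) by (auto simp: l_def)
    ultimately show False using not_chordless_sum_in_U chordless_replace(1)[OF C(1) l] by blast
  next
    case double: False
    have eU': "e \<in> U'" using subsp_0[OF U] by (simp add: mem_plus_pair)
    have eU: "e \<notin> U" using False eC subsp_add_cancel(2)[OF U, of e "\<Sum>C"] by blast
    have e: "e \<notin> C" using CS eU' by blast
    have sub: "S \<subseteq> S'" "U \<subseteq> U'" by (auto simp: mem_plus_pair)
    have shift: "v + e \<in> S' \<longleftrightarrow> v \<in> S'" for v using mem_shift(1)[of e v] by simp
    have "chordless S U (insert e C)"
      unfolding chordless_def
    proof (intro conjI allI impI)
      show "finite (insert e C)" "4 \<le> card (insert e C)" using fin card4 e by simp_all
      show "insert e C \<subseteq> S - U" using CS C(2) eS eU sub by blast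
      show "\<Sum>(insert e C) \<in> U" using fin e eC by (simp add: add.commute)
      fix D assume D: "D \<subseteq> insert e C" "\<Sum>D \<in> S"
      have finD: "finite D" using D fin finite_subset by blast
      show "card D \<le> 1 \<or> card (insert e C - D) \<le> 1"
      proof (cases "e \<in> D")
        case True
        define D0 where "D0 = D - {e}"
        have D0: "D = insert e D0" "e \<notin> D0" "D0 \<subseteq> C" "finite D0" using True D finD by (auto simp: D0_def)
        have DS: "\<Sum>D0 + e \<in> S" using D(2) D0 by (simp add: add.commute)
        then have "card D0 \<le> 1 \<or> card (C - D0) \<le> 1" using chord[OF D0(3)] shift sub by blast
        moreover have "insert e C - D = C - D0" using D0 e by blast
        moreover have "card D0 \<noteq> 1"
          using DS double D0(3) by (auto simp: card_1_singleton_iff)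
        moreover have "card D \<le> 1" if "card D0 = 0" using that D0 by simp
        ultimately show ?thesis by (metis One_nat_def le_SucE le_zero_eq)
      next
        case False
        then have DC: "D \<subseteq> C" using D by blast
        have *: "card D \<le> 1 \<or> card (C - D) \<le> 1" using chord[OF DC] D(2) sub by blast
        \<comment> \<open>The complement of \<open>D\<close> in the enlarged circuit also contains
          \<open>e\<close>. If it were \<open>{c, e}\<close>, then \<open>c + e\<close> would be in
          \<open>S\<close>.\<close>
        have "card (C - D) \<noteq> 1"
        proof
          assume "card (C - D) = 1"
          then obtain c where c: "C - D = {c}" by (auto simp: card_1_singleton_iff)
          have "\<Sum>C = \<Sum>(C - D) + \<Sum>D" using DC fin by (intro sum.subset_diff) auto
          then have "\<Sum>D + (\<Sum>C + e) = c + e" using c by (simp add: ac_simps)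
          then have "c + e \<in> S" using SU[OF D(2) eC] by metis
          then show False using double c by blast
        qed
        moreover have "insert e C - D = {e}" if "card (C - D) = 0"
          using that fin False DC by auto
        ultimately show ?thesis using * by (metis One_nat_def card_1_singleton_iff le_SucE le_zero_eq order_refl)
      qed
    qed
    then show False using no by (auto simp: no_induced_def)
  qed
qed

lemma not_chordless_contract: "\<not> chordless S' U' C"
proof
  assume C: "chordless S' U' C"
  define l where "l c = (if c \<in> S then c else c + e)" for c
  have l: "l c + c \<in> {0, e}" if "c \<in> C" for c by (simp add: l_def ac_simps)
  have "l ` C \<subseteq> S" using C by (auto simp: l_def chordless_def mem_plus_pair)
  then show False using not_chordless_subset chordless_replace(1)[OF C l] by blast
qed

text \<open>For independent \<open>p, q, e\<close> these are the seven 4-circuits of a Fano plane,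
  the complements of its lines: four contain \<open>e\<close>, the last three avoid it.\<close>

lemma line_lift:
  "line (p \<in> S) (p + e \<in> S) (q \<in> S) (q + e \<in> S) (p + q \<in> S) (p + q + e \<in> S)"
  unfolding line_def
proof (intro conjI impI; elim conjE)
  assume "p + e \<in> S" "q + e \<in> S" "p + q + e \<in> S"
  then show "p \<in> S \<longleftrightarrow> (q \<in> S \<longleftrightarrow> p + q \<in> S)"
    using odd4[of e "p + e" "q + e" "p + q + e"] eS by (simp add: ac_simps)
next
  assume "p + e \<in> S" "q \<in> S" "p + q \<in> S"
  then show "p \<in> S \<longleftrightarrow> (q + e \<in> S \<longleftrightarrow> p + q + e \<in> S)"
    using odd4[of e "p + e" q "p + q"] eS by (simp add: ac_simps)
next
  assume "q + e \<in> S" "p \<in> S" "p + q \<in> S"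
  then show "q \<in> S \<longleftrightarrow> (p + e \<in> S \<longleftrightarrow> p + q + e \<in> S)"
    using odd4[of e "q + e" p "p + q"] eS by (simp add: ac_simps)
next
  assume "p + q + e \<in> S" "p \<in> S" "q \<in> S"
  then show "p + q \<in> S \<longleftrightarrow> (p + e \<in> S \<longleftrightarrow> q + e \<in> S)"
    using odd4[of e "p + q + e" p q] eS by (simp add: ac_simps)
next
  assume "q \<in> S" "q + e \<in> S" "p + q \<in> S" "p + q + e \<in> S"
  then show "p \<in> S \<longleftrightarrow> p + e \<in> S"
    using odd4[of q "q + e" "p + q" "p + q + e"] eS by (simp add: ac_simps)
next
  assume "p \<in> S" "p + e \<in> S" "p + q \<in> S" "p + q + e \<in> S"
  then show "q \<in> S \<longleftrightarrow> q + e \<in> S"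
    using odd4[of p "p + e" "p + q" "p + q + e"] eS by (simp add: ac_simps)
next
  assume "p \<in> S" "p + e \<in> S" "q \<in> S" "q + e \<in> S"
  then show "p + q \<in> S \<longleftrightarrow> p + q + e \<in> S"
    using odd4[of p "p + e" q "q + e"] eS by (simp add: ac_simps)
qed

text \<open>Two diagonals of the lifted circuit are absent, so the third, a lift of
  \<open>q\<close>, is present. The shifts \<open>i, j, k\<close> of \<open>r, r', s\<close> force
  that of \<open>s'\<close>, and \<open>i + j\<close> tells whether \<open>q\<close> or
  \<open>q + e\<close> is obtained.\<close>

lemma corner_lift:
  assumes sum: "q = r + r'" "q = s + s'" and cross: "r + s \<notin> S'" "r' + s \<notin> S'"
  shows "corner (q \<in> S) (q + e \<in> S) (r \<in> S) (r + e \<in> S) (r' \<in> S) (r' + e \<in> S) (s \<in> S) (s + e \<in> S) (s' \<in> S) (s' + e \<in> S)"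
proof -
  have s': "s' = r + r' + s" using sum by (metis add.commute add_self_left)
  have *: "r + r' + (i + j) \<in> S"
    if "i \<in> {0, e}" "j \<in> {0, e}" "k \<in> {0, e}" "r + i \<in> S" "r' + j \<in> S" "s + k \<in> S" "s' + (i + j + k) \<in> S" for i j k
  proof -
    have "r + s + (i + k) \<notin> S'" "r' + s + (j + k) \<notin> S'"
      using mem_shift(1)[OF subsp_add[OF subsp_pair that(1,3)], of "r + s"]
        mem_shift(1)[OF subsp_add[OF subsp_pair that(2,3)], of "r' + s"] cross by blast+
    then have "r + s + (i + k) \<notin> S" "r' + s + (j + k) \<notin> S" by (auto simp: mem_plus_pair)
    then show ?thesis
      using odd4[of "r + i" "r' + j" "s + k" "s' + (i + j + k)"] that by (simp add: s' ac_simps)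
  qed
  show ?thesis
    unfolding corner_def
    using *[of 0 0 0] *[of 0 0 e] *[of e e 0] *[of e e e] *[of 0 e 0] *[of 0 e e] *[of e 0 0] *[of e 0 e]
    by (simp add: sum(1) add.assoc) blast
qed

lemma not_grid_contract: "\<not> grid S' U' a b c d"
proof
  assume grid: "grid S' U' a b c d"
  then have nine: "{a, b, a + b, c, d, c + d, a + c, b + d, a + b + c + d} \<subseteq> S' - U'"
    and six: "a + d \<notin> S'" "b + c \<notin> S'" "a + b + c \<notin> S'" "a + b + d \<notin> S'" "a + c + d \<notin> S'" "b + c + d \<notin> S'"
    by (auto simp: grid_def)
  have ex: "v \<in> S \<or> v + e \<in> S" if "v \<in> S'" for v using that by (simp add: mem_plus_pair)
  have mem: "a \<in> S \<or> a + e \<in> S" "b \<in> S \<or> b + e \<in> S" "a + b \<in> S \<or> a + b + e \<in> S"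
    "c \<in> S \<or> c + e \<in> S" "d \<in> S \<or> d + e \<in> S" "c + d \<in> S \<or> c + d + e \<in> S"
    "a + c \<in> S \<or> a + c + e \<in> S" "b + d \<in> S \<or> b + d + e \<in> S" "a + b + c + d \<in> S \<or> a + b + c + d + e \<in> S"
    using nine by (intro ex; blast)+
  note rows = line_lift[of a b] line_lift[of c d] line_lift[of "a + c" "b + d"]
  have r3: "a + c + (b + d) = a + b + c + d" "a + b + (c + d) = a + b + c + d" by (simp_all add: ac_simps)
  note cols = line_lift[of a c] line_lift[of b d] line_lift[of "a + b" "c + d"]
  have corners:
    "corner (a \<in> S) (a + e \<in> S) (b \<in> S) (b + e \<in> S) (a + b \<in> S) (a + b + e \<in> S) (c \<in> S) (c + e \<in> S) (a + c \<in> S) (a + c + e \<in> S)"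
    "corner (b \<in> S) (b + e \<in> S) (a \<in> S) (a + e \<in> S) (a + b \<in> S) (a + b + e \<in> S) (d \<in> S) (d + e \<in> S) (b + d \<in> S) (b + d + e \<in> S)"
    "corner (a + b \<in> S) (a + b + e \<in> S) (a \<in> S) (a + e \<in> S) (b \<in> S) (b + e \<in> S) (c + d \<in> S) (c + d + e \<in> S) (a + b + c + d \<in> S) (a + b + c + d + e \<in> S)"
    "corner (c \<in> S) (c + e \<in> S) (d \<in> S) (d + e \<in> S) (c + d \<in> S) (c + d + e \<in> S) (a \<in> S) (a + e \<in> S) (a + c \<in> S) (a + c + e \<in> S)"
    "corner (d \<in> S) (d + e \<in> S) (c \<in> S) (c + e \<in> S) (c + d \<in> S) (c + d + e \<in> S) (b \<in> S) (b + e \<in> S) (b + d \<in> S) (b + d + e \<in> S)"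
    "corner (c + d \<in> S) (c + d + e \<in> S) (c \<in> S) (c + e \<in> S) (d \<in> S) (d + e \<in> S) (a + b \<in> S) (a + b + e \<in> S) (a + b + c + d \<in> S) (a + b + c + d + e \<in> S)"
    "corner (a + c \<in> S) (a + c + e \<in> S) (b + d \<in> S) (b + d + e \<in> S) (a + b + c + d \<in> S) (a + b + c + d + e \<in> S) (a \<in> S) (a + e \<in> S) (c \<in> S) (c + e \<in> S)"
    "corner (b + d \<in> S) (b + d + e \<in> S) (a + c \<in> S) (a + c + e \<in> S) (a + b + c + d \<in> S) (a + b + c + d + e \<in> S) (b \<in> S) (b + e \<in> S) (d \<in> S) (d + e \<in> S)"
    "corner (a + b + c + d \<in> S) (a + b + c + d + e \<in> S) (a + c \<in> S) (a + c + e \<in> S) (b + d \<in> S) (b + d + e \<in> S) (a + b \<in> S) (a + b + e \<in> S) (c + d \<in> S) (c + d + e \<in> S)"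
    using six by (intro corner_lift; simp add: ac_simps)+
  obtain i j k l where "(if i then a + e \<in> S else a \<in> S)" "(if j then b + e \<in> S else b \<in> S)"
      "(if i \<noteq> j then a + b + e \<in> S else a + b \<in> S)"
      "(if k then c + e \<in> S else c \<in> S)" "(if l then d + e \<in> S else d \<in> S)" "(if k \<noteq> l then c + d + e \<in> S else c + d \<in> S)"
      "(if i \<noteq> k then a + c + e \<in> S else a + c \<in> S)" "(if j \<noteq> l then b + d + e \<in> S else b + d \<in> S)"
      "(if (i \<noteq> j) \<noteq> (k \<noteq> l) then a + b + c + d + e \<in> S else a + b + c + d \<in> S)"
    using grid_lift_bool[OF mem rows[unfolded r3] cols[unfolded r3] corners] by blast
  note lifts = this
  \<comment> \<open>Truth values index the shifts by 0 or \<open>e\<close>, with exclusive or as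
    addition, to match \<open>grid_lift_bool\<close>.\<close>
  define \<epsilon> where "\<epsilon> h = (if h then e else 0)" for h
  have \<epsilon>: "\<epsilon> h \<in> {0, e}" for h by (simp add: \<epsilon>_def)
  define a' b' c' d' where "a' = a + \<epsilon> i" and "b' = b + \<epsilon> j" and "c' = c + \<epsilon> k" and "d' = d + \<epsilon> l"
  have add_\<epsilon>: "\<epsilon> h + \<epsilon> m = \<epsilon> (h \<noteq> m)" for h m by (simp add: \<epsilon>_def)
  have sums: "a' + b' = a + b + \<epsilon> (i \<noteq> j)" "c' + d' = c + d + \<epsilon> (k \<noteq> l)" "a' + c' = a + c + \<epsilon> (i \<noteq> k)"
    "b' + d' = b + d + \<epsilon> (j \<noteq> l)" "a' + b' + c' + d' = a + b + c + d + \<epsilon> ((i \<noteq> j) \<noteq> (k \<noteq> l))"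
    unfolding add_\<epsilon>[symmetric] by (simp_all add: a'_def b'_def c'_def d'_def ac_simps)
  have sums6: "a' + d' = a + d + \<epsilon> (i \<noteq> l)" "b' + c' = b + c + \<epsilon> (j \<noteq> k)"
    "a' + b' + c' = a + b + c + \<epsilon> ((i \<noteq> j) \<noteq> k)" "a' + b' + d' = a + b + d + \<epsilon> ((i \<noteq> j) \<noteq> l)"
    "a' + c' + d' = a + c + d + \<epsilon> ((i \<noteq> k) \<noteq> l)" "b' + c' + d' = b + c + d + \<epsilon> ((j \<noteq> k) \<noteq> l)"
    unfolding add_\<epsilon>[symmetric] by (simp_all add: a'_def b'_def c'_def d'_def ac_simps)
  have inS: "v + \<epsilon> h \<in> S" if "if h then v + e \<in> S else v \<in> S" for v h using that by (simp add: \<epsilon>_def split: if_splits)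
  have S9: "a' \<in> S" "b' \<in> S" "a' + b' \<in> S" "c' \<in> S" "d' \<in> S" "c' + d' \<in> S" "a' + c' \<in> S" "b' + d' \<in> S" "a' + b' + c' + d' \<in> S"
    using lifts[THEN inS] by (simp_all only: sums[symmetric] a'_def[symmetric] b'_def[symmetric] c'_def[symmetric] d'_def[symmetric])
  have sub: "S \<subseteq> S'" "U \<subseteq> U'" by (auto simp: mem_plus_pair)
  have notU': "v + \<epsilon> h \<notin> U" if "v \<in> S' - U'" for v h
    using mem_shift(2)[OF \<epsilon>, of v h] that sub by blast
  have U9: "a' \<notin> U" "b' \<notin> U" "a' + b' \<notin> U" "c' \<notin> U" "d' \<notin> U" "c' + d' \<notin> U" "a' + c' \<notin> U" "b' + d' \<notin> U" "a' + b' + c' + d' \<notin> U"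
  proof -
    have *: "v + \<epsilon> h \<notin> U" if "v \<in> {a, b, a + b, c, d, c + d, a + c, b + d, a + b + c + d}" for v h
      using notU' nine that by blast
    show "a' \<notin> U" "b' \<notin> U" "c' \<notin> U" "d' \<notin> U" unfolding a'_def b'_def c'_def d'_def by (intro *; simp)+
    show "a' + b' + c' + d' \<notin> U" by (subst sums(5), intro *, simp)
    show "a' + b' \<notin> U" "c' + d' \<notin> U" "a' + c' \<notin> U" "b' + d' \<notin> U" unfolding sums by (intro *; simp)+
  qed
  have notS: "v + \<epsilon> h \<notin> S" if "v \<notin> S'" for v h
    using mem_shift(1)[OF \<epsilon>, of v h] that sub by blast
  have S6: "a' + d' \<notin> S" "b' + c' \<notin> S" "a' + b' + c' \<notin> S" "a' + b' + d' \<notin> S" "a' + c' + d' \<notin> S" "b' + c' + d' \<notin> S"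
    using notS[OF six(1), of "i \<noteq> l"] notS[OF six(2), of "j \<noteq> k"] notS[OF six(3), of "(i \<noteq> j) \<noteq> k"]
      notS[OF six(4), of "(i \<noteq> j) \<noteq> l"] notS[OF six(5), of "(i \<noteq> k) \<noteq> l"] notS[OF six(6), of "(j \<noteq> k) \<noteq> l"]
    by (simp_all only: sums6[symmetric] not_False_eq_True)
  have "grid S U a' b' c' d'"
    unfolding grid_def using S9 U9 S6 by simp
  then show False using no by (auto simp: no_induced_def)
qed

lemma no_induced_contract: "no_induced S' U'"
  using odd_diag_contract not_chordless_contract not_grid_contract by (simp add: no_induced_def)

end

text \<open>Contraction of one element after another. All three exclusions are carried along,
  because \<open>odd_diag\<close> alone is not inherited: a 5-cycle contracts to a 4-cycle.\<close>

lemma no_induced_odd_minors: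
  fixes S :: "'v::xor_group set"
  assumes "no_induced S {0}" "0 \<in> S" "finite S"
  shows "odd_minors S"
  unfolding odd_minors_def
proof (intro allI impI)
  fix X assume X: "X \<subseteq> S"
  have "finite X" using X assms(3) finite_subset by blast
  then have "no_induced (S + sp X) (sp X)"
    using X
  proof (induction X rule: finite_induct)
    case empty
    have "S + {0} = S" by simp
    then show ?case using assms(1) by (simp add: sp_empty)
  next
    case (insert x X)
    have sub: "S \<subseteq> S + sp X" by (rule subset_plus[OF subsp_sp])
    have "sp X \<subseteq> S + sp X" using assms(2) by (auto simp: mem_plus_iff intro!: bexI[of _ 0])
    moreover have "s + u \<in> S + sp X" if "s \<in> S + sp X" "u \<in> sp X" for s u
      using that mem_plus_shift[OF subsp_sp] by blast
    ultimately have "no_induced ((S + sp X) + {0, x}) (sp X + {0, x})"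
      using insert sub by (intro no_induced_contract[OF subsp_sp]) auto
    then show ?case by (simp add: sp_insert ac_simps)
  qed
  then show "odd_diag (S + sp X)" by (simp add: no_induced_def)
qed

section \<open>Binary matroids as vectors modulo a subspace\<close>

text \<open>
  A representation over the quotient by \<open>U\<close>: contraction keeps the map \<open>\<phi>\<close> and enlarges \<open>U\<close>.
\<close>

definition rep :: "'a matroid \<Rightarrow> ('a \<Rightarrow> 'v::xor_group) \<Rightarrow> 'v set \<Rightarrow> bool" where
  "rep N \<phi> U \<longleftrightarrow> finite (ground N) \<and> subsp U \<and> finite U \<and>
     indep N = {I. I \<subseteq> ground N \<and> (\<forall>D\<subseteq>I. sum \<phi> D \<in> U \<longrightarrow> D = {})}"

text \<open>With 0 adjoined and \<open>U\<close> absorbed, the set does not see loops or parallel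
  elements: simplification leaves it unchanged and contraction adds a subspace to it.\<close>

definition elems :: "'a matroid \<Rightarrow> ('a \<Rightarrow> 'v::xor_group) \<Rightarrow> 'v set \<Rightarrow> 'v set" where
  "elems N \<phi> U = insert 0 (\<phi> ` ground N) + U"

lemma mem_elems: "v \<in> elems N \<phi> U \<longleftrightarrow> v \<in> U \<or> (\<exists>x\<in>ground N. v + \<phi> x \<in> U)"
  by (auto simp: elems_def mem_plus_iff)

lemma mem_span_plus:
  assumes "finite X"
  shows "v \<in> sp (\<phi> ` X) + U \<longleftrightarrow> (\<exists>Y\<subseteq>X. v + sum \<phi> Y \<in> U)"
  by (simp only: mem_plus_iff Bex_def sp_image_eq[OF assms]) blast

lemma in_span_plus: "subsp U \<Longrightarrow> x \<in> X \<Longrightarrow> \<phi> x \<in> sp (\<phi> ` X) + U"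
  using subset_plus[of U "sp (\<phi> ` X)"] sp_incl[of "\<phi> x" "\<phi> ` X"] by blast

lemma repD:
  assumes "rep N \<phi> U"
  shows "finite (ground N)" "subsp U" "finite U"
    "I \<in> indep N \<longleftrightarrow> I \<subseteq> ground N \<and> (\<forall>D\<subseteq>I. sum \<phi> D \<in> U \<longrightarrow> D = {})"
  using assms by (auto simp: rep_def)

lemma rep_indep_finite: "rep N \<phi> U \<Longrightarrow> I \<in> indep N \<Longrightarrow> finite I"
  using finite_subset[of I "ground N"] by (simp add: rep_def)

lemma rep_indepD: "rep N \<phi> U \<Longrightarrow> I \<in> indep N \<Longrightarrow> D \<subseteq> I \<Longrightarrow> sum \<phi> D \<in> U \<Longrightarrow> D = {}"
  by (simp add: rep_def)

lemma rep_indep_empty: "rep N \<phi> U \<Longrightarrow> {} \<in> indep N"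
  by (simp add: repD(4))

lemma rep_indep_insert:
  assumes N: "rep N \<phi> U" and I: "I \<in> indep N" and y: "y \<in> ground N" "y \<notin> I"
  shows "insert y I \<in> indep N \<longleftrightarrow> \<phi> y \<notin> sp (\<phi> ` I) + U"
proof -
  have fin: "finite I" using rep_indep_finite[OF N I] .
  show ?thesis
  proof
    assume *: "insert y I \<in> indep N"
    show "\<phi> y \<notin> sp (\<phi> ` I) + U"
    proof
      assume "\<phi> y \<in> sp (\<phi> ` I) + U"
      then obtain Y where Y: "Y \<subseteq> I" "\<phi> y + sum \<phi> Y \<in> U" using fin by (auto simp: mem_span_plus)
      then have "finite Y" "y \<notin> Y" using finite_subset[OF _ fin] y by blast+
      then have "sum \<phi> (insert y Y) \<in> U" using Y by simp
      moreover have "insert y Y \<subseteq> insert y I" using Y by blast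
      ultimately show False using * repD(4)[OF N, of "insert y I"] by blast
    qed
  next
    assume *: "\<phi> y \<notin> sp (\<phi> ` I) + U"
    have "D = {}" if D: "D \<subseteq> insert y I" "sum \<phi> D \<in> U" for D
    proof (cases "y \<in> D")
      case True
      have "finite D" using finite_subset[OF D(1)] fin by simp
      then have "\<phi> y + sum \<phi> (D - {y}) \<in> U" using sum.remove[of D y \<phi>] True D by simp
      moreover have "D - {y} \<subseteq> I" using D by blast
      ultimately show ?thesis using * fin by (auto simp: mem_span_plus)
    next
      case False
      then show ?thesis using D I repD(4)[OF N, of I] by blast
    qed
    then show "insert y I \<in> indep N" using repD(4)[OF N] I y by blast
  qed
qed

text \<open>Different subsets of an independent set have different sums modulo \<open>U\<close>.
  Comparing such cardinalities takes the place of dimension theory.\<close>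

lemma rep_card_indep:
  assumes N: "rep N \<phi> U" and I: "I \<in> indep N"
  shows "card (sp (\<phi> ` I) + U) = 2 ^ card I * card U"
proof -
  have fin: "finite I" using rep_indep_finite[OF N I] .
  have subU: "subsp U" by (rule repD(2)[OF N])
  have eq: "sp (\<phi> ` I) + U = (\<lambda>(Y, u). sum \<phi> Y + u) ` (Pow I \<times> U)"
  proof (intro equalityI subsetI)
    fix v assume "v \<in> sp (\<phi> ` I) + U"
    then obtain Y where "Y \<subseteq> I" "v + sum \<phi> Y \<in> U" using fin by (auto simp: mem_span_plus)
    then show "v \<in> (\<lambda>(Y, u). sum \<phi> Y + u) ` (Pow I \<times> U)"
      by (intro image_eqI[of _ _ "(Y, v + sum \<phi> Y)"]) (auto simp: ac_simps)
  next
    fix v assume "v \<in> (\<lambda>(Y, u). sum \<phi> Y + u) ` (Pow I \<times> U)"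
    then obtain Y u where "Y \<subseteq> I" "u \<in> U" "v = sum \<phi> Y + u" by auto
    then show "v \<in> sp (\<phi> ` I) + U"
      unfolding mem_span_plus[OF fin] by (intro exI[of _ Y]) (simp add: ac_simps)
  qed
  have "inj_on (\<lambda>(Y, u). sum \<phi> Y + u) (Pow I \<times> U)"
  proof (rule inj_onI, clarify)
    fix A u B w assume *: "A \<subseteq> I" "B \<subseteq> I" "u \<in> U" "w \<in> U" "sum \<phi> A + u = sum \<phi> B + w"
    have "sum \<phi> (symdiff A B) = sum \<phi> A + sum \<phi> B"
      using finite_subset[OF *(1) fin] finite_subset[OF *(2) fin] by (rule sum_symdiff)
    also have "\<dots> = u + w" using *(5) by (metis add.assoc add.commute add_self_left)
    finally have "sum \<phi> (symdiff A B) \<in> U" using * subsp_add[OF subU] by simp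
    moreover have "symdiff A B \<subseteq> I" using * by blast
    ultimately have "symdiff A B = {}" by (rule rep_indepD[OF N I, rotated])
    then have "A = B" by blast
    then show "A = B \<and> u = w" using *(5) by simp
  qed
  then show ?thesis
    unfolding eq using fin by (simp add: card_image card_cartesian_product card_Pow)
qed

lemma rep_span_mono:
  assumes N: "rep N \<phi> U" and "\<And>y. y \<in> Y \<Longrightarrow> \<phi> y \<in> sp (\<phi> ` X) + U"
  shows "sp (\<phi> ` Y) + U \<subseteq> sp (\<phi> ` X) + U"
proof -
  have sub: "subsp (sp (\<phi> ` X) + U)" by (intro subsp_plus subsp_sp repD(2)[OF N])
  have "sp (\<phi> ` Y) \<subseteq> sp (\<phi> ` X) + U" using assms(2) by (intro sp_least sub) auto
  moreover have "U \<subseteq> sp (\<phi> ` X) + U" using zero_in_sp by (auto simp: mem_plus_iff intro!: bexI[of _ 0])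
  ultimately show ?thesis
    by (intro subsetI, elim set_plus_elim) (auto intro: subsp_add[OF sub])
qed

lemma rep_span_finite: "rep N \<phi> U \<Longrightarrow> X \<subseteq> ground N \<Longrightarrow> finite (sp (\<phi> ` X) + U)"
  using finite_subset by (intro finite_set_plus finite_sp finite_imageI) (auto simp: rep_def)

text \<open>If no member of \<open>Y\<close> augmented \<open>X\<close>, the span of
  \<open>Y\<close> would lie in that of \<open>X\<close>, against
  \<open>rep_card_indep\<close>.\<close>

lemma rep_matroid:
  assumes N: "rep N \<phi> U" shows "matroid N"
proof
  show "finite (ground N)" "{} \<in> indep N" using repD(1)[OF N] rep_indep_empty[OF N] by auto
  show "X \<in> indep N \<Longrightarrow> X \<subseteq> ground N" "X \<in> indep N \<Longrightarrow> Y \<subseteq> X \<Longrightarrow> Y \<in> indep N" for X Y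
    unfolding repD(4)[OF N] by blast+
  fix X Y assume X: "X \<in> indep N" and Y: "Y \<in> indep N" and less: "card X < card Y"
  show "\<exists>y\<in>Y - X. insert y X \<in> indep N"
  proof (rule ccontr)
    assume *: "\<not> ?thesis"
    have XG: "X \<subseteq> ground N" "Y \<subseteq> ground N" using X Y by (simp_all add: repD(4)[OF N])
    have "\<phi> y \<in> sp (\<phi> ` X) + U" if "y \<in> Y" for y
    proof (cases "y \<in> X")
      case True
      then show ?thesis by (intro in_span_plus repD(2)[OF N])
    next
      case False
      then show ?thesis using rep_indep_insert[OF N X, of y] that XG * by blast
    qed
    then have "sp (\<phi> ` Y) + U \<subseteq> sp (\<phi> ` X) + U" by (rule rep_span_mono[OF N])
    then have "card (sp (\<phi> ` Y) + U) \<le> card (sp (\<phi> ` X) + U)"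
      using rep_span_finite[OF N XG(1)] by (rule card_mono[rotated])
    moreover have "card U > 0" using repD(2,3)[OF N] subsp_0 by (auto simp: card_gt_0_iff)
    ultimately show False using less by (simp add: rep_card_indep[OF N X] rep_card_indep[OF N Y])
  qed
qed

lemma rep_max_indep:
  assumes N: "rep N \<phi> U" and X: "X \<subseteq> ground N"
  obtains I where "I \<in> indep N" "I \<subseteq> X" "card I = rank N X" "sp (\<phi> ` I) + U = sp (\<phi> ` X) + U"
proof -
  let ?F = "{I \<in> indep N. I \<subseteq> X}"
  have "finite X" using X repD(1)[OF N] finite_subset by blast
  then have finF: "finite ?F" by simp
  moreover have "{} \<in> ?F" using rep_indep_empty[OF N] by simp
  ultimately have "rank N X \<in> card ` ?F" unfolding rank_def by (intro Max_in) auto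
  then obtain I where I: "I \<in> indep N" "I \<subseteq> X" "card I = rank N X" by auto
  have max: "card J \<le> card I" if "J \<in> ?F" for J
    unfolding I(3) rank_def using finF that by (intro Max_ge) auto
  have finI: "finite I" using I \<open>finite X\<close> finite_subset by blast
  have "\<phi> y \<in> sp (\<phi> ` I) + U" if "y \<in> X" for y
  proof (cases "y \<in> I")
    case True
    then show ?thesis by (intro in_span_plus repD(2)[OF N])
  next
    case False
    then have "insert y I \<notin> ?F" using max[of "insert y I"] finI by auto
    then show ?thesis using rep_indep_insert[OF N I(1), of y] that X I False by blast
  qed
  then have "sp (\<phi> ` X) + U \<subseteq> sp (\<phi> ` I) + U" by (rule rep_span_mono[OF N])
  moreover have "sp (\<phi> ` I) + U \<subseteq> sp (\<phi> ` X) + U"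
    using I(2) by (intro set_plus_mono2 sp_mono) auto
  ultimately show ?thesis using that I by blast
qed

lemma rep_rank:
  assumes "rep N \<phi> U" "X \<subseteq> ground N"
  shows "card (sp (\<phi> ` X) + U) = 2 ^ rank N X * card U"
  using rep_max_indep[OF assms] rep_card_indep[OF assms(1)] by metis

lemma rep_closure:
  assumes N: "rep N \<phi> U" and X: "X \<subseteq> ground N"
  shows "closure N X = {x \<in> ground N. \<phi> x \<in> sp (\<phi> ` X) + U}"
proof -
  have "rank N (insert x X) = rank N X \<longleftrightarrow> \<phi> x \<in> sp (\<phi> ` X) + U" if x: "x \<in> ground N" for x
  proof -
    let ?A = "sp (\<phi> ` X) + U" and ?B = "sp (\<phi> ` insert x X) + U"
    have xX: "insert x X \<subseteq> ground N" using x X by blast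
    have "card U > 0" using repD(2,3)[OF N] subsp_0 by (auto simp: card_gt_0_iff)
    then have "rank N (insert x X) = rank N X \<longleftrightarrow> card ?B = card ?A"
      unfolding rep_rank[OF N X] rep_rank[OF N xX] by simp
    also have "\<dots> \<longleftrightarrow> ?B = ?A"
    proof
      have "?A \<subseteq> ?B" by (intro set_plus_mono2 sp_mono) auto
      then show "card ?B = card ?A \<Longrightarrow> ?B = ?A"
        using card_subset_eq[OF rep_span_finite[OF N xX]] by metis
    qed simp
    also have "\<dots> \<longleftrightarrow> \<phi> x \<in> ?A"
    proof
      assume "?B = ?A"
      moreover have "\<phi> x \<in> ?B" by (rule in_span_plus[OF repD(2)[OF N]]) simp
      ultimately show "\<phi> x \<in> ?A" by simp
    next
      assume *: "\<phi> x \<in> ?A"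
      have "\<phi> y \<in> ?A" if "y \<in> insert x X" for y
        using that * by (auto intro: in_span_plus repD(2)[OF N])
      then have "?B \<subseteq> ?A" by (rule rep_span_mono[OF N])
      moreover have "?A \<subseteq> ?B" by (intro set_plus_mono2 sp_mono) auto
      ultimately show "?B = ?A" by blast
    qed
    finally show ?thesis .
  qed
  then show ?thesis by (auto simp: closure_def)
qed

lemma rep_flat:
  assumes N: "rep N \<phi> U"
  shows "flat N F \<longleftrightarrow> F \<subseteq> ground N \<and> (\<forall>x\<in>ground N. \<phi> x \<in> sp (\<phi> ` F) + U \<longrightarrow> x \<in> F)"
proof (cases "F \<subseteq> ground N")
  case True
  have "\<phi> x \<in> sp (\<phi> ` F) + U" if "x \<in> F" for x
    using that by (auto intro: in_span_plus repD(2)[OF N])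
  then show ?thesis using True by (auto simp: flat_def rep_closure[OF N True])
qed (auto simp: flat_def)

lemma rep_restriction:
  assumes "rep N \<phi> U" "X \<subseteq> ground N"
  shows "rep (restriction N X) \<phi> U"
  using assms finite_subset by (auto simp: rep_def restriction_def)

lemma rep_basis:
  assumes N: "rep N \<phi> U" and B: "basis N B"
  shows "sp (\<phi> ` B) + U = sp (\<phi> ` ground N) + U"
proof -
  have BI: "B \<in> indep N" and max: "\<And>C. C \<in> indep N \<Longrightarrow> B \<subseteq> C \<Longrightarrow> C = B"
    using B by (auto simp: basis_def)
  have BG: "B \<subseteq> ground N" using BI by (simp add: repD(4)[OF N])
  have "\<phi> y \<in> sp (\<phi> ` B) + U" if "y \<in> ground N" for y
  proof (cases "y \<in> B")
    case True
    then show ?thesis by (intro in_span_plus repD(2)[OF N])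
  next
    case False
    then have "insert y B \<notin> indep N" using max[of "insert y B"] by blast
    then show ?thesis using rep_indep_insert[OF N BI that False] by blast
  qed
  then have "sp (\<phi> ` ground N) + U \<subseteq> sp (\<phi> ` B) + U" by (rule rep_span_mono[OF N])
  moreover have "sp (\<phi> ` B) + U \<subseteq> sp (\<phi> ` ground N) + U"
    using BG by (intro set_plus_mono2 sp_mono) auto
  ultimately show ?thesis by blast
qed

text \<open>Every basis of \<open>X\<close> has the same span modulo \<open>U\<close>, so the basis
  chosen in the definition of contraction is irrelevant and the span of \<open>X\<close> simply
  joins the kernel.\<close>

lemma rep_contraction:
  assumes N: "rep N \<phi> U" and X: "X \<subseteq> ground N"
  shows "rep (contraction N X) \<phi> (sp (\<phi> ` X) + U)"
proof -
  have subU: "subsp U" by (rule repD(2)[OF N])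
  have NX: "rep (restriction N X) \<phi> U" by (rule rep_restriction[OF N X])
  have finX: "finite X" using X repD(1)[OF N] finite_subset by blast
  have basis: "sp (\<phi> ` B) + U = sp (\<phi> ` X) + U" "B \<in> indep N" "B \<subseteq> X" if "basis (restriction N X) B" for B
    using rep_basis[OF NX that] that by (simp_all add: restriction_def basis_def)
  have ex: "\<exists>B. basis (restriction N X) B"
  proof -
    let ?F = "indep (restriction N X)"
    have "finite ?F" using finX by (auto simp: restriction_def intro: finite_subset[of _ "Pow X"])
    moreover have "{} \<in> ?F" by (rule rep_indep_empty[OF NX])
    ultimately obtain B where "B \<in> ?F" "\<forall>C\<in>?F. B \<subseteq> C \<longrightarrow> B = C"
      using finite_has_maximal[of ?F] by blast
    then show ?thesis by (auto simp: basis_def)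
  qed
  have "(\<exists>B. basis (restriction N X) B \<and> B \<union> I \<in> indep N) \<longleftrightarrow>
      (\<forall>D\<subseteq>I. sum \<phi> D \<in> sp (\<phi> ` X) + U \<longrightarrow> D = {})" if I: "I \<subseteq> ground N - X" for I
  proof
    have finI: "finite I" using I repD(1)[OF N] finite_subset by blast
    assume "\<exists>B. basis (restriction N X) B \<and> B \<union> I \<in> indep N"
    then obtain B where B: "basis (restriction N X) B" "B \<union> I \<in> indep N" by blast
    have finB: "finite B" using basis(3)[OF B(1)] finX finite_subset by blast
    show "\<forall>D\<subseteq>I. sum \<phi> D \<in> sp (\<phi> ` X) + U \<longrightarrow> D = {}"
    proof (intro allI impI)
      fix D assume D: "D \<subseteq> I" "sum \<phi> D \<in> sp (\<phi> ` X) + U"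
      then obtain Y where Y: "Y \<subseteq> B" "sum \<phi> D + sum \<phi> Y \<in> U"
        using finB by (auto simp: basis(1)[OF B(1), symmetric] mem_span_plus)
      have "finite D" "finite Y" "D \<inter> Y = {}"
        using D Y I finI finB basis(3)[OF B(1)] finite_subset by blast+
      then have "sum \<phi> (D \<union> Y) \<in> U" using Y by (simp add: sum.union_disjoint)
      moreover have "D \<union> Y \<subseteq> B \<union> I" using D Y by blast
      ultimately show "D = {}" using B(2) repD(4)[OF N, of "B \<union> I"] by blast
    qed
  next
    assume *: "\<forall>D\<subseteq>I. sum \<phi> D \<in> sp (\<phi> ` X) + U \<longrightarrow> D = {}"
    have finI: "finite I" using I repD(1)[OF N] finite_subset by blast
    obtain B where B: "basis (restriction N X) B" using ex by blast
    have BX: "B \<in> indep N" "B \<subseteq> X" using basis[OF B] by blast+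
    have finB: "finite B" using BX finX finite_subset by blast
    have "D = {}" if D: "D \<subseteq> B \<union> I" "sum \<phi> D \<in> U" for D
    proof -
      have "D = (D \<inter> I) \<union> (D \<inter> B)" "(D \<inter> I) \<inter> (D \<inter> B) = {}" using D I BX by blast+
      then have "sum \<phi> D = sum \<phi> (D \<inter> I) + sum \<phi> (D \<inter> B)"
        using finI finB by (metis finite_Int sum.union_disjoint)
      then have "sum \<phi> (D \<inter> I) + sum \<phi> (D \<inter> B) \<in> U" using D by simp
      moreover have "D \<inter> B \<subseteq> X" using BX by blast
      ultimately have "sum \<phi> (D \<inter> I) \<in> sp (\<phi> ` X) + U" using finX by (auto simp: mem_span_plus)
      then have "D \<inter> I = {}" using * by blast
      then have "D \<subseteq> B" using D by blast
      then show ?thesis using D BX(1) repD(4)[OF N, of B] by blast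
    qed
    moreover have "B \<union> I \<subseteq> ground N" using BX I X by blast
    ultimately have "B \<union> I \<in> indep N" using repD(4)[OF N] by blast
    then show "\<exists>B. basis (restriction N X) B \<and> B \<union> I \<in> indep N" using B by blast
  qed
  then have "indep (contraction N X) = {I. I \<subseteq> ground N - X \<and> (\<forall>D\<subseteq>I. sum \<phi> D \<in> sp (\<phi> ` X) + U \<longrightarrow> D = {})}"
    by (auto simp: contraction_def)
  then show ?thesis
    using repD(1)[OF N] subsp_plus[OF subsp_sp subU] rep_span_finite[OF N X]
    by (simp add: rep_def contraction_def)
qed

text \<open>Elements of \<open>X\<close> fall into the new kernel, so removing them from the ground
  set loses no vector.\<close>

lemma elems_contraction:
  assumes N: "rep N \<phi> U" and X: "X \<subseteq> ground N"
  shows "elems (contraction N X) \<phi> (sp (\<phi> ` X) + U) = elems N \<phi> U + sp (\<phi> ` X)"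
proof -
  let ?V = "sp (\<phi> ` X) + U"
  have sub: "subsp ?V" by (intro subsp_plus subsp_sp repD(2)[OF N])
  have XV: "\<phi> x \<in> ?V" if "x \<in> X" for x
    using that by (auto intro: in_span_plus repD(2)[OF N])
  have "v \<in> elems (contraction N X) \<phi> ?V \<longleftrightarrow> v \<in> ?V \<or> (\<exists>x\<in>ground N. v + \<phi> x \<in> ?V)" for v
    using XV subsp_add_cancel(2)[OF sub] by (auto simp: mem_elems contraction_def)
  then have "elems (contraction N X) \<phi> ?V = insert 0 (\<phi> ` ground N) + ?V"
    by (auto simp: mem_plus_iff)
  then show ?thesis by (simp add: elems_def ac_simps)
qed

section \<open>Simplification\<close>

definition simple_rep :: "'a matroid \<Rightarrow> ('a \<Rightarrow> 'v::xor_group) \<Rightarrow> 'v set \<Rightarrow> bool" where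
  "simple_rep N \<phi> U \<longleftrightarrow> rep N \<phi> U \<and> (\<forall>x\<in>ground N. \<phi> x \<notin> U) \<and>
     (\<forall>x\<in>ground N. \<forall>y\<in>ground N. \<phi> x + \<phi> y \<in> U \<longrightarrow> x = y)"

lemma rep_indep_single: "rep N \<phi> U \<Longrightarrow> {x} \<in> indep N \<longleftrightarrow> x \<in> ground N \<and> \<phi> x \<notin> U"
  by (auto simp: repD(4) subset_singleton_iff)

lemma rep_loop: "rep N \<phi> U \<Longrightarrow> loop N x \<longleftrightarrow> x \<in> ground N \<and> \<phi> x \<in> U"
  by (auto simp: loop_def rep_indep_single)

lemma rep_parallel:
  assumes N: "rep N \<phi> U"
  shows "parallel N x y \<longleftrightarrow> x \<in> ground N \<and> y \<in> ground N \<and> \<phi> x \<notin> U \<and> \<phi> y \<notin> U \<and> \<phi> x + \<phi> y \<in> U"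
proof (cases "x = y")
  case True
  then show ?thesis using subsp_0[OF repD(2)[OF N]] by (auto simp: parallel_def rep_indep_single[OF N])
next
  case False
  have "{x, y} \<in> indep N \<longleftrightarrow> \<phi> x + \<phi> y \<notin> U"
    if "x \<in> ground N" "y \<in> ground N" "\<phi> x \<notin> U" "\<phi> y \<notin> U"
  proof -
    have "D \<subseteq> {x, y} \<longleftrightarrow> D = {} \<or> D = {x} \<or> D = {y} \<or> D = {x, y}" for D by blast
    then show ?thesis using that False by (auto simp: repD(4)[OF N])
  qed
  then show ?thesis using False by (auto simp: parallel_def rep_indep_single[OF N])
qed

lemma simple_rep_if_simple:
  assumes "rep N \<phi> U" "simple_matroid N" shows "simple_rep N \<phi> U"
  using assms unfolding simple_rep_def simple_matroid_def
  by (auto simp: rep_loop rep_parallel)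

lemma rep_simplification:
  assumes N: "rep N \<phi> U" and N': "is_simplification N N'"
  shows "simple_rep N' \<phi> U" "elems N' \<phi> U = elems N \<phi> U"
proof -
  have subU: "subsp U" by (rule repD(2)[OF N])
  obtain X where X: "X \<subseteq> ground N" "N' = restriction N X" "\<And>x. x \<in> X \<Longrightarrow> \<not> loop N x"
    and ex1: "\<And>y. y \<in> ground N \<Longrightarrow> \<not> loop N y \<Longrightarrow> \<exists>!x. x \<in> X \<and> parallel N x y"
    using N' by (auto simp: is_simplification_def)
  have g: "ground N' = X" by (simp add: X restriction_def)
  have nl: "\<phi> x \<notin> U" if "x \<in> X" for x using X(1,3) that by (auto simp: rep_loop[OF N])
  have "x = y" if "x \<in> X" "y \<in> X" "\<phi> x + \<phi> y \<in> U" for x y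
  proof -
    have "parallel N x y" "parallel N y y" using that X(1) nl subsp_0[OF subU] by (auto simp: rep_parallel[OF N])
    moreover have "y \<in> ground N" "\<not> loop N y" using X(1,3) that by blast+
    ultimately show ?thesis using ex1[of y] that by blast
  qed
  then show "simple_rep N' \<phi> U"
    using rep_restriction[OF N X(1)] nl by (auto simp: simple_rep_def g X(2)[symmetric])
  have "\<exists>x\<in>X. v + \<phi> x \<in> U" if y: "y \<in> ground N" "v + \<phi> y \<in> U" "v \<notin> U" for v y
  proof -
    have "\<phi> y \<notin> U" using y subsp_add_cancel(2)[OF subU, of "\<phi> y" v] by blast
    then obtain x where x: "x \<in> X" "\<phi> x + \<phi> y \<in> U"
      using ex1[of y] y(1) by (auto simp: rep_loop[OF N] rep_parallel[OF N])
    then have "(v + \<phi> y) + (\<phi> x + \<phi> y) \<in> U" using y(2) subsp_add[OF subU] by blast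
    then show ?thesis using x(1) by (intro bexI[of _ x]) (simp_all add: ac_simps)
  qed
  then show "elems N' \<phi> U = elems N \<phi> U"
    using X(1) unfolding set_eq_iff mem_elems g by blast
qed

lemma rep_simplification_exists:
  assumes N: "rep N \<phi> U"
  shows "\<exists>N'. is_simplification N N'"
proof -
  have subU: "subsp U" by (rule repD(2)[OF N])
  \<comment> \<open>The choice depends only on the coset of \<open>\<phi> x\<close>, so
    \<open>r\<close> picks one representative from each parallel class.\<close>
  define r where "r x = (SOME y. y \<in> ground N \<and> \<phi> x + \<phi> y \<in> U)" for x
  have r: "r x \<in> ground N" "\<phi> x + \<phi> (r x) \<in> U" if "x \<in> ground N" for x
    using someI[of "\<lambda>y. y \<in> ground N \<and> \<phi> x + \<phi> y \<in> U" x] that subsp_0[OF subU] by (auto simp: r_def)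
  have r_eq: "r x = r y" if "\<phi> x + \<phi> y \<in> U" for x y
  proof -
    have "\<phi> x + \<phi> t \<in> U \<longleftrightarrow> \<phi> y + \<phi> t \<in> U" for t
      using subsp_add_cancel(1)[OF subU that, of "\<phi> y + \<phi> t"] by (simp add: ac_simps)
    then show ?thesis by (simp add: r_def)
  qed
  let ?X = "r ` {x \<in> ground N. \<phi> x \<notin> U}"
  have XU: "\<phi> x \<notin> U" "x \<in> ground N" if x: "x \<in> ?X" for x
  proof -
    obtain t where t: "t \<in> ground N" "\<phi> t \<notin> U" "x = r t" using x by blast
    then show "\<phi> x \<notin> U" "x \<in> ground N"
      using r[OF t(1)] subsp_add_cancel(2)[OF subU, of "\<phi> x" "\<phi> t"] by blast+
  qed
  have "is_simplification N (restriction N ?X)"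
    unfolding is_simplification_def
  proof (intro exI[of _ ?X] conjI ballI impI)
    show "?X \<subseteq> ground N" using r by auto
    show "\<not> loop N x" if "x \<in> ?X" for x using XU(1)[OF that] by (simp add: rep_loop[OF N])
    fix y assume y: "y \<in> ground N" "\<not> loop N y"
    then have yU: "\<phi> y \<notin> U" by (simp add: rep_loop[OF N])
    show "\<exists>!x. x \<in> ?X \<and> parallel N x y"
    proof (rule ex1I)
      show "r y \<in> ?X \<and> parallel N (r y) y"
      proof
        show ry: "r y \<in> ?X" using y yU by blast
        show "parallel N (r y) y"
          using y yU XU[OF ry] r(2)[of y] by (simp add: rep_parallel[OF N] add.commute)
      qed
      fix x assume x: "x \<in> ?X \<and> parallel N x y"
      then obtain t where t: "t \<in> ground N" "x = r t" by blast
      then have "\<phi> t + \<phi> x \<in> U" using r(2) by blast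
      moreover have "\<phi> x + \<phi> y \<in> U" using x by (simp add: rep_parallel[OF N])
      ultimately have "(\<phi> t + \<phi> x) + (\<phi> x + \<phi> y) \<in> U" using subsp_add[OF subU] by blast
      then show "x = r y" using r_eq[of t y] t(2) by (simp add: ac_simps)
    qed
  qed simp
  then show ?thesis by blast
qed

lemma rep_flat_of_subsp:
  assumes N: "rep N \<phi> U" and W: "subsp W" "U \<subseteq> W"
  shows "flat N {x \<in> ground N. \<phi> x \<in> W}"
proof -
  have "sp (\<phi> ` {x \<in> ground N. \<phi> x \<in> W}) \<subseteq> W" by (intro sp_least W) auto
  then have "sp (\<phi> ` {x \<in> ground N. \<phi> x \<in> W}) + U \<subseteq> W"
    using W by (auto elim!: set_plus_elim intro: subsp_add)
  then show ?thesis by (auto simp: rep_flat[OF N])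
qed

lemma elems_flat:
  assumes N: "rep N \<phi> U" and F: "flat N F"
  shows "elems (restriction N F) \<phi> U = elems N \<phi> U \<inter> (sp (\<phi> ` F) + U)"
proof -
  let ?W = "sp (\<phi> ` F) + U"
  have F': "F \<subseteq> ground N" "\<And>x. x \<in> ground N \<Longrightarrow> \<phi> x \<in> ?W \<Longrightarrow> x \<in> F"
    using F by (auto simp: rep_flat[OF N])
  have W: "subsp ?W" by (intro subsp_plus subsp_sp repD(2)[OF N])
  have UW: "U \<subseteq> ?W" using zero_in_sp by (auto simp: mem_plus_iff intro!: bexI[of _ 0])
  have FW: "\<phi> x \<in> ?W" if "x \<in> F" for x using that by (intro in_span_plus repD(2)[OF N])
  have "v + \<phi> x \<in> U \<Longrightarrow> v \<in> ?W \<longleftrightarrow> \<phi> x \<in> ?W" for v x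
    using UW subsp_add_cancel[OF W] by blast
  moreover have "ground (restriction N F) = F" by (simp add: restriction_def)
  ultimately show ?thesis
    using F' FW UW unfolding set_eq_iff Int_iff mem_elems by blast
qed

lemma elems_incl: "rep N \<phi> U \<Longrightarrow> x \<in> ground N \<Longrightarrow> \<phi> x \<in> elems N \<phi> U"
  unfolding mem_elems using subsp_0[OF repD(2), of N \<phi> U] by (metis add_self)

text \<open>The map \<open>\<phi>\<close> survives every step and only the kernel grows. To show
  that (i) implies (ii) and (iii), it then suffices that no obstruction is itself chordal.\<close>

lemma induced_minor_chordal:
  assumes "induced_minor M N" "rep M \<phi> U" "chordal (elems M \<phi> U)"
  shows "\<exists>U'. rep N \<phi> U' \<and> chordal (elems N \<phi> U')"
  using assms(1)
proof (induction rule: induced_minor.induct)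
  case refl
  then show ?case using assms(2,3) by blast
next
  case (contract N X N')
  then obtain V where N: "rep N \<phi> V" "chordal (elems N \<phi> V)" by blast
  have "finite X" using contract.hyps(2) repD(1)[OF N(1)] finite_subset by blast
  moreover have "\<phi> ` X \<subseteq> elems N \<phi> V"
    using contract.hyps(2) elems_incl[OF N(1)] by blast
  ultimately have "chordal (elems N \<phi> V + sp (\<phi> ` X))"
    using N(2) by (intro chordal_contract_sp) auto
  then have "chordal (elems N' \<phi> (sp (\<phi> ` X) + V))"
    using rep_simplification(2)[OF rep_contraction[OF N(1) contract.hyps(2)] contract.hyps(3)]
    by (simp add: elems_contraction[OF N(1) contract.hyps(2)])
  then show ?case
    using rep_simplification(1)[OF rep_contraction[OF N(1) contract.hyps(2)] contract.hyps(3)]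
    unfolding simple_rep_def by blast
next
  case (restrict N N')
  then obtain V where N: "rep N \<phi> V" "chordal (elems N \<phi> V)" by blast
  obtain F where F: "flat N F" "N' = restriction N F"
    using restrict.hyps(2) by (auto simp: induced_restriction_def)
  have "chordal (elems N' \<phi> V)"
    unfolding F(2) elems_flat[OF N(1) F(1)]
    using N by (intro chordal_Int_subsp subsp_plus subsp_sp repD(2)) auto
  moreover have "rep N' \<phi> V"
    using rep_restriction[OF N(1)] F by (auto simp: flat_def)
  ultimately show ?case by blast
qed

section \<open>Cycle spaces and isomorphisms\<close>

text \<open>\<open>Z\<close> is the cycle space of \<open>N\<close>, whose minimal nonempty members are the circuits.\<close>

definition cycles :: "'a matroid \<Rightarrow> 'a set set \<Rightarrow> bool" where
  "cycles N Z \<longleftrightarrow> finite (ground N) \<and> Z \<subseteq> Pow (ground N) \<and> {} \<in> Z \<and>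
     (\<forall>A\<in>Z. \<forall>B\<in>Z. symdiff A B \<in> Z) \<and>
     indep N = {I. I \<subseteq> ground N \<and> (\<forall>D\<in>Z. D \<subseteq> I \<longrightarrow> D = {})}"

lemma cycles_indep:
  assumes "cycles N Z"
  shows "X \<in> indep N \<longleftrightarrow> X \<subseteq> ground N \<and> (\<forall>D. D \<subseteq> X \<longrightarrow> D \<in> Z \<longrightarrow> D = {})"
proof -
  have "indep N = {I. I \<subseteq> ground N \<and> (\<forall>D\<in>Z. D \<subseteq> I \<longrightarrow> D = {})}"
    using assms by (simp only: cycles_def)
  then show ?thesis by blast
qed

lemma rep_cycles:
  assumes N: "rep N \<phi> U"
  shows "cycles N {D. D \<subseteq> ground N \<and> sum \<phi> D \<in> U}"
proof -
  have "sum \<phi> (symdiff A B) \<in> U"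
    if "A \<subseteq> ground N" "sum \<phi> A \<in> U" "B \<subseteq> ground N" "sum \<phi> B \<in> U" for A B
    using sum_symdiff[of A B \<phi>] that repD(1)[OF N] subsp_add[OF repD(2)[OF N]] finite_subset by metis
  moreover have "indep N = {I. I \<subseteq> ground N \<and> (\<forall>D\<in>{D. D \<subseteq> ground N \<and> sum \<phi> D \<in> U}. D \<subseteq> I \<longrightarrow> D = {})}"
    unfolding set_eq_iff repD(4)[OF N] mem_Collect_eq by blast
  ultimately show ?thesis
    using repD(1)[OF N] subsp_0[OF repD(2)[OF N]] unfolding cycles_def by auto
qed

text \<open>Independent sets determine the circuits, and every member of the cycle space is a
  disjoint union of circuits; these are split off one by one.\<close>

lemma cycles_iso_aux:
  assumes N: "cycles N Z" and N': "cycles N' Z'" and f: "inj_on f (ground N)"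
    and indep: "\<And>X. X \<subseteq> ground N \<Longrightarrow> X \<in> indep N \<longleftrightarrow> f ` X \<in> indep N'"
    and im: "f ` ground N \<subseteq> ground N'"
    and "D \<in> Z"
  shows "f ` D \<in> Z'"
  using assms(6)
proof (induction "card D" arbitrary: D rule: less_induct)
  case less
  have DG: "D \<subseteq> ground N" using less.prems N by (auto simp: cycles_def)
  have finD: "finite D" using DG N finite_subset by (auto simp: cycles_def)
  show ?case
  proof (cases "D = {}")
    case True
    then show ?thesis using N' by (simp add: cycles_def)
  next
    case False
    let ?F = "{C \<in> Z. C \<subseteq> D \<and> C \<noteq> {}}"
    have "finite ?F" using finD by simp
    moreover have "D \<in> ?F" using False less.prems by simp
    ultimately obtain C where "C \<in> ?F" "\<forall>B\<in>?F. B \<subseteq> C \<longrightarrow> C = B"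
      using finite_has_minimal[of ?F] by blast
    then have C: "C \<in> Z" "C \<subseteq> D" "C \<noteq> {}" and Cmin: "\<And>B. B \<in> Z \<Longrightarrow> B \<subseteq> C \<Longrightarrow> B \<noteq> {} \<Longrightarrow> B = C"
      by auto
    have CG: "C \<subseteq> ground N" using C DG by blast
    have "C \<notin> indep N" using C N by (auto simp: cycles_def)
    then have "f ` C \<notin> indep N'" using indep CG by blast
    moreover have "f ` C \<subseteq> ground N'" using CG im by blast
    ultimately obtain E where E: "E \<in> Z'" "E \<subseteq> f ` C" "E \<noteq> {}"
      using N' by (auto simp: cycles_def)
    obtain C0 where C0: "C0 \<subseteq> C" "E = f ` C0" using E(2) by (metis subset_imageE)
    have "C0 = C"
    proof (rule ccontr)
      assume "C0 \<noteq> C"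
      then have "\<forall>D\<in>Z. D \<subseteq> C0 \<longrightarrow> D = {}" using Cmin C0(1) by blast
      then have "C0 \<in> indep N" using C0(1) CG N by (simp add: cycles_def)
      then have "E \<in> indep N'" using indep C0 CG by blast
      then show False using E N' by (auto simp: cycles_def)
    qed
    then have fC: "f ` C \<in> Z'" using E C0 by simp
    have "symdiff D C = D - C" using C(2) by blast
    moreover have "symdiff D C \<in> Z" using N less.prems C(1) by (simp add: cycles_def)
    ultimately have "D - C \<in> Z" by simp
    moreover have "card (D - C) < card D" using C finD by (intro psubset_card_mono) auto
    ultimately have "f ` (D - C) \<in> Z'" using less.hyps by blast
    then have "symdiff (f ` (D - C)) (f ` C) \<in> Z'" using N' fC unfolding cycles_def by blast
    moreover have "f ` (D - C) = f ` D - f ` C" using f DG CG by (intro inj_on_image_set_diff) auto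
    then have "symdiff (f ` (D - C)) (f ` C) = f ` D" using C(2) by blast
    ultimately show ?thesis by simp
  qed
qed

lemma cycles_iso:
  assumes N: "cycles N Z" and N': "cycles N' Z'" and f: "bij_betw f (ground N) (ground N')"
    and indep: "\<And>X. X \<subseteq> ground N \<Longrightarrow> X \<in> indep N \<longleftrightarrow> f ` X \<in> indep N'"
    and D: "D \<subseteq> ground N"
  shows "D \<in> Z \<longleftrightarrow> f ` D \<in> Z'"
proof
  show "D \<in> Z \<Longrightarrow> f ` D \<in> Z'"
    using f by (intro cycles_iso_aux[OF N N' _ indep]) (auto simp: bij_betw_def)
  assume *: "f ` D \<in> Z'"
  let ?g = "the_inv_into (ground N) f"
  have g: "bij_betw ?g (ground N') (ground N)" by (rule bij_betw_the_inv_into[OF f])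
  have fg: "f ` ?g ` X = X" if "X \<subseteq> ground N'" for X
    using that f by (auto simp: image_image bij_betw_def f_the_inv_into_f subset_iff)
  have "?g ` (f ` D) \<in> Z"
  proof (rule cycles_iso_aux[OF N' N])
    show "X \<in> indep N' \<longleftrightarrow> ?g ` X \<in> indep N" if "X \<subseteq> ground N'" for X
      using indep[of "?g ` X"] fg[OF that] g that by (auto simp: bij_betw_def)
  qed (use g * in \<open>auto simp: bij_betw_def\<close>)
  moreover have "?g ` f ` D = D"
    using D f by (force simp: image_image bij_betw_def the_inv_into_f_f subset_iff)
  ultimately show "D \<in> Z" by simp
qed

lemma matroid_isoI_cycles:
  assumes N: "cycles N Z" and N': "cycles N' Z'" and f: "bij_betw f (ground N) (ground N')"
    and Z: "\<And>D. D \<subseteq> ground N \<Longrightarrow> D \<in> Z \<longleftrightarrow> f ` D \<in> Z'"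
  shows "matroid_iso N N'"
  unfolding matroid_iso_def
proof (intro exI[of _ f] conjI allI impI f)
  fix X assume X: "X \<subseteq> ground N"
  have fX: "f ` X \<subseteq> ground N'" using X f by (auto simp: bij_betw_def)
  have "X \<in> indep N \<longleftrightarrow> (\<forall>D. D \<subseteq> X \<longrightarrow> D \<in> Z \<longrightarrow> D = {})"
    using cycles_indep[OF N, of X] X by blast
  also have "\<dots> \<longleftrightarrow> (\<forall>D. D \<subseteq> X \<longrightarrow> f ` D \<in> Z' \<longrightarrow> f ` D = {})"
  proof -
    have "D \<in> Z \<longleftrightarrow> f ` D \<in> Z'" if "D \<subseteq> X" for D by (rule Z[OF subset_trans[OF that X]])
    then show ?thesis by simp
  qed
  also have "\<dots> \<longleftrightarrow> (\<forall>E. E \<subseteq> f ` X \<longrightarrow> E \<in> Z' \<longrightarrow> E = {})"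
    using all_subset_image[of f X "\<lambda>E. E \<in> Z' \<longrightarrow> E = {}"] by simp
  also have "\<dots> \<longleftrightarrow> f ` X \<in> indep N'"
    using cycles_indep[OF N', of "f ` X"] fX by blast
  finally show "X \<in> indep N \<longleftrightarrow> f ` X \<in> indep N'" .
qed

text \<open>Relabels the vectors of \<open>N\<close> by the elements of \<open>N'\<close>, so that
  one can compute with the edges of a concrete graph.\<close>

lemma iso_transfer:
  assumes iso: "matroid_iso N N'" and N: "rep N \<phi> U" and N': "cycles N' Z"
  obtains \<psi> where "\<And>D. D \<subseteq> ground N' \<Longrightarrow> sum \<psi> D \<in> U \<longleftrightarrow> D \<in> Z"
    "\<And>v. v \<in> elems N \<phi> U \<longleftrightarrow> v \<in> U \<or> (\<exists>e\<in>ground N'. v + \<psi> e \<in> U)"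
proof -
  obtain f where f: "bij_betw f (ground N) (ground N')"
    and indep: "\<And>X. X \<subseteq> ground N \<Longrightarrow> X \<in> indep N \<longleftrightarrow> f ` X \<in> indep N'"
    using iso by (auto simp: matroid_iso_def)
  let ?g = "the_inv_into (ground N) f"
  have g: "bij_betw ?g (ground N') (ground N)" by (rule bij_betw_the_inv_into[OF f])
  have fg: "f ` ?g ` X = X" if "X \<subseteq> ground N'" for X
    using that f by (auto simp: image_image bij_betw_def f_the_inv_into_f subset_iff)
  show ?thesis
  proof (rule that[of "\<phi> \<circ> ?g"])
    fix D assume D: "D \<subseteq> ground N'"
    have gD: "?g ` D \<subseteq> ground N" using g D by (auto simp: bij_betw_def)
    have "inj_on ?g D" using g D by (auto simp: bij_betw_def intro: inj_on_subset)
    then have "sum (\<phi> \<circ> ?g) D = sum \<phi> (?g ` D)" by (simp add: sum.reindex)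
    then show "sum (\<phi> \<circ> ?g) D \<in> U \<longleftrightarrow> D \<in> Z"
      using cycles_iso[OF rep_cycles[OF N] N' f indep gD] fg[OF D] gD by simp
  next
    fix v show "v \<in> elems N \<phi> U \<longleftrightarrow> v \<in> U \<or> (\<exists>e\<in>ground N'. v + (\<phi> \<circ> ?g) e \<in> U)"
    proof -
      have "(\<exists>x\<in>ground N. v + \<phi> x \<in> U) \<longleftrightarrow> (\<exists>x\<in>?g ` ground N'. v + \<phi> x \<in> U)"
        by (simp only: bij_betw_imp_surj_on[OF g])
      then show ?thesis by (simp add: mem_elems)
    qed
  qed
qed

text \<open>A converse of \<open>iso_transfer\<close>: vectors labelled by \<open>N'\<close> that
  exhaust \<open>elems N \<phi> U \<inter> W\<close> modulo \<open>U\<close>, with the right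
  relations, exhibit \<open>N'\<close> as a restriction to a flat. The last two premises say that
  \<open>N'\<close> is simple, which makes the labelling injective.\<close>

lemma induced_restriction_iso:
  fixes \<psi> :: "'b \<Rightarrow> 'v::xor_group"
  assumes N: "simple_rep N \<phi> U" and N': "cycles N' Z" and W: "subsp W" "U \<subseteq> W"
    and \<psi>: "\<And>e. e \<in> ground N' \<Longrightarrow> \<psi> e \<in> elems N \<phi> U \<inter> W"
    and cover: "\<And>s. s \<in> elems N \<phi> U \<inter> W \<Longrightarrow> s \<in> U \<or> (\<exists>e\<in>ground N'. s + \<psi> e \<in> U)"
    and Z: "\<And>D. D \<subseteq> ground N' \<Longrightarrow> sum \<psi> D \<in> U \<longleftrightarrow> D \<in> Z"
    and single: "\<And>e. {e} \<notin> Z" and pair: "\<And>e e'. e \<noteq> e' \<Longrightarrow> {e, e'} \<notin> Z"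
  shows "\<exists>N0. induced_restriction N N0 \<and> matroid_iso N0 N'"
proof -
  have rN: "rep N \<phi> U" and nU: "\<And>x. x \<in> ground N \<Longrightarrow> \<phi> x \<notin> U"
    and inj: "\<And>x y. x \<in> ground N \<Longrightarrow> y \<in> ground N \<Longrightarrow> \<phi> x + \<phi> y \<in> U \<Longrightarrow> x = y"
    using N by (auto simp: simple_rep_def)
  have subU: "subsp U" by (rule repD(2)[OF rN])
  let ?F = "{x \<in> ground N. \<phi> x \<in> W}"
  let ?N0 = "restriction N ?F"
  have flat: "flat N ?F" by (rule rep_flat_of_subsp[OF rN W])
  have r0: "rep ?N0 \<phi> U" by (rule rep_restriction[OF rN]) auto
  have g0: "ground ?N0 = ?F" by (simp add: restriction_def)
  have fin': "finite (ground N')" using N' by (simp add: cycles_def)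
  have inj\<psi>: "e = e'" if "e \<in> ground N'" "e' \<in> ground N'" "\<psi> e + \<psi> e' \<in> U" for e e'
    using Z[of "{e, e'}"] pair[of e e'] that by (cases "e = e'") auto
  have \<psi>U: "\<psi> e \<notin> U" if "e \<in> ground N'" for e using Z[of "{e}"] single[of e] that by auto
  have ex: "\<exists>x\<in>?F. \<psi> e + \<phi> x \<in> U" if e: "e \<in> ground N'" for e
  proof -
    obtain x where x: "x \<in> ground N" "\<psi> e + \<phi> x \<in> U" using \<psi>[OF e] \<psi>U[OF e] by (auto simp: mem_elems)
    then have "\<phi> x \<in> W" using \<psi>[OF e] W(2) subsp_add_cancel(1)[OF W(1), of "\<psi> e" "\<phi> x"] by blast
    then show ?thesis using x by blast
  qed
  define g where "g e = (SOME x. x \<in> ?F \<and> \<psi> e + \<phi> x \<in> U)" for e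
  have g: "g e \<in> ?F" "\<psi> e + \<phi> (g e) \<in> U" if "e \<in> ground N'" for e
    using someI_ex[of "\<lambda>x. x \<in> ?F \<and> \<psi> e + \<phi> x \<in> U"] ex[OF that] unfolding g_def by blast+
  have "inj_on g (ground N')"
  proof (rule inj_onI)
    fix e e' assume e: "e \<in> ground N'" "e' \<in> ground N'" "g e = g e'"
    then have "(\<psi> e + \<phi> (g e)) + (\<psi> e' + \<phi> (g e)) \<in> U" using g subsp_add[OF subU] by metis
    then show "e = e'" using inj\<psi>[OF e(1,2)] by (simp add: ac_simps)
  qed
  moreover have "g ` ground N' = ?F"
  proof (intro equalityI subsetI)
    fix x assume x: "x \<in> ?F"
    then have "\<phi> x \<in> elems N \<phi> U \<inter> W" "\<phi> x \<notin> U" using nU subsp_0[OF subU] by (auto simp: mem_elems intro!: bexI[of _ x])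
    then obtain e where e: "e \<in> ground N'" "\<phi> x + \<psi> e \<in> U" using cover by blast
    then have "(\<psi> e + \<phi> (g e)) + (\<phi> x + \<psi> e) \<in> U" using g(2) subsp_add[OF subU] by blast
    then have "g e = x" using inj[of "g e" x] g(1)[OF e(1)] x by (simp add: ac_simps)
    then show "x \<in> g ` ground N'" using e(1) by blast
  qed (use g in blast)
  ultimately have bij: "bij_betw g (ground N') (ground ?N0)" by (simp add: bij_betw_def g0)
  have sum: "sum \<phi> (g ` D) \<in> U \<longleftrightarrow> D \<in> Z" if D: "D \<subseteq> ground N'" for D
  proof -
    have "inj_on g D" using bij D by (auto simp: bij_betw_def intro: inj_on_subset)
    then have "sum \<psi> D + sum \<phi> (g ` D) = (\<Sum>e\<in>D. \<psi> e + \<phi> (g e))" by (simp add: sum.reindex sum.distrib)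
    also have "\<dots> \<in> U" using g(2) D by (intro subsp_sum[OF subU]) blast
    finally have "sum \<phi> (g ` D) \<in> U \<longleftrightarrow> sum \<psi> D \<in> U"
      using subsp_add_cancel[OF subU] by blast
    then show ?thesis using Z[OF D] by simp
  qed
  let ?f = "the_inv_into (ground N') g"
  have f: "bij_betw ?f (ground ?N0) (ground N')" by (rule bij_betw_the_inv_into[OF bij])
  have "matroid_iso ?N0 N'"
  proof (rule matroid_isoI_cycles[OF rep_cycles[OF r0] N' f])
    fix D assume D: "D \<subseteq> ground ?N0"
    have "g ` ?f ` D = D" using D bij by (auto simp: image_image bij_betw_def f_the_inv_into_f subset_iff)
    moreover have "?f ` D \<subseteq> ground N'" using f D by (auto simp: bij_betw_def)
    ultimately show "D \<in> {D. D \<subseteq> ground ?N0 \<and> sum \<phi> D \<in> U} \<longleftrightarrow> ?f ` D \<in> Z"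
      using sum[of "?f ` D"] D by simp
  qed
  then show ?thesis using flat by (auto simp: induced_restriction_def)
qed

subsection \<open>Cycle matroids of graphs and their duals\<close>

definition ind :: "'v set \<Rightarrow> 'v \<Rightarrow> bit" where
  "ind e = (\<lambda>j. if j \<in> e then 1 else 0)"

definition simple_graph :: "'v set set \<Rightarrow> bool" where
  "simple_graph G \<longleftrightarrow> finite G \<and> (\<forall>e\<in>G. card e = 2)"

lemma sum_fun_apply: "(\<Sum>a\<in>A. f a) x = (\<Sum>a\<in>A. f a x)"
  for f :: "'a \<Rightarrow> 'b \<Rightarrow> 'c::comm_monoid_add"
  by (induction A rule: infinite_finite_induct) auto

lemma ind_pair: "u \<noteq> v \<Longrightarrow> ind {u, v} = ind {u} + ind {v}"
  by (auto simp: ind_def fun_eq_iff)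

lemma cycle_edges_image: "cycle_edges vs = (\<lambda>i. {vs ! i, vs ! (Suc i mod length vs)}) ` {..<length vs}"
  by (auto simp: cycle_edges_def)

lemma Suc_mod_if: "i < n \<Longrightarrow> Suc i mod n = (if Suc i = n then 0 else Suc i)"
  by auto

text \<open>With only two vertices both indices would give the same edge; this is where length three
  enters.\<close>

lemma inj_on_cycle_edges:
  assumes "distinct vs" "3 \<le> length vs"
  shows "inj_on (\<lambda>i. {vs ! i, vs ! (Suc i mod length vs)}) {..<length vs}"
proof (rule inj_onI)
  let ?n = "length vs"
  fix i j assume ij: "i \<in> {..<?n}" "j \<in> {..<?n}"
    and eq: "{vs ! i, vs ! (Suc i mod ?n)} = {vs ! j, vs ! (Suc j mod ?n)}"
  have "0 < ?n" using assms(2) by linarith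
  then have "Suc i mod ?n < ?n" "Suc j mod ?n < ?n" by simp_all
  then have "i = j \<or> i = Suc j mod ?n \<and> Suc i mod ?n = j"
    using eq assms(1) ij by (auto simp: doubleton_eq_iff nth_eq_iff_index_eq)
  then show "i = j"
    using ij assms(2) by (auto simp: Suc_mod_if split: if_splits)
qed

lemma sum_ind_cycle_edges:
  assumes "distinct vs" "3 \<le> length vs"
  shows "sum ind (cycle_edges vs) = 0"
proof -
  let ?n = "length vs"
  have "sum ind (cycle_edges vs) = (\<Sum>i<?n. ind {vs ! i, vs ! (Suc i mod ?n)})"
    unfolding cycle_edges_image using inj_on_cycle_edges[OF assms] by (simp add: sum.reindex)
  also have "\<dots> = (\<Sum>i<?n. ind {vs ! i} + ind {vs ! (Suc i mod ?n)})"
  proof (rule sum.cong)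
    fix i assume "i \<in> {..<?n}"
    then have "Suc i mod ?n < ?n" "Suc i mod ?n \<noteq> i" "i < ?n" using assms(2) by (auto simp: Suc_mod_if)
    then have "vs ! i \<noteq> vs ! (Suc i mod ?n)" using assms(1) by (metis nth_eq_iff_index_eq)
    then show "ind {vs ! i, vs ! (Suc i mod ?n)} = ind {vs ! i} + ind {vs ! (Suc i mod ?n)}"
      by (rule ind_pair)
  qed simp
  also have "\<dots> = (\<Sum>i<?n. ind {vs ! i}) + (\<Sum>i<?n. ind {vs ! (Suc i mod ?n)})"
    by (rule sum.distrib)
  also have "(\<Sum>i<?n. ind {vs ! (Suc i mod ?n)}) = (\<Sum>i<?n. ind {vs ! i})"
  proof (rule sum.reindex_bij_betw)
    have inj: "inj_on (\<lambda>i. Suc i mod ?n) {..<?n}"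
      by (rule inj_onI) (auto simp: Suc_mod_if split: if_splits)
    moreover have "(\<lambda>i. Suc i mod ?n) ` {..<?n} \<subseteq> {..<?n}" by (auto simp: Suc_mod_if)
    ultimately show "bij_betw (\<lambda>i. Suc i mod ?n) {..<?n} {..<?n}"
      by (simp add: bij_betw_def endo_inj_surj)
  qed
  finally show ?thesis by (simp only: add_self)
qed

lemma even_degree_edge:
  assumes "finite D" "sum ind D = 0" "e \<in> D" "v \<in> e"
  shows "\<exists>e'\<in>D. e' \<noteq> e \<and> v \<in> e'"
proof (rule ccontr)
  assume "\<not> ?thesis"
  then have *: "\<forall>e'\<in>D - {e}. ind e' v = 0" by (auto simp: ind_def)
  have "(\<Sum>e'\<in>D. ind e' v) = ind e v + (\<Sum>e'\<in>D - {e}. ind e' v)"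
    using assms by (simp add: sum.remove)
  also have "\<dots> = 1" using * assms(4) by (simp add: ind_def sum.neutral)
  finally show False using assms(2) sum_fun_apply[of ind D v] by simp
qed

text \<open>Take a longest path. Even degree gives its first vertex a second edge, whose other end
  must lie on the path.\<close>

lemma even_contains_cycle:
  assumes fin: "finite D" and two: "\<And>e. e \<in> D \<Longrightarrow> card e = 2" and "D \<noteq> {}" and sum: "sum ind D = 0"
  shows "\<exists>vs. distinct vs \<and> 3 \<le> length vs \<and> cycle_edges vs \<subseteq> D"
proof -
  define path where "path vs \<longleftrightarrow> distinct vs \<and> 2 \<le> length vs \<and> (\<forall>i. Suc i < length vs \<longrightarrow> {vs ! i, vs ! Suc i} \<in> D)" for vs
  obtain e where "e \<in> D" using \<open>D \<noteq> {}\<close> by blast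
  then obtain a b where "a \<noteq> b" "{a, b} \<in> D" using two card_2_iff by metis
  then have p0: "path [a, b]" by (simp add: path_def)
  have finV: "finite (\<Union>D)" using fin two by (metis card.infinite finite_Union zero_neq_numeral)
  have bound: "length vs \<le> card (\<Union>D)" if "path vs" for vs
  proof -
    have "set vs \<subseteq> \<Union>D"
    proof
      fix v assume "v \<in> set vs"
      then obtain i where i: "i < length vs" "v = vs ! i" by (metis in_set_conv_nth)
      show "v \<in> \<Union>D"
      proof (cases "Suc i < length vs")
        case True
        then show ?thesis using that i by (auto simp: path_def)
      next
        case False
        then have "i \<noteq> 0" using that i by (auto simp: path_def)
        then obtain k where "i = Suc k" using not0_implies_Suc by blast
        then show ?thesis using that i by (auto simp: path_def)
      qed
    qed
    then have "card (set vs) \<le> card (\<Union>D)" using finV by (rule card_mono[rotated])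
    then show ?thesis using that by (simp add: path_def distinct_card)
  qed
  obtain vs where vs: "path vs" and max: "\<And>ws. path ws \<Longrightarrow> length ws \<le> length vs"
    using ex_has_greatest_nat[of path "[a, b]" length "Suc (card (\<Union>D))"] p0 bound by (metis le_imp_less_Suc)
  have dist: "distinct vs" and len: "2 \<le> length vs" and edge: "\<And>i. Suc i < length vs \<Longrightarrow> {vs ! i, vs ! Suc i} \<in> D"
    using vs by (auto simp: path_def)
  have "{vs ! 0, vs ! Suc 0} \<in> D" using edge[of 0] len by simp
  then obtain e' where e': "e' \<in> D" "e' \<noteq> {vs ! 0, vs ! Suc 0}" "vs ! 0 \<in> e'"
    using even_degree_edge[OF fin sum, of "{vs ! 0, vs ! Suc 0}" "vs ! 0"] by blast
  then obtain u where u: "e' = {u, vs ! 0}" "u \<noteq> vs ! 0"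
    using two[OF e'(1)] by (auto simp: card_2_iff)
  have "u \<in> set vs"
  proof (rule ccontr)
    assume "u \<notin> set vs"
    moreover have "{(u # vs) ! i, (u # vs) ! Suc i} \<in> D" if "Suc i < length (u # vs)" for i
      using that edge e'(1) u(1) by (cases i) auto
    ultimately have "path (u # vs)" using dist len by (simp add: path_def)
    then show False using max by fastforce
  qed
  then obtain k where k: "k < length vs" "u = vs ! k" by (metis in_set_conv_nth)
  \<comment> \<open>The new edge is neither a loop nor the first edge of the path, so the cycle has
    at least three vertices.\<close>
  have "k \<noteq> 0" "k \<noteq> Suc 0" using k u e'(2) by (auto simp: insert_commute)
  then have k2: "2 \<le> k" by simp
  let ?ws = "take (Suc k) vs"
  have lws: "length ?ws = Suc k" using k by simp
  have "cycle_edges ?ws \<subseteq> D"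
  proof
    fix e assume "e \<in> cycle_edges ?ws"
    then obtain i where i: "i < Suc k" "e = {?ws ! i, ?ws ! (Suc i mod Suc k)}"
      unfolding cycle_edges_def lws by blast
    show "e \<in> D"
    proof (cases "i = k")
      case True
      then show ?thesis using i u e' k by simp
    next
      case False
      then have "Suc i mod Suc k = Suc i" "Suc i < Suc k" using i by simp_all
      then show ?thesis using i edge[of i] k by simp
    qed
  qed
  moreover have "distinct ?ws" using dist by simp
  ultimately show ?thesis using k2 lws by (intro exI[of _ ?ws]) simp
qed

lemma rep_cycle_matroid:
  assumes "simple_graph G"
  shows "rep (cycle_matroid G) ind {0}"
proof -
  have fin: "finite G" and two: "\<And>e. e \<in> G \<Longrightarrow> card e = 2" using assms by (auto simp: simple_graph_def)
  have key: "(\<exists>vs. distinct vs \<and> 3 \<le> length vs \<and> cycle_edges vs \<subseteq> X) \<longleftrightarrow> (\<exists>D\<subseteq>X. sum ind D = 0 \<and> D \<noteq> {})"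
    if X: "X \<subseteq> G" for X
  proof
    assume "\<exists>vs. distinct vs \<and> 3 \<le> length vs \<and> cycle_edges vs \<subseteq> X"
    then obtain vs where vs: "distinct vs" "3 \<le> length vs" "cycle_edges vs \<subseteq> X" by blast
    moreover have "{..<length vs} \<noteq> {}" using vs(2) by (auto simp: lessThan_empty_iff)
    then have "cycle_edges vs \<noteq> {}" unfolding cycle_edges_image by blast
    ultimately show "\<exists>D\<subseteq>X. sum ind D = 0 \<and> D \<noteq> {}" using sum_ind_cycle_edges by blast
  next
    assume "\<exists>D\<subseteq>X. sum ind D = 0 \<and> D \<noteq> {}"
    then obtain D where D: "D \<subseteq> X" "sum ind D = 0" "D \<noteq> {}" by blast
    have "finite D" using finite_subset[OF _ fin] D(1) X by blast
    then obtain vs where "distinct vs" "3 \<le> length vs" "cycle_edges vs \<subseteq> D"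
      using even_contains_cycle[of D] D X two by blast
    then show "\<exists>vs. distinct vs \<and> 3 \<le> length vs \<and> cycle_edges vs \<subseteq> X" using D by blast
  qed
  have "indep (cycle_matroid G) =
      {X. X \<subseteq> G \<and> \<not> (\<exists>vs. distinct vs \<and> 3 \<le> length vs \<and> cycle_edges vs \<subseteq> X)}"
    by (simp add: cycle_matroid_def)
  also have "\<dots> = {I. I \<subseteq> G \<and> (\<forall>D\<subseteq>I. sum ind D = 0 \<longrightarrow> D = {})}"
  proof (rule Collect_cong, rule conj_cong[OF HOL.refl])
    fix X assume "X \<subseteq> G"
    then show "(\<not> (\<exists>vs. distinct vs \<and> 3 \<le> length vs \<and> cycle_edges vs \<subseteq> X)) =
        (\<forall>D\<subseteq>X. sum ind D = 0 \<longrightarrow> D = {})"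
      unfolding key[OF \<open>X \<subseteq> G\<close>] by metis
  qed
  finally have "indep (cycle_matroid G) = {I. I \<subseteq> G \<and> (\<forall>D\<subseteq>I. sum ind D = 0 \<longrightarrow> D = {})}" .
  moreover have "ground (cycle_matroid G) = G" by (simp add: cycle_matroid_def)
  ultimately show ?thesis unfolding rep_def using fin by (simp add: subsp_singleton)
qed

lemma ground_cycle_matroid [simp]: "ground (cycle_matroid G) = G"
  by (simp add: cycle_matroid_def)

lemma cycles_cycle_matroid:
  "simple_graph G \<Longrightarrow> cycles (cycle_matroid G) {D. D \<subseteq> G \<and> sum ind D = 0}"
  using rep_cycles[OF rep_cycle_matroid, of G] unfolding singleton_iff ground_cycle_matroid .

text \<open>For an edge with ends \<open>u\<close> and \<open>v\<close> the sum is
  \<open>h u + h v\<close>: the cut consists of the edges whose ends are coloured differently by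
  \<open>h\<close>.\<close>

definition cut :: "'v set set \<Rightarrow> ('v \<Rightarrow> bit) \<Rightarrow> 'v set set" where
  "cut G h = {e \<in> G. sum h e = 1}"

lemma cut_symdiff: "symdiff (cut G h) (cut G k) = cut G (h + k)"
proof -
  have "sum (h + k) e = sum h e + sum k e" for e unfolding plus_fun_apply by (rule sum.distrib)
  moreover have "a + b = 1 \<longleftrightarrow> (a = 1) \<noteq> (b = 1)" for a b :: bit by (cases a; cases b) simp_all
  ultimately have *: "sum (h + k) e = 1 \<longleftrightarrow> (sum h e = 1) \<noteq> (sum k e = 1)" for e by metis
  show ?thesis unfolding cut_def * by blast
qed

text \<open>The cycle space of the dual is the cut space: some basis avoids \<open>X\<close> iff the
  edges outside \<open>X\<close> span all edges, which fails exactly when \<open>X\<close> contains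
  a nonempty cut.\<close>

lemma cycles_dual_cycle_matroid:
  fixes G :: "'v set set"
  assumes G: "simple_graph G"
  shows "cycles (dual (cycle_matroid G)) (range (cut G))"
proof -
  let ?M = "cycle_matroid G"
  have r: "rep ?M ind {0}" by (rule rep_cycle_matroid[OF G])
  have fin: "finite G" and two: "\<And>e. e \<in> G \<Longrightarrow> card e = 2" using G by (auto simp: simple_graph_def)
  have finV: "finite (\<Union>G)" using fin two by (metis card.infinite finite_Union zero_neq_numeral)
  have plus0: "A + {0} = A" for A :: "('v \<Rightarrow> bit) set" by simp
  have "(\<exists>B. basis ?M B \<and> B \<inter> X = {}) \<longleftrightarrow> (\<forall>D\<in>range (cut G). D \<subseteq> X \<longrightarrow> D = {})" if X: "X \<subseteq> G" for X
  proof
    assume "\<exists>B. basis ?M B \<and> B \<inter> X = {}"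
    then obtain B where B: "basis ?M B" "B \<inter> X = {}" by blast
    then have BG: "B \<subseteq> G" by (auto simp: basis_def cycle_matroid_def)
    have finB: "finite B" using BG fin finite_subset by blast
    show "\<forall>D\<in>range (cut G). D \<subseteq> X \<longrightarrow> D = {}"
    proof (intro ballI impI, rule ccontr)
      fix D assume D: "D \<in> range (cut G)" "D \<subseteq> X" "D \<noteq> {}"
      then obtain h e where h: "D = cut G h" and e: "e \<in> D" by blast
      \<comment> \<open>A linear functional with value \<open>sum h e\<close> at the edge
        \<open>e\<close>. It vanishes on the basis \<open>B\<close>, which avoids the cut, and hence
        on all edges, although the cut is nonempty.\<close>
      define L where "L v = (\<Sum>j\<in>\<Union>G. v j * h j)" for v :: "'v \<Rightarrow> bit"
      have L_ind: "L (ind e) = sum h e" if "e \<in> G" for e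
      proof -
        have "L (ind e) = (\<Sum>j\<in>\<Union>G. if j \<in> e then h j else 0)"
          unfolding L_def by (intro sum.cong) (auto simp: ind_def)
        also have "\<dots> = sum h (\<Union>G \<inter> e)" using finV by (simp add: sum.inter_restrict)
        also have "\<Union>G \<inter> e = e" using that by blast
        finally show ?thesis .
      qed
      have L_sum: "L (sum ind Y) = (\<Sum>e\<in>Y. L (ind e))" for Y
        unfolding L_def sum_fun_apply sum_distrib_right by (rule sum.swap)
      have "e \<in> G" using e h by (auto simp: cut_def)
      then have "ind e \<in> sp (ind ` B)"
        using rep_basis[OF r B(1)] by (simp add: plus0 sp_incl)
      then obtain Y where Y: "Y \<subseteq> B" "ind e = sum ind Y" using sp_image_eq[OF finB] by blast
      have "L (ind e') = 0" if "e' \<in> Y" for e'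
      proof -
        have "e' \<in> G" "e' \<notin> cut G h" using that Y(1) BG B(2) D(2) h by blast+
        then show ?thesis using L_ind by (simp add: cut_def bit_not_one_iff)
      qed
      then have "L (ind e) = 0" using Y(2) L_sum by simp
      moreover have "L (ind e) = 1" using e h L_ind by (simp add: cut_def)
      ultimately show False by simp
    qed
  next
    assume *: "\<forall>D\<in>range (cut G). D \<subseteq> X \<longrightarrow> D = {}"
    define T where "T = sp (ind ` (G - X))"
    have T: "ind e0 \<in> T" if e0: "e0 \<in> G" for e0
    proof -
      obtain a b where ab: "e0 = {a, b}" "a \<noteq> b" using two[OF e0] by (auto simp: card_2_iff)
      \<comment> \<open>Vertices are coloured by whether they are connected to \<open>a\<close>
        inside \<open>T\<close>. Edges outside \<open>X\<close> have ends of equal colour, so the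
        cut is contained in \<open>X\<close> and therefore empty.\<close>
      define h :: "'v \<Rightarrow> bit" where "h u = (if ind {a} + ind {u} \<in> T then 1 else 0)" for u
      have "cut G h \<subseteq> X"
      proof (rule ccontr)
        assume "\<not> cut G h \<subseteq> X"
        then obtain e where e: "e \<in> G - X" "sum h e = 1" by (auto simp: cut_def)
        obtain u v where uv: "e = {u, v}" "u \<noteq> v" using two[of e] e by (auto simp: card_2_iff)
        have "ind {u} + ind {v} \<in> T" using e(1) uv unfolding T_def ind_pair[OF uv(2), symmetric] by (intro sp_incl) blast
        then have "ind {a} + ind {u} \<in> T \<longleftrightarrow> ind {a} + ind {v} \<in> T"
          using subsp_add_cancel(1)[OF subsp_sp, of "ind {u} + ind {v}" "ind ` (G - X)" "ind {a} + ind {v}"]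
          by (simp add: T_def ac_simps)
        then have "h u = h v" by (simp add: h_def)
        then show False using e(2) uv by simp
      qed
      then have "cut G h = {}" using * by blast
      then have "sum h e0 = 0" using e0 by (auto simp: cut_def bit_not_one_iff)
      moreover have "h a = 1" by (simp add: h_def T_def zero_in_sp)
      moreover have "sum h e0 = h a + h b" using ab by simp
      ultimately have "h b = 1" by (metis add_eq_0_iff_eq)
      then show ?thesis using ab by (simp add: h_def ind_pair split: if_splits)
    qed
    have GX: "G - X \<subseteq> ground ?M" by auto
    obtain B where B: "B \<in> indep ?M" "B \<subseteq> G - X" "sp (ind ` B) + {0} = T + {0}"
      using rep_max_indep[OF r GX] unfolding T_def by metis
    have "basis ?M B"
      unfolding basis_def
    proof (intro conjI ballI impI B(1), rule ccontr)
      fix C assume C: "C \<in> indep ?M" "B \<subseteq> C" "C \<noteq> B"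
      then obtain x where x: "x \<in> C" "x \<notin> B" by blast
      have xG: "x \<in> G" using C(1) x by (auto simp: cycle_matroid_def)
      have "insert x B \<in> indep ?M"
        using matroid.indep_mono[OF rep_matroid[OF r] C(1), of "insert x B"] C(2) x by blast
      then have "ind x \<notin> T" using rep_indep_insert[OF r B(1), of x] xG x(2) B(3) by (simp add: plus0)
      then show False using T xG by blast
    qed
    then show "\<exists>B. basis ?M B \<and> B \<inter> X = {}" using B(2) by blast
  qed
  then have indep: "indep (dual ?M) = {I. I \<subseteq> G \<and> (\<forall>D\<in>range (cut G). D \<subseteq> I \<longrightarrow> D = {})}"
    by (auto simp: dual_def)
  have empty: "{} \<in> range (cut G)" by (rule range_eqI[of _ _ 0]) (simp add: cut_def)
  have closed: "symdiff A B \<in> range (cut G)" if AB: "A \<in> range (cut G)" "B \<in> range (cut G)" for A B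
  proof -
    obtain h k where "A = cut G h" "B = cut G k" using AB by blast
    then have "symdiff A B = cut G (h + k)" by (simp only: cut_symdiff)
    then show ?thesis by blast
  qed
  have ground: "ground (dual ?M) = G" by (simp add: dual_def)
  show ?thesis
    unfolding cycles_def ground
  proof (intro conjI ballI)
    show "range (cut G) \<subseteq> Pow G" by (auto simp: cut_def)
    show "finite G" by (rule fin)
    show "{} \<in> range (cut G)" by (rule empty)
    show "symdiff A B \<in> range (cut G)" if "A \<in> range (cut G)" "B \<in> range (cut G)" for A B
      using that by (rule closed)
    show "indep (dual ?M) = {I. I \<subseteq> G \<and> (\<forall>D\<in>range (cut G). D \<subseteq> I \<longrightarrow> D = {})}" by (rule indep)
  qed
qed

lemma ground_dual [simp]: "ground (dual M) = ground M"
  by (simp add: dual_def)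

lemma elems_shift:
  assumes "subsp U" "u \<in> U"
  shows "v + u \<in> elems N \<phi> U \<longleftrightarrow> v \<in> elems N \<phi> U"
  unfolding elems_def by (rule mem_plus_shift[OF assms])

lemma elems_U: "U \<subseteq> elems N \<phi> U"
  by (auto simp: mem_elems)

lemma elems_shift':
  assumes "subsp U" "v + w \<in> U"
  shows "v \<in> elems N \<phi> U \<longleftrightarrow> w \<in> elems N \<phi> U"
  using elems_shift[OF assms, of v N \<phi>] by simp

lemma rep_finite_elems: "rep N \<phi> U \<Longrightarrow> finite (elems N \<phi> U)"
  unfolding elems_def by (intro finite_set_plus) (auto simp: rep_def)

subsection \<open>Cycle graphs\<close>

lemma cycle_graph_image: "cycle_graph n = (\<lambda>i. {i, Suc i mod n}) ` {..<n}"
proof -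
  have "[0..<n] ! i = i" "[0..<n] ! (Suc i mod n) = Suc i mod n" if "i < n" for i
  proof -
    have "Suc i mod n < n" using that by (cases n) auto
    then show "[0..<n] ! i = i" "[0..<n] ! (Suc i mod n) = Suc i mod n" using that by simp_all
  qed
  then show ?thesis unfolding cycle_graph_def cycle_edges_image by auto
qed

lemma simple_cycle_graph:
  assumes "3 \<le> n" shows "simple_graph (cycle_graph n)"
proof -
  have "i \<noteq> Suc i mod n" if "i < n" for i using that assms by (simp add: Suc_mod_if)
  then show ?thesis by (auto simp: simple_graph_def cycle_graph_image card_2_iff)
qed

lemma card_cycle_graph:
  assumes "3 \<le> n" shows "card (cycle_graph n) = n"
proof -
  have "inj_on (\<lambda>i. {[0..<n] ! i, [0..<n] ! (Suc i mod length [0..<n])}) {..<length [0..<n]}"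
    using assms by (intro inj_on_cycle_edges) auto
  from card_image[OF this] show ?thesis
    unfolding cycle_graph_def cycle_edges_image by (simp only: card_lessThan length_upt diff_zero)
qed

text \<open>An edge forces the next one, since the vertex between them has even degree.\<close>

lemma even_cycle_graph:
  assumes n: "3 \<le> n" and D: "D \<subseteq> cycle_graph n" "sum ind D = 0" "D \<noteq> {}"
  shows "D = cycle_graph n"
proof -
  let ?e = "\<lambda>i. {i, Suc i mod n}"
  have finD: "finite D" using D(1) finite_subset by (auto simp: cycle_graph_image)
  have step: "?e (Suc i mod n) \<in> D" if i: "i < n" "?e i \<in> D" for i
  proof -
    obtain e' where e': "e' \<in> D" "e' \<noteq> ?e i" "Suc i mod n \<in> e'"
      using even_degree_edge[OF finD D(2) i(2), of "Suc i mod n"] by blast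
    then obtain j where j: "j < n" "e' = ?e j" using D(1) by (auto simp: cycle_graph_image)
    have "Suc i mod n = j"
    proof (rule ccontr)
      assume "Suc i mod n \<noteq> j"
      then have "Suc i mod n = Suc j mod n" using e'(3) j(2) by auto
      then have "i = j" using i(1) j(1) by (simp add: Suc_mod_if split: if_splits)
      then show False using e'(2) j(2) by simp
    qed
    then show ?thesis using e'(1) j(2) by simp
  qed
  obtain i where i: "i < n" "?e i \<in> D" using D(1,3) by (auto simp: cycle_graph_image)
  have all: "?e ((i + k) mod n) \<in> D" for k
  proof (induction k)
    case 0
    then show ?case using i by simp
  next
    case (Suc k)
    have "Suc ((i + k) mod n) mod n = (i + Suc k) mod n" by (simp add: mod_Suc_eq)
    moreover have "(i + k) mod n < n" using i(1) by simp
    ultimately show ?case using step[OF _ Suc.IH] by metis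
  qed
  have "?e j \<in> D" if "j < n" for j
  proof -
    have "(i + (n - i + j)) mod n = j" using that i(1) by simp
    then show ?thesis using all[of "n - i + j"] by metis
  qed
  then show ?thesis using D(1) by (auto simp: cycle_graph_image)
qed

lemma cycles_cycle_graph:
  assumes "3 \<le> n"
  shows "cycles (cycle_matroid (cycle_graph n)) {{}, cycle_graph n}"
proof -
  have "sum ind (cycle_graph n) = 0"
    unfolding cycle_graph_def using assms by (intro sum_ind_cycle_edges) auto
  then have "D \<subseteq> cycle_graph n \<and> sum ind D = 0 \<longleftrightarrow> D = {} \<or> D = cycle_graph n" for D
    using even_cycle_graph[OF assms, of D] by (metis order_refl empty_subsetI sum.empty)
  then have "{D. D \<subseteq> cycle_graph n \<and> sum ind D = 0} = {{}, cycle_graph n}"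
    by blast
  then show ?thesis using cycles_cycle_matroid[OF simple_cycle_graph[OF assms]] by simp
qed

text \<open>Contracting all elements but four leaves a 4-circuit without diagonals, against
  \<open>chordal_odd_diag\<close>.\<close>

lemma chordal_no_long_cycle:
  assumes N: "rep N \<phi> U" and ch: "chordal (elems N \<phi> U)" and n: "4 \<le> n"
  shows "\<not> matroid_iso N (cycle_matroid (cycle_graph n))"
proof
  let ?G = "cycle_graph n"
  let ?S = "elems N \<phi> U"
  assume iso: "matroid_iso N (cycle_matroid ?G)"
  have n3: "3 \<le> n" using n by simp
  obtain \<psi> where sums: "\<And>D. D \<subseteq> ?G \<Longrightarrow> sum \<psi> D \<in> U \<longleftrightarrow> D \<in> {{}, ?G}"
    and S: "\<And>v. v \<in> ?S \<longleftrightarrow> v \<in> U \<or> (\<exists>e\<in>?G. v + \<psi> e \<in> U)"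
    using iso_transfer[OF iso N cycles_cycle_graph[OF n3]] by (metis ground_cycle_matroid)
  have subU: "subsp U" by (rule repD(2)[OF N])
  have finG: "finite ?G" using simple_cycle_graph[OF n3] by (simp add: simple_graph_def)
  have "\<exists>Q\<subseteq>?G. card Q = 4" using card_cycle_graph[OF n3] n obtain_subset_with_card_n by metis
  then obtain Q where Q: "Q \<subseteq> ?G" "card Q = 4" by blast
  define Y where "Y = ?G - Q"
  have finY: "finite Y" using finG by (simp add: Y_def)
  have \<psi>S: "\<psi> e \<in> ?S" if "e \<in> ?G" for e
    unfolding S using that subsp_0[OF subU] by (metis add_self)
  then have YS: "\<psi> ` Y \<subseteq> ?S" by (auto simp: Y_def)
  let ?T = "?S + sp (\<psi> ` Y)"
  have "chordal ?T" using ch YS finY by (intro chordal_contract_sp) auto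
  then have odd: "odd_diag ?T" by (rule chordal_odd_diag)
  have T: "v \<in> ?T \<longleftrightarrow> (\<exists>Z\<subseteq>Y. v + sum \<psi> Z \<in> ?S)" for v
    unfolding add.commute[of ?S] by (rule mem_span_plus[OF finY])
  have pair: "\<psi> p + \<psi> q \<notin> ?T" if pq: "p \<in> Q" "q \<in> Q" "p \<noteq> q" for p q
  proof
    assume "\<psi> p + \<psi> q \<in> ?T"
    then obtain Z where Z: "Z \<subseteq> Y" "\<psi> p + \<psi> q + sum \<psi> Z \<in> ?S" unfolding T by blast
    define A where "A = insert p (insert q Z)"
    have finZ: "finite Z" using Z finY finite_subset by blast
    have pZ: "p \<notin> Z" "q \<notin> Z" using Z pq by (auto simp: Y_def)
    have sumA: "sum \<psi> A = \<psi> p + \<psi> q + sum \<psi> Z"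
      unfolding A_def using finZ pZ pq(3) by (simp add: ac_simps)
    have AG: "A \<subseteq> ?G" using Z pq Q by (auto simp: A_def Y_def)
    have finA: "finite A" using finZ by (simp add: A_def)
    have "finite Q" using Q finG finite_subset by blast
    then have "card (Q - {p, q}) = 2" using Q(2) pq by (simp add: card_Diff_subset)
    then obtain r s where rs: "Q - {p, q} = {r, s}" "r \<noteq> s" by (auto simp: card_2_iff)
    have "r \<in> Q - {p, q}" "s \<in> Q - {p, q}" unfolding rs(1) by simp_all
    then have rsA: "r \<notin> A" "s \<notin> A" "r \<in> ?G" "s \<in> ?G" using Q(1) Z(1) unfolding A_def Y_def by blast+
    consider "sum \<psi> A \<in> U" | t where "t \<in> ?G" "sum \<psi> A + \<psi> t \<in> U"
      using Z(2) unfolding sumA[symmetric] S by blast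
    then show False
    proof cases
      case 1
      then have "A = {} \<or> A = ?G" using sums[OF AG] by blast
      then show False using rsA by (auto simp: A_def)
    next
      case 2
      have "sum \<psi> (symdiff A {t}) = sum \<psi> A + \<psi> t" using sum_symdiff[of A "{t}" \<psi>] finA by simp
      then have "symdiff A {t} \<in> {{}, ?G}" using sums[of "symdiff A {t}"] AG 2 by auto
      then consider "symdiff A {t} = {}" | "symdiff A {t} = ?G" by blast
      then show False
      proof cases
        case 1
        then have "A = {t}" by blast
        then show False using pq(3) by (auto simp: A_def)
      next
        case 2
        \<comment> \<open>Both remaining elements \<open>r\<close> and \<open>s\<close> would have
          to be the single element \<open>t\<close>.\<close>
        have "r \<in> symdiff A {t}" "s \<in> symdiff A {t}" unfolding 2 using rsA by blast+
        then show False using rsA rs(2) by blast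
      qed
    qed
  qed
  have "card Q = Suc (Suc (Suc (Suc 0)))" using Q(2) by simp
  then obtain x y w v where Q4: "Q = {x, y, w, v}" "x \<noteq> y" "x \<noteq> w" "x \<noteq> v" "y \<noteq> w" "y \<noteq> v" "w \<noteq> v"
    by (auto simp: card_Suc_eq)
  have ST: "?S \<subseteq> ?T" by (rule subset_plus[OF subsp_sp])
  have xS: "\<psi> e \<in> ?T" if "e \<in> Q" for e
    using \<psi>S[of e] that Q(1) ST by blast
  have "sum \<psi> ?G = sum \<psi> Y + sum \<psi> Q" unfolding Y_def using Q finG by (intro sum.subset_diff)
  moreover have "sum \<psi> Q = \<psi> x + (\<psi> y + (\<psi> w + \<psi> v))" using Q4 by simp
  moreover have "sum \<psi> ?G \<in> U" using sums[of ?G] by simp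
  ultimately have "(\<psi> x + \<psi> y + \<psi> w + sum \<psi> Y) + \<psi> v \<in> U" by (simp add: ac_simps)
  moreover have "v \<in> ?G" using Q(1) Q4 by blast
  ultimately have "\<psi> x + \<psi> y + \<psi> w + sum \<psi> Y \<in> ?S" unfolding S by blast
  then have "\<psi> x + \<psi> y + \<psi> w \<in> ?T" unfolding T by blast
  then show False
    using odd_diagD[OF odd xS[of x] xS[of y] xS[of w]] pair[of x y] pair[of x w] pair[of y w] Q4 by simp
qed

text \<open>The condition on subset sums already contains the minimality of \<open>C\<close>, since
  \<open>C\<close> avoids \<open>U\<close>. It also shows that, modulo \<open>U\<close>, the span of
  \<open>C\<close> contains no member of \<open>elems N \<phi> U\<close> except 0 and the vectors of
  \<open>C\<close>.\<close>

lemma chordless_iso: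
  assumes N: "simple_rep N \<phi> U" and C: "chordless (elems N \<phi> U) U C"
  shows "\<exists>N0. induced_restriction N N0 \<and> matroid_iso N0 (cycle_matroid (cycle_graph (card C)))"
proof -
  let ?n = "card C"
  let ?G = "cycle_graph ?n"
  let ?S = "elems N \<phi> U"
  have fin: "finite C" and card4: "4 \<le> ?n" and CS: "C \<subseteq> ?S - U" and sumC: "\<Sum>C \<in> U"
    and chord: "\<And>D. D \<subseteq> C \<Longrightarrow> \<Sum>D \<in> ?S \<Longrightarrow> card D \<le> 1 \<or> card (C - D) \<le> 1"
    using C by (auto simp: chordless_def)
  have n3: "3 \<le> ?n" using card4 by simp
  have subU: "subsp U" using N by (simp add: simple_rep_def rep_def)
  have finG: "finite ?G" using simple_cycle_graph[OF n3] by (simp add: simple_graph_def)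
  obtain \<psi> where \<psi>: "bij_betw \<psi> ?G C"
    using finite_same_card_bij[OF finG fin] card_cycle_graph[OF n3] by auto
  have sum_img: "sum \<psi> D = \<Sum>(\<psi> ` D)" if "D \<subseteq> ?G" for D
    using that \<psi> by (simp add: sum.reindex inj_on_subset[of \<psi> ?G D] bij_betw_def)
  have D_cases: "D = {} \<or> (\<exists>c\<in>C. D = {c}) \<or> D = C \<or> (\<exists>c\<in>C. C - D = {c})" if "D \<subseteq> C" "\<Sum>D \<in> ?S" for D
  proof -
    have "finite D" "finite (C - D)" using that fin finite_subset by auto
    then have "D = {} \<or> (\<exists>c. D = {c}) \<or> C - D = {} \<or> (\<exists>c. C - D = {c})"
      using chord[OF that] by (auto simp: le_Suc_eq card_1_singleton_iff)
    then show ?thesis using that(1) by blast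
  qed
  have compl: "\<Sum>D + c \<in> U" if "D \<subseteq> C" "C - D = {c}" for D c
    using sum.subset_diff[OF that(1) fin, of "\<lambda>x. x"] that(2) sumC by (simp add: add.commute)
  have zero: "\<Sum>D \<in> U \<longleftrightarrow> D = {} \<or> D = C" if D: "D \<subseteq> C" for D
  proof
    assume *: "\<Sum>D \<in> U"
    then have "\<Sum>D \<in> ?S" using elems_U by blast
    moreover have "D \<noteq> {c}" if "c \<in> C" for c using that CS * by auto
    moreover have "C - D \<noteq> {c}" if "c \<in> C" for c
      using that CS * compl[OF D, of c] subsp_add_cancel(1)[OF subU *, of c] by blast
    ultimately show "D = {} \<or> D = C" using D_cases[OF D] by blast
  qed (use sumC subsp_0[OF subU] in auto)
  show ?thesis
  proof (rule induced_restriction_iso[OF N cycles_cycle_graph[OF n3], of "sp C + U" \<psi>])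
    show "subsp (sp C + U)" by (intro subsp_plus subsp_sp subU)
    show "U \<subseteq> sp C + U" using zero_in_sp by (auto simp: mem_plus_iff intro!: bexI[of _ 0])
    have CW: "C \<subseteq> sp C + U" using sp_superset subset_plus[OF subU] by blast
    show "\<psi> e \<in> ?S \<inter> (sp C + U)" if "e \<in> ground (cycle_matroid ?G)" for e
      using that \<psi> CS CW by (auto simp: bij_betw_def)
    show "sum \<psi> D \<in> U \<longleftrightarrow> D \<in> {{}, ?G}" if D: "D \<subseteq> ground (cycle_matroid ?G)" for D
    proof -
      have DG: "D \<subseteq> ?G" using D by simp
      have inj: "inj_on \<psi> ?G" and im: "\<psi> ` ?G = C" using \<psi> by (auto simp: bij_betw_def)
      have "\<psi> ` D \<subseteq> C" using image_mono[OF DG, of \<psi>] im by simp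
      moreover have "\<psi> ` D = C \<longleftrightarrow> D = ?G" using inj_on_image_eq_iff[OF inj DG order_refl] im by simp
      ultimately show ?thesis using zero[of "\<psi> ` D"] sum_img[OF DG] by simp
    qed
    have G2: "card ?G > 2" using card_cycle_graph[OF n3] card4 by simp
    show "{e} \<notin> {{}, ?G}" for e
    proof
      assume "{e} \<in> {{}, ?G}"
      then have "card ?G = card {e}" by auto
      then show False using G2 by simp
    qed
    show "{e, e'} \<notin> {{}, ?G}" for e e'
    proof
      assume "{e, e'} \<in> {{}, ?G}"
      then have "card ?G = card {e, e'}" by auto
      then show False using G2 card_insert_le_m1[of 2 "{e'}" e] by simp
    qed
    fix s assume s: "s \<in> ?S \<inter> (sp C + U)"
    then obtain D where D: "D \<subseteq> C" "s + \<Sum>D \<in> U"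
      using mem_span_plus[OF fin, of s "\<lambda>x. x" U] by auto
    then have "\<Sum>D \<in> ?S" using s elems_shift'[OF subU D(2)] by blast
    then consider "D = {}" | c where "c \<in> C" "D = {c}" | "D = C" | c where "c \<in> C" "C - D = {c}"
      using D_cases[OF D(1)] by blast
    then have "s \<in> U \<or> (\<exists>c\<in>C. s + c \<in> U)"
    proof cases
      case 1
      then show ?thesis using D by simp
    next
      case (2 c)
      then show ?thesis using D by auto
    next
      case 3
      then show ?thesis using D sumC subsp_add_cancel(2)[OF subU sumC, of s] by simp
    next
      case (4 c)
      then have "(s + \<Sum>D) + (\<Sum>D + c) \<in> U" using subsp_add[OF subU D(2) compl[OF D(1)]] by blast
      then show ?thesis using 4(1) by (auto simp: add.assoc)
    qed
    then show "s \<in> U \<or> (\<exists>e\<in>ground (cycle_matroid ?G). s + \<psi> e \<in> U)"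
      using bij_betw_imp_surj_on[OF \<psi>] by force
  qed
qed

subsection \<open>The complete graph on four vertices\<close>

(* keeps the vertices of the graphs below in the form of numerals *)
declare One_nat_def [simp del]

lemma K4_eq: "K4 = {{0, 1}, {0, 2}, {0, 3}, {1, 2}, {1, 3}, {2, 3}}"
proof -
  have four: "u < 4 \<longleftrightarrow> u = 0 \<or> u = 1 \<or> u = 2 \<or> u = 3" for u :: nat by linarith
  show ?thesis
  proof (rule subset_antisym; rule subsetI)
    fix e assume "e \<in> K4"
    then obtain u v where e: "e = {u, v}" and uv: "u < 4" "v < 4" "u \<noteq> v" unfolding K4_def by blast
    show "e \<in> {{0, 1}, {0, 2}, {0, 3}, {1, 2}, {1, 3}, {2, 3}}"
      using uv(3) uv(1,2)[unfolded four] unfolding e by (elim disjE) (simp_all add: insert_commute)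
  next
    fix e assume e: "e \<in> {{0, 1}, {0, 2}, {0, 3}, {1, 2}, {1, 3}, {2, 3} :: nat set}"
    have K: "{u, v} \<in> K4" if "u < 4" "v < 4" "u \<noteq> v" for u v using that unfolding K4_def by blast
    show "e \<in> K4" using e by (elim insertE emptyE; hypsubst) (simp_all add: K)
  qed
qed

lemma simple_K4: "simple_graph K4"
  unfolding simple_graph_def K4_eq by (auto simp: card_insert_if)

text \<open>Each edge contributes the values of \<open>c\<close> at its ends, so only vertices of
  odd degree in \<open>D\<close> survive.\<close>

lemma sum_potential:
  fixes c :: "'v \<Rightarrow> 'a::xor_group"
  assumes "finite V" "finite D" "\<And>e. e \<in> D \<Longrightarrow> e \<subseteq> V"
  shows "(\<Sum>e\<in>D. sum c e) = (\<Sum>j\<in>V. if sum ind D j = 1 then c j else 0)"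
  using assms(2,3)
proof (induction D rule: finite_induct)
  case empty
  then show ?case by simp
next
  case (insert e D)
  have "sum c e = (\<Sum>j\<in>V. if ind e j = 1 then c j else 0)"
    using insert.prems[of e] assms(1) by (simp add: ind_def sum.If_cases Int_absorb1 cong: if_cong)
  moreover have "(if ind e j = 1 then c j else 0) + (if sum ind D j = 1 then c j else 0) =
      (if sum ind (insert e D) j = 1 then c j else 0)" for j
  proof -
    have "sum ind (insert e D) j = ind e j + sum ind D j" using insert.hyps by simp
    then show ?thesis by (cases "ind e j"; cases "sum ind D j") simp_all
  qed
  ultimately show ?case using insert by (simp add: sum.distrib[symmetric])
qed

text \<open>The edges of the path 0, 1, 2, 3 and the edge \<open>{0, 3}\<close> form a 4-circuit
  with two diagonals, \<open>{0, 2}\<close> and \<open>{1, 3}\<close>. The third would be the sum of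
  \<open>{0, 1}\<close> and \<open>{2, 3}\<close>, which is not an edge.\<close>

lemma chordal_no_K4:
  assumes N: "rep N \<phi> U" and ch: "chordal (elems N \<phi> U)"
  shows "\<not> matroid_iso N (cycle_matroid K4)"
proof
  let ?S = "elems N \<phi> U"
  assume iso: "matroid_iso N (cycle_matroid K4)"
  obtain \<psi> where \<psi>: "\<And>D. D \<subseteq> ground (cycle_matroid K4) \<Longrightarrow> sum \<psi> D \<in> U \<longleftrightarrow> D \<in> {D. D \<subseteq> K4 \<and> sum ind D = 0}"
    "\<And>v. v \<in> ?S \<longleftrightarrow> v \<in> U \<or> (\<exists>e\<in>ground (cycle_matroid K4). v + \<psi> e \<in> U)"
    by (rule iso_transfer[OF iso N cycles_cycle_matroid[OF simple_K4]]) (rule that)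
  have sums: "sum \<psi> D \<in> U \<longleftrightarrow> sum ind D = 0" if "D \<subseteq> K4" for D using \<psi>(1)[of D] that by simp
  have S: "v \<in> ?S \<longleftrightarrow> v \<in> U \<or> (\<exists>e\<in>K4. v + \<psi> e \<in> U)" for v using \<psi>(2)[of v] by simp
  have subU: "subsp U" by (rule repD(2)[OF N])
  have odd: "odd_diag ?S" using ch by (rule chordal_odd_diag)
  have \<psi>S: "\<psi> e \<in> ?S" if "e \<in> K4" for e
    unfolding S using that subsp_0[OF subU] by (metis add_self)
  let ?x = "\<psi> {0, 1}" and ?y = "\<psi> {1, 2}" and ?w = "\<psi> {2, 3}"
  have tri: "\<psi> {a, b} + \<psi> {b, c} + \<psi> {a, c} \<in> U"
    if "{a, b} \<in> K4" "{b, c} \<in> K4" "{a, c} \<in> K4" "a \<noteq> b" "b \<noteq> c" "a \<noteq> c" for a b c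
  proof -
    have "sum ind {{a, b}, {b, c}, {a, c}} = (0 :: nat \<Rightarrow> bit)"
      using that(4-6) by (simp add: doubleton_eq_iff ind_pair ac_simps)
    moreover have "sum \<psi> {{a, b}, {b, c}, {a, c}} = \<psi> {a, b} + \<psi> {b, c} + \<psi> {a, c}"
      using that(4-6) by (simp add: doubleton_eq_iff ac_simps)
    ultimately show ?thesis using sums[of "{{a, b}, {b, c}, {a, c}}"] that(1-3) by simp
  qed
  have K: "{0, 1} \<in> K4" "{0, 2} \<in> K4" "{0, 3} \<in> K4" "{1, 2} \<in> K4" "{1, 3} \<in> K4" "{2, 3} \<in> K4"
    unfolding K4_eq by simp_all
  have "?x + ?y + \<psi> {0, 2} \<in> U" "?y + ?w + \<psi> {1, 3} \<in> U" "\<psi> {0, 2} + ?w + \<psi> {0, 3} \<in> U"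
    using tri[of 0 1 2] tri[of 1 2 3] tri[of 0 2 3] K by simp_all
  then have xy: "?x + ?y \<in> ?S" and yw: "?y + ?w \<in> ?S"
    and xyw: "(?x + ?y + \<psi> {0, 2}) + (\<psi> {0, 2} + ?w + \<psi> {0, 3}) \<in> U"
    using K subsp_add[OF subU] unfolding S by blast+
  have "(?x + ?y + ?w) + \<psi> {0, 3} \<in> U" using xyw by (simp add: ac_simps)
  then have "?x + ?y + ?w \<in> ?S" using K unfolding S by blast
  then have "?x + ?w \<in> ?S"
    using odd_diagD[OF odd, of ?x ?y ?w] xy yw \<psi>S K by blast
  moreover have xw: "sum \<psi> {{0, 1}, {2, 3}} = ?x + ?w" "sum ind {{0, 1}, {2, 3}} = (ind {0, 1} + ind {2, 3} :: nat \<Rightarrow> bit)"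
    by (simp_all add: doubleton_eq_iff)
  ultimately consider "?x + ?w \<in> U" | t where "t \<in> K4" "?x + ?w + \<psi> t \<in> U" unfolding S by blast
  then show False
  proof cases
    case 1
    then have "ind {0, 1} + ind {2, 3} = (0 :: nat \<Rightarrow> bit)" using sums[of "{{0, 1}, {2, 3}}"] K xw by simp
    then have "(ind {0, 1} + ind {2, 3} :: nat \<Rightarrow> bit) 0 = 0" by simp
    then show False by (simp add: ind_def)
  next
    case 2
    have sub: "symdiff {{0, 1}, {2, 3}} {t} \<subseteq> K4" using K 2(1) by blast
    have "sum \<psi> (symdiff {{0, 1}, {2, 3}} {t}) = ?x + ?w + \<psi> t"
      using sum_symdiff[of "{{0, 1}, {2, 3}}" "{t}" \<psi>] xw(1) by simp
    then have "sum ind (symdiff {{0, 1}, {2, 3}} {t}) = (0 :: nat \<Rightarrow> bit)"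
      using sums[OF sub] 2(2) by simp
    then have "ind {0, 1} + ind {2, 3} + ind t = (0 :: nat \<Rightarrow> bit)"
      using sum_symdiff[of "{{0, 1}, {2, 3}}" "{t}" ind] xw(2) by simp
    then have *: "(ind {0, 1} + ind {2, 3} + ind t :: nat \<Rightarrow> bit) j = 0" for j by simp
    have "0 \<in> t" "1 \<in> t" "2 \<in> t" using *[of 0] *[of 1] *[of 2] by (simp_all add: ind_def split: if_splits)
    then show False using 2(1) unfolding K4_eq by (elim insertE emptyE) simp_all
  qed
qed

lemma K4_iso:
  assumes N: "simple_rep N \<phi> U"
    and S: "x \<in> elems N \<phi> U" "y \<in> elems N \<phi> U" "w \<in> elems N \<phi> U" "x + y + w \<in> elems N \<phi> U"
      "x + y \<in> elems N \<phi> U" "x + w \<in> elems N \<phi> U" "y + w \<notin> elems N \<phi> U"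
    and nU: "x \<notin> U" "y \<notin> U" "w \<notin> U" "x + y \<notin> U" "x + w \<notin> U" "x + y + w \<notin> U"
  shows "\<exists>N0. induced_restriction N N0 \<and> matroid_iso N0 (cycle_matroid K4)"
proof -
  let ?S = "elems N \<phi> U"
  have subU: "subsp U" using N by (simp add: simple_rep_def rep_def)
  have yw: "y + w \<notin> U" using S(7) elems_U by blast
  \<comment> \<open>Potentials at the vertices, normalised to 0 at vertex 0; the edges then carry
    the six vectors that are present, and \<open>y + w\<close> is the one missing from the Fano
    plane.\<close>
  define c where "c j = (if j = 1 then x else if j = 2 then x + y else if j = 3 then w else 0)" for j :: nat
  define \<psi> where "\<psi> = sum c"
  have \<psi>_vals: "\<psi> {0, 1} = x" "\<psi> {0, 2} = x + y" "\<psi> {0, 3} = w" "\<psi> {1, 2} = y" "\<psi> {1, 3} = x + w" "\<psi> {2, 3} = x + y + w"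
    by (simp_all add: \<psi>_def c_def ac_simps)
  let ?W = "sp {x, y, w} + U"
  have memW: "v \<in> ?W \<longleftrightarrow> v \<in> U \<or> v + x \<in> U \<or> v + y \<in> U \<or> v + w \<in> U \<or> v + (x + y) \<in> U \<or> v + (x + w) \<in> U
     \<or> v + (y + w) \<in> U \<or> v + (x + y + w) \<in> U" for v
    by (simp only: sp_insert sp_empty add.assoc mem_pair_plus zero_plus_set) (auto simp: ac_simps)
  show ?thesis
  proof (rule induced_restriction_iso[OF N cycles_cycle_matroid[OF simple_K4], of ?W \<psi>])
    show "subsp ?W" by (intro subsp_plus subsp_sp subU)
    show "U \<subseteq> ?W" using memW by blast
    show "\<psi> e \<in> ?S \<inter> ?W" if "e \<in> ground (cycle_matroid K4)" for e
    proof -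
      have "\<psi> e \<in> {x, x + y, w, y, x + w, x + y + w}"
        using that unfolding ground_cycle_matroid K4_eq by (elim insertE emptyE) (simp_all add: \<psi>_vals)
      moreover have "v \<in> ?W" if "v \<in> {x, x + y, w, y, x + w, x + y + w}" for v
        using that subsp_0[OF subU] unfolding memW by (elim insertE emptyE) simp_all
      moreover have "{x, x + y, w, y, x + w, x + y + w} \<subseteq> ?S" using S by simp
      ultimately show ?thesis by blast
    qed
    show "s \<in> U \<or> (\<exists>e\<in>ground (cycle_matroid K4). s + \<psi> e \<in> U)" if s: "s \<in> ?S \<inter> ?W" for s
    proof -
      have "s + (y + w) \<notin> U" using s S(7) elems_shift'[OF subU, of s "y + w" N \<phi>] by blast
      moreover have "(\<exists>e\<in>ground (cycle_matroid K4). s + \<psi> e \<in> U) \<longleftrightarrow> s + x \<in> U \<or> s + (x + y) \<in> U \<or>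
          s + w \<in> U \<or> s + y \<in> U \<or> s + (x + w) \<in> U \<or> s + (x + y + w) \<in> U"
        unfolding ground_cycle_matroid K4_eq by (simp only: bex_simps \<psi>_vals simp_thms)
      ultimately show ?thesis using s unfolding Int_iff memW by argo
    qed
    show "sum \<psi> D \<in> U \<longleftrightarrow> D \<in> {D. D \<subseteq> K4 \<and> sum ind D = 0}" if D: "D \<subseteq> ground (cycle_matroid K4)" for D
    proof -
      have DK: "D \<subseteq> K4" using D by simp
      have finD: "finite D" using DK simple_K4 finite_subset by (auto simp: simple_graph_def)
      have sub: "e \<subseteq> {0, 1, 2, 3}" if "e \<in> D" for e
        using subsetD[OF DK that] unfolding K4_eq by (elim insertE emptyE) simp_all
      define h where "h = sum ind D"
      have L: "sum \<psi> D = (if h 1 = 1 then x else 0) + (if h 2 = 1 then x + y else 0) + (if h 3 = 1 then w else 0)"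
        using sum_potential[of "{0, 1, 2, 3}" D c] finD sub unfolding \<psi>_def h_def[symmetric]
        by (simp add: c_def cong: if_cong)
      \<comment> \<open>Every edge has two ends, so the coordinate at vertex 0, which the potentials
        do not see, is determined by the other three.\<close>
      have "sum (ind e) {0, 1, 2, 3} = 0" if "e \<in> D" for e
        using subsetD[OF DK that] unfolding K4_eq by (elim insertE emptyE) (simp_all add: ind_def)
      then have "sum h {0, 1, 2, 3} = 0" unfolding h_def sum_fun_apply by (subst sum.swap) simp
      then have h0: "h 1 = 0 \<Longrightarrow> h 2 = 0 \<Longrightarrow> h 3 = 0 \<Longrightarrow> h 0 = 0" by simp
      have h4: "h j = 0" if "j \<notin> {0, 1, 2, 3}" for j
        unfolding h_def sum_fun_apply using sub that by (intro sum.neutral) (auto simp: ind_def)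
      have "sum \<psi> D \<in> U \<longleftrightarrow> h 1 = 0 \<and> h 2 = 0 \<and> h 3 = 0"
        unfolding L using nU yw subsp_0[OF subU]
        by (cases "h 1"; cases "h 2"; cases "h 3") (simp_all add: ac_simps)
      also have "\<dots> \<longleftrightarrow> h = 0"
      proof
        assume "h 1 = 0 \<and> h 2 = 0 \<and> h 3 = 0"
        then have "h j = 0" for j using h0 h4[of j] by (cases "j \<in> {0, 1, 2, 3}") auto
        then show "h = 0" by (simp add: fun_eq_iff)
      qed simp
      finally show ?thesis using DK by (simp add: h_def)
    qed
    show "{e} \<notin> {D. D \<subseteq> K4 \<and> sum ind D = 0}" for e
    proof
      assume "{e} \<in> {D. D \<subseteq> K4 \<and> sum ind D = 0}"
      then have "e \<in> K4" "ind e = 0" by auto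
      then have "ind e j = 0" for j by simp
      then have "e = {}" unfolding ind_def by (metis equals0I zero_neq_one)
      then show False using \<open>e \<in> K4\<close> by (auto simp: K4_eq)
    qed
    show "{e, e'} \<notin> {D. D \<subseteq> K4 \<and> sum ind D = 0}" if ne: "e \<noteq> e'" for e e'
    proof
      assume "{e, e'} \<in> {D. D \<subseteq> K4 \<and> sum ind D = 0}"
      then have "ind e + ind e' = 0" using ne by simp
      then have "ind e = ind e'" by (simp only: add_eq_0_iff_eq)
      then have "ind e j = ind e' j" for j by simp
      then have "e = e'" unfolding ind_def by (metis set_eqI zero_neq_one)
      then show False using ne by blast
    qed
  qed
qed

lemma not_odd_diag_iso:
  assumes N: "simple_rep N \<phi> U" and odd: "\<not> odd_diag (elems N \<phi> U)"
  shows "\<exists>N0. induced_restriction N N0 \<and>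
    (matroid_iso N0 (cycle_matroid (cycle_graph 4)) \<or> matroid_iso N0 (cycle_matroid K4))"
proof -
  let ?S = "elems N \<phi> U"
  have subU: "subsp U" using N by (simp add: simple_rep_def rep_def)
  obtain x y w where S: "x \<in> ?S" "y \<in> ?S" "w \<in> ?S" "x + y + w \<in> ?S"
    and ne: "\<not> (x + y \<in> ?S \<longleftrightarrow> (x + w \<in> ?S \<longleftrightarrow> y + w \<in> ?S))"
    using odd unfolding odd_diag_def by blast
  note shift = elems_shift'[OF subU, where N = N and \<phi> = \<phi>]
  \<comment> \<open>A circuit vector in \<open>U\<close> would force all three diagonals, and a
    diagonal in \<open>U\<close> would make the other two congruent; the number of diagonals would
    be odd either way.\<close>
  have nU: "x \<notin> U" "y \<notin> U" "w \<notin> U" "x + y + w \<notin> U" "x + y \<notin> U" "x + w \<notin> U" "y + w \<notin> U"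
  proof -
    show "x \<notin> U" using shift[of "x + y" y] shift[of "x + w" w] shift[of "x + y + w" "y + w"] S ne by (auto simp: ac_simps)
    show "y \<notin> U" using shift[of "x + y" x] shift[of "y + w" w] shift[of "x + y + w" "x + w"] S ne by (auto simp: ac_simps)
    show "w \<notin> U" using shift[of "x + w" x] shift[of "y + w" y] shift[of "x + y + w" "x + y"] S ne by (auto simp: ac_simps)
    show "x + y + w \<notin> U" using shift[of "x + y" w] shift[of "x + w" y] shift[of "y + w" x] S ne by (auto simp: ac_simps)
    show "x + y \<notin> U" using elems_U[of U N \<phi>] shift[of "x + w" "y + w"] ne by (auto simp: ac_simps)
    show "x + w \<notin> U" using elems_U[of U N \<phi>] shift[of "x + y" "y + w"] ne by (auto simp: ac_simps)
    show "y + w \<notin> U" using elems_U[of U N \<phi>] shift[of "x + y" "x + w"] ne by (auto simp: ac_simps)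
  qed
  consider "x + y \<notin> ?S" "x + w \<notin> ?S" "y + w \<notin> ?S" | "x + y \<in> ?S" "x + w \<in> ?S" "y + w \<notin> ?S"
    | "x + y \<in> ?S" "y + w \<in> ?S" "x + w \<notin> ?S" | "x + w \<in> ?S" "y + w \<in> ?S" "x + y \<notin> ?S"
    using ne by blast
  then show ?thesis
  proof cases
    case 1
    have 0: "0 \<in> U" by (rule subsp_0[OF subU])
    define v where "v = x + y + w"
    have v: "x + v = y + w" "y + v = x + w" "w + v = x + y" by (simp_all add: v_def ac_simps)
    have pairs: "x + y \<notin> ?S" "x + w \<notin> ?S" "y + w \<notin> ?S" "x + v \<notin> ?S" "y + v \<notin> ?S" "w + v \<notin> ?S"
      unfolding v using 1 by auto
    then have dist: "x \<noteq> y" "x \<noteq> w" "y \<noteq> w" "x \<noteq> v" "y \<noteq> v" "w \<noteq> v" using 0 elems_U[of U N \<phi>] by auto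
    let ?C = "{x, y, w, v}"
    have card4: "card ?C = 4" using dist by simp
    have two: "\<Sum>D \<notin> ?S" if "D \<subseteq> ?C" "card D = 2" for D
    proof -
      obtain p q where pq: "D = {p, q}" "p \<noteq> q" using \<open>card D = 2\<close> by (auto simp: card_2_iff)
      then have "p \<in> ?C" "q \<in> ?C" using \<open>D \<subseteq> ?C\<close> by blast+
      then have "p + q \<notin> ?S" using pq(2) pairs by (elim insertE emptyE; simp add: add.commute)
      then show ?thesis using pq by simp
    qed
    have "chordless ?S U ?C"
      unfolding chordless_def
    proof (intro conjI allI impI)
      show "?C \<subseteq> ?S - U" using S nU by (simp add: v_def)
      have "\<Sum>?C = x + (y + (w + v))" using dist by simp
      then show "\<Sum>?C \<in> U" using 0 by (simp add: v_def ac_simps)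
      fix D assume D: "D \<subseteq> ?C" "\<Sum>D \<in> ?S"
      have "card D \<noteq> 2" using two D by blast
      moreover have "card (?C - D) = 4 - card D" using D card4 by (simp add: card_Diff_subset finite_subset)
      ultimately show "card D \<le> 1 \<or> card (?C - D) \<le> 1" by linarith
    qed (use card4 in auto)
    then show ?thesis using chordless_iso[OF N] card4 by metis
  next
    case 2
    then show ?thesis using K4_iso[OF N, of x y w] S nU by blast
  next
    case 3
    then show ?thesis using K4_iso[OF N, of y x w] S nU by (auto simp: ac_simps)
  next
    case 4
    then show ?thesis using K4_iso[OF N, of w x y] S nU by (auto simp: ac_simps)
  qed
qed

subsection \<open>The complete bipartite graph on three and three vertices\<close>

lemma K33_eq: "K33 = {{0, 3}, {0, 4}, {0, 5}, {1, 3}, {1, 4}, {1, 5}, {2, 3}, {2, 4}, {2, 5}}"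
proof -
  have three: "u < 3 \<longleftrightarrow> u = 0 \<or> u = 1 \<or> u = 2" "3 \<le> v \<and> v < 6 \<longleftrightarrow> v = 3 \<or> v = 4 \<or> v = 5" for u v :: nat
    by linarith+
  show ?thesis
  proof (rule subset_antisym; rule subsetI)
    fix e assume "e \<in> K33"
    then obtain u v where e: "e = {u, v}" and u: "u < 3" and v: "3 \<le> v \<and> v < 6" unfolding K33_def by blast
    show "e \<in> {{0, 3}, {0, 4}, {0, 5}, {1, 3}, {1, 4}, {1, 5}, {2, 3}, {2, 4}, {2, 5}}"
      using u[unfolded three] v[unfolded three] unfolding e by (elim disjE) simp_all
  next
    fix e assume e: "e \<in> {{0, 3}, {0, 4}, {0, 5}, {1, 3}, {1, 4}, {1, 5}, {2, 3}, {2, 4}, {2, 5} :: nat set}"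
    have K: "{u, v} \<in> K33" if "u < 3" "3 \<le> v" "v < 6" for u v using that unfolding K33_def by blast
    show "e \<in> K33" using e by (elim insertE emptyE; hypsubst) (simp_all add: K)
  qed
qed

lemma K33_cases:
  assumes "e \<in> K33"
    and "P {0, 3}" "P {0, 4}" "P {0, 5}" "P {1, 3}" "P {1, 4}" "P {1, 5}" "P {2, 3}" "P {2, 4}" "P {2, 5}"
  shows "P e"
  using assms unfolding K33_eq by (elim insertE emptyE) simp_all

lemma K33_edges:
  "{0, 3} \<in> K33" "{0, 4} \<in> K33" "{0, 5} \<in> K33" "{1, 3} \<in> K33" "{1, 4} \<in> K33" "{1, 5} \<in> K33"
  "{2, 3} \<in> K33" "{2, 4} \<in> K33" "{2, 5} \<in> K33"
  unfolding K33_eq by simp_all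

lemma simple_K33: "simple_graph K33"
  unfolding simple_graph_def
proof
  show "finite K33" unfolding K33_eq by simp
  show "\<forall>e\<in>K33. card e = 2"
  proof
    fix e assume "e \<in> K33"
    then show "card e = 2" by (rule K33_cases) simp_all
  qed
qed

text \<open>A cut meets every 4-cycle of the graph in an even number of edges, and the four 4-cycles
  through the edge \<open>{2, 5}\<close> generate the cycle space.\<close>

lemma cut_K33_iff:
  assumes D: "D \<subseteq> K33"
  shows "D \<in> range (cut K33) \<longleftrightarrow>
    (({0, 3} \<in> D) \<noteq> ({0, 5} \<in> D)) = (({2, 3} \<in> D) \<noteq> ({2, 5} \<in> D)) \<and>
    (({0, 4} \<in> D) \<noteq> ({0, 5} \<in> D)) = (({2, 4} \<in> D) \<noteq> ({2, 5} \<in> D)) \<and>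
    (({1, 3} \<in> D) \<noteq> ({1, 5} \<in> D)) = (({2, 3} \<in> D) \<noteq> ({2, 5} \<in> D)) \<and>
    (({1, 4} \<in> D) \<noteq> ({1, 5} \<in> D)) = (({2, 4} \<in> D) \<noteq> ({2, 5} \<in> D))"
    (is "_ \<longleftrightarrow> ?par")
proof
  have one: "x + y = 1 \<longleftrightarrow> (x = 1) \<noteq> (y = 1)" for x y :: bit by (cases x; cases y) simp_all
  have cut: "{i, j} \<in> cut K33 h \<longleftrightarrow> (h i = 1) \<noteq> (h j = 1)" if "{i, j} \<in> K33" "i \<noteq> j" for i j and h :: "nat \<Rightarrow> bit"
  proof -
    have "sum h {i, j} = h i + h j" using that(2) by simp
    then show ?thesis using that(1) one[of "h i" "h j"] by (simp only: cut_def mem_Collect_eq simp_thms)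
  qed
  show "?par" if range: "D \<in> range (cut K33)"
  proof -
    obtain h where "D = cut K33 h" using range by blast
    then show ?thesis using cut[where h = h, OF K33_edges(1)] cut[where h = h, OF K33_edges(2)] cut[where h = h, OF K33_edges(3)]
      cut[where h = h, OF K33_edges(4)] cut[where h = h, OF K33_edges(5)] cut[where h = h, OF K33_edges(6)]
      cut[where h = h, OF K33_edges(7)] cut[where h = h, OF K33_edges(8)] cut[where h = h, OF K33_edges(9)] by simp argo
  qed
  assume par: ?par
  define h :: "nat \<Rightarrow> bit" where "h j = of_bool (if j = 0 then ({0, 5} \<in> D) \<noteq> ({2, 5} \<in> D)
    else if j = 1 then ({1, 5} \<in> D) \<noteq> ({2, 5} \<in> D) else if j = 2 then False else {2, j} \<in> D)" for j
  have h1: "h j = 1 \<longleftrightarrow> (if j = 0 then ({0, 5} \<in> D) \<noteq> ({2, 5} \<in> D)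
    else if j = 1 then ({1, 5} \<in> D) \<noteq> ({2, 5} \<in> D) else if j = 2 then False else {2, j} \<in> D)" for j
    unfolding h_def of_bool_eq_1_iff ..
  have "e \<in> D \<longleftrightarrow> e \<in> cut K33 h" if e: "e \<in> K33" for e
    using e
  proof (rule K33_cases)
    show "{0, 3} \<in> D \<longleftrightarrow> {0, 3} \<in> cut K33 h" using cut[OF K33_edges(1), of h] h1[of 0] h1[of 3] par by simp argo
    show "{0, 4} \<in> D \<longleftrightarrow> {0, 4} \<in> cut K33 h" using cut[OF K33_edges(2), of h] h1[of 0] h1[of 4] par by simp argo
    show "{0, 5} \<in> D \<longleftrightarrow> {0, 5} \<in> cut K33 h" using cut[OF K33_edges(3), of h] h1[of 0] h1[of 5] par by simp argo
    show "{1, 3} \<in> D \<longleftrightarrow> {1, 3} \<in> cut K33 h" using cut[OF K33_edges(4), of h] h1[of 1] h1[of 3] par by simp argo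
    show "{1, 4} \<in> D \<longleftrightarrow> {1, 4} \<in> cut K33 h" using cut[OF K33_edges(5), of h] h1[of 1] h1[of 4] par by simp argo
    show "{1, 5} \<in> D \<longleftrightarrow> {1, 5} \<in> cut K33 h" using cut[OF K33_edges(6), of h] h1[of 1] h1[of 5] par by simp argo
    show "{2, 3} \<in> D \<longleftrightarrow> {2, 3} \<in> cut K33 h" using cut[OF K33_edges(7), of h] h1[of 2] h1[of 3] by simp
    show "{2, 4} \<in> D \<longleftrightarrow> {2, 4} \<in> cut K33 h" using cut[OF K33_edges(8), of h] h1[of 2] h1[of 4] by simp
    show "{2, 5} \<in> D \<longleftrightarrow> {2, 5} \<in> cut K33 h" using cut[OF K33_edges(9), of h] h1[of 2] h1[of 5] by simp
  qed
  moreover have "cut K33 h \<subseteq> K33" by (auto simp: cut_def)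
  ultimately have "D = cut K33 h" using D by blast
  then show "D \<in> range (cut K33)" by blast
qed

lemma cycles_dual_K33: "cycles (dual (cycle_matroid K33)) (range (cut K33))"
  by (rule cycles_dual_cycle_matroid[OF simple_K33])

lemma ground_dual_K33: "ground (dual (cycle_matroid K33)) = K33"
  by simp

text \<open>Contract the middle entry \<open>{1, 4}\<close> of the array. The four corners become a
  4-circuit with diagonals \<open>{0, 4}\<close> and \<open>{1, 3}\<close>, and the third diagonal
  is missing.\<close>

lemma chordal_no_K33:
  assumes N: "rep N \<phi> U" and ch: "chordal (elems N \<phi> U)"
  shows "\<not> matroid_iso N (dual (cycle_matroid K33))"
proof
  let ?S = "elems N \<phi> U"
  assume iso: "matroid_iso N (dual (cycle_matroid K33))"
  obtain \<psi> where \<psi>: "\<And>D. D \<subseteq> ground (dual (cycle_matroid K33)) \<Longrightarrow> sum \<psi> D \<in> U \<longleftrightarrow> D \<in> range (cut K33)"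
    "\<And>v. v \<in> ?S \<longleftrightarrow> v \<in> U \<or> (\<exists>e\<in>ground (dual (cycle_matroid K33)). v + \<psi> e \<in> U)"
    by (rule iso_transfer[OF iso N cycles_dual_K33]) (rule that)
  note sums = \<psi>(1)[unfolded ground_dual_K33] and S = \<psi>(2)[unfolded ground_dual_K33]
  have subU: "subsp U" by (rule repD(2)[OF N])
  have \<psi>S: "\<psi> e \<in> ?S" if "e \<in> K33" for e
    unfolding S using that subsp_0[OF subU] by (metis add_self)
  have tri: "\<psi> e1 + \<psi> e2 + \<psi> e3 \<in> U"
    if "{e1, e2, e3} \<subseteq> K33" "e1 \<noteq> e2" "e1 \<noteq> e3" "e2 \<noteq> e3" "{e1, e2, e3} \<in> range (cut K33)" for e1 e2 e3
  proof -
    have "sum \<psi> {e1, e2, e3} = \<psi> e1 + \<psi> e2 + \<psi> e3" using that(2-4) by (simp add: ac_simps)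
    then show ?thesis using sums[OF that(1)] that(5) by simp
  qed
  have row0: "\<psi> {0, 3} + \<psi> {0, 4} + \<psi> {0, 5} \<in> U"
    by (rule tri; (subst cut_K33_iff)?) (simp_all add: K33_edges doubleton_eq_iff)
  have row2: "\<psi> {2, 3} + \<psi> {2, 4} + \<psi> {2, 5} \<in> U"
    by (rule tri; (subst cut_K33_iff)?) (simp_all add: K33_edges doubleton_eq_iff)
  have col0: "\<psi> {0, 3} + \<psi> {1, 3} + \<psi> {2, 3} \<in> U"
    by (rule tri; (subst cut_K33_iff)?) (simp_all add: K33_edges doubleton_eq_iff)
  have col1: "\<psi> {0, 4} + \<psi> {1, 4} + \<psi> {2, 4} \<in> U"
    by (rule tri; (subst cut_K33_iff)?) (simp_all add: K33_edges doubleton_eq_iff)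
  let ?x = "\<psi> {0, 3}" and ?y = "\<psi> {0, 5}" and ?w = "\<psi> {2, 3}" and ?q = "\<psi> {1, 4}"
  let ?T = "?S + {0, ?q}"
  have "chordal ?T" using ch \<psi>S K33_edges(5) by (intro chordal_contract) auto
  then have odd: "odd_diag ?T" by (rule chordal_odd_diag)
  have "?x + ?y + \<psi> {0, 4} \<in> U" "?x + ?w + \<psi> {1, 3} \<in> U" using row0 col0 by (simp_all add: ac_simps)
  then have xy: "?x + ?y \<in> ?S" and xw: "?x + ?w \<in> ?S" using K33_edges unfolding S by blast+
  have "(\<psi> {0, 3} + \<psi> {0, 4} + \<psi> {0, 5}) + (\<psi> {0, 4} + \<psi> {1, 4} + \<psi> {2, 4}) + (\<psi> {2, 3} + \<psi> {2, 4} + \<psi> {2, 5}) \<in> U"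
    using row0 row2 col1 subsp_add[OF subU] by blast
  then have "(?x + ?y + ?w + ?q) + \<psi> {2, 5} \<in> U" by (simp add: ac_simps)
  then have "?x + ?y + ?w + ?q \<in> ?S" using K33_edges unfolding S by blast
  then have "?y + ?w \<in> ?T"
    using odd_diagD[OF odd, of ?x ?y ?w] xy xw \<psi>S K33_edges by (simp add: mem_plus_pair)
  then obtain A where A: "A = {{0, 5}, {2, 3}} \<or> A = {{0, 5}, {2, 3}, {1, 4}}" "sum \<psi> A \<in> ?S"
  proof -
    have "sum \<psi> {{0, 5}, {2, 3}} = ?y + ?w" "sum \<psi> {{0, 5}, {2, 3}, {1, 4}} = ?y + ?w + ?q"
      by (simp_all add: doubleton_eq_iff ac_simps)
    then show ?thesis using that \<open>?y + ?w \<in> ?T\<close> unfolding mem_plus_pair by metis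
  qed
  have AK: "A \<subseteq> K33" "finite A" using A(1) K33_edges by (elim disjE; simp)+
  \<comment> \<open>The two candidates for \<open>A\<close> differ only in the entry
    \<open>{1, 4}\<close>, so the contradiction is drawn from the other eight.\<close>
  have A_mem: "{0, 5} \<in> A" "{2, 3} \<in> A" "{0, 3} \<notin> A" "{2, 5} \<notin> A" "{0, 4} \<notin> A" "{2, 4} \<notin> A" "{1, 3} \<notin> A" "{1, 5} \<notin> A"
    using A(1) by (elim disjE; simp add: doubleton_eq_iff)+
  consider "sum \<psi> A \<in> U" | t where "t \<in> K33" "sum \<psi> A + \<psi> t \<in> U" using A(2) unfolding S by blast
  then show False
  proof cases
    case 1
    then have "A \<in> range (cut K33)" using sums[OF AK(1)] by simp
    then show False unfolding cut_K33_iff[OF AK(1)] using A_mem by simp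
  next
    case 2
    let ?B = "symdiff A {t}"
    have BK: "?B \<subseteq> K33" using AK(1) 2(1) by blast
    have "sum \<psi> ?B = sum \<psi> A + \<psi> t" using sum_symdiff[of A "{t}" \<psi>] AK(2) by simp
    then have B: "?B \<in> range (cut K33)" using sums[OF BK] 2(2) by simp
    have mem: "e \<in> ?B \<longleftrightarrow> (e \<in> A) \<noteq> (e = t)" for e
      unfolding Un_iff Diff_iff singleton_iff by argo
    note par = B[unfolded cut_K33_iff[OF BK] mem]
    have "t = {0, 3} \<or> t = {0, 4} \<or> t = {0, 5} \<or> t = {1, 3} \<or> t = {1, 4} \<or> t = {1, 5} \<or> t = {2, 3} \<or> t = {2, 4} \<or> t = {2, 5}"
      using 2(1) by (simp only: K33_eq insert_iff empty_iff simp_thms)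
    then show False using par A_mem by (elim disjE) (simp_all add: doubleton_eq_iff)
  qed
qed

lemma grid_iso:
  fixes \<phi> :: "'a \<Rightarrow> 'v::xor_group"
  assumes N: "simple_rep N \<phi> U" and grid: "grid (elems N \<phi> U) U a b c d"
  shows "\<exists>N0. induced_restriction N N0 \<and> matroid_iso N0 (dual (cycle_matroid K33))"
proof -
  let ?S = "elems N \<phi> U"
  have subU: "subsp U" using N by (simp add: simple_rep_def rep_def)
  have nine: "a \<in> ?S - U" "b \<in> ?S - U" "a + b \<in> ?S - U" "c \<in> ?S - U" "d \<in> ?S - U" "c + d \<in> ?S - U"
      "a + c \<in> ?S - U" "b + d \<in> ?S - U" "a + b + c + d \<in> ?S - U"
    and six: "a + d \<notin> ?S" "b + c \<notin> ?S" "a + b + c \<notin> ?S" "a + b + d \<notin> ?S" "a + c + d \<notin> ?S" "b + c + d \<notin> ?S"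
    using grid by (auto simp: grid_def)
  have nU: "a \<notin> U" "b \<notin> U" "a + b \<notin> U" "c \<notin> U" "d \<notin> U" "c + d \<notin> U" "a + c \<notin> U" "b + d \<notin> U" "a + b + c + d \<notin> U"
    "a + d \<notin> U" "b + c \<notin> U" "a + b + c \<notin> U" "a + b + d \<notin> U" "a + c + d \<notin> U" "b + c + d \<notin> U"
    using nine six elems_U[of U N \<phi>] by blast+
  \<comment> \<open>The edge from \<open>u\<close> to \<open>v\<close> sits in row \<open>u\<close>
    and column \<open>v - 3\<close> of the array.\<close>
  define \<psi> where "\<psi> e = (if e = {0, 3} then a else if e = {0, 4} then b else if e = {0, 5} then a + b
    else if e = {1, 3} then c else if e = {1, 4} then d else if e = {1, 5} then c + d
    else if e = {2, 3} then a + c else if e = {2, 4} then b + d else a + b + c + d)" for e :: "nat set"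
  have \<psi>_vals: "\<psi> {0, 3} = a" "\<psi> {0, 4} = b" "\<psi> {0, 5} = a + b" "\<psi> {1, 3} = c" "\<psi> {1, 4} = d" "\<psi> {1, 5} = c + d"
    "\<psi> {2, 3} = a + c" "\<psi> {2, 4} = b + d" "\<psi> {2, 5} = a + b + c + d"
    by (simp_all add: \<psi>_def doubleton_eq_iff)
  let ?W = "sp {a, b, c, d} + U"
  have memW: "v \<in> ?W \<longleftrightarrow> v \<in> U \<or> v + a \<in> U \<or> v + b \<in> U \<or> v + (a + b) \<in> U \<or> v + c \<in> U \<or> v + d \<in> U \<or> v + (c + d) \<in> U
     \<or> v + (a + c) \<in> U \<or> v + (b + d) \<in> U \<or> v + (a + b + c + d) \<in> U \<or> v + (a + d) \<in> U \<or> v + (b + c) \<in> U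
     \<or> v + (a + b + c) \<in> U \<or> v + (a + b + d) \<in> U \<or> v + (a + c + d) \<in> U \<or> v + (b + c + d) \<in> U" for v
    by (simp only: sp_insert sp_empty add.assoc mem_pair_plus zero_plus_set)
      (simp only: ac_simps; rule iffI; elim disjE; simp)
  have zero: "sum \<psi> D \<in> U \<longleftrightarrow> D \<in> range (cut K33)" if D: "D \<subseteq> K33" for D
  proof -
    \<comment> \<open>\<open>i p x\<close> is a scalar multiple with a truth value as scalar.
      Collecting coefficients yields exactly the four parities of
      \<open>cut_K33_iff\<close>.\<close>
    define i where "i p x = (if p then x else 0)" for p and x :: 'v
    have i_add: "i p (x + y) = i p x + i p y" "i p x + i q x = i (p \<noteq> q) x" "i p x + (i q x + y) = i (p \<noteq> q) x + y" for p q x y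
      by (auto simp: i_def ac_simps)
    have fin: "finite K33" using simple_K33 by (simp add: simple_graph_def)
    have "sum \<psi> D = (\<Sum>e\<in>K33. i (e \<in> D) (\<psi> e))"
      using sum.inter_restrict[OF fin, of \<psi> D] D by (simp add: i_def Int_absorb1)
    also have "\<dots> = i ({0, 3} \<in> D) a + (i ({0, 4} \<in> D) b + (i ({0, 5} \<in> D) (a + b) + (i ({1, 3} \<in> D) c + (i ({1, 4} \<in> D) d
       + (i ({1, 5} \<in> D) (c + d) + (i ({2, 3} \<in> D) (a + c) + (i ({2, 4} \<in> D) (b + d) + i ({2, 5} \<in> D) (a + b + c + d))))))))"
      unfolding K33_eq by (simp add: \<psi>_vals doubleton_eq_iff)
    also have "\<dots> = i ((({0, 3} \<in> D) \<noteq> ({0, 5} \<in> D)) \<noteq> (({2, 3} \<in> D) \<noteq> ({2, 5} \<in> D))) a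
        + (i ((({0, 4} \<in> D) \<noteq> ({0, 5} \<in> D)) \<noteq> (({2, 4} \<in> D) \<noteq> ({2, 5} \<in> D))) b
        + (i ((({1, 3} \<in> D) \<noteq> ({1, 5} \<in> D)) \<noteq> (({2, 3} \<in> D) \<noteq> ({2, 5} \<in> D))) c
        + i ((({1, 4} \<in> D) \<noteq> ({1, 5} \<in> D)) \<noteq> (({2, 4} \<in> D) \<noteq> ({2, 5} \<in> D))) d))"
      unfolding i_add(2)[symmetric] by (simp only: i_add(1) ac_simps)
    finally have sum: "sum \<psi> D = \<dots>" .
    have ind: "i p a + (i q b + (i r c + i s d)) \<in> U \<longleftrightarrow> \<not> p \<and> \<not> q \<and> \<not> r \<and> \<not> s" for p q r s
      using nU subsp_0[OF subU] by (cases p; cases q; cases r; cases s) (simp_all add: i_def ac_simps)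
    show ?thesis unfolding sum ind cut_K33_iff[OF D] by simp
  qed
  show ?thesis
  proof (rule induced_restriction_iso[OF N cycles_dual_K33, of ?W \<psi>, unfolded ground_dual_K33])
    show "subsp ?W" by (intro subsp_plus subsp_sp subU)
    show "U \<subseteq> ?W" using memW by blast
    show "\<psi> e \<in> ?S \<inter> ?W" if "e \<in> K33" for e
      using that
      by (rule K33_cases) (use nine subsp_0[OF subU] in \<open>simp_all add: \<psi>_vals memW\<close>)
    show "s \<in> U \<or> (\<exists>e\<in>K33. s + \<psi> e \<in> U)" if s: "s \<in> ?S \<inter> ?W" for s
    proof -
      have "s + (a + d) \<notin> U" "s + (b + c) \<notin> U" "s + (a + b + c) \<notin> U" "s + (a + b + d) \<notin> U" "s + (a + c + d) \<notin> U" "s + (b + c + d) \<notin> U"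
        using s six elems_shift'[OF subU, of s _ N \<phi>] by blast+
      moreover have "(\<exists>e\<in>K33. s + \<psi> e \<in> U) \<longleftrightarrow> s + a \<in> U \<or> s + b \<in> U \<or> s + (a + b) \<in> U \<or> s + c \<in> U \<or> s + d \<in> U
          \<or> s + (c + d) \<in> U \<or> s + (a + c) \<in> U \<or> s + (b + d) \<in> U \<or> s + (a + b + c + d) \<in> U"
        unfolding K33_eq by (simp only: bex_simps \<psi>_vals simp_thms)
      ultimately show ?thesis using s unfolding Int_iff memW by argo
    qed
    show "sum \<psi> D \<in> U \<longleftrightarrow> D \<in> range (cut K33)" if "D \<subseteq> K33" for D by (rule zero[OF that])
    show "{e} \<notin> range (cut K33)" for e
    proof
      assume *: "{e} \<in> range (cut K33)"
      then have e: "{e} \<subseteq> K33" by (auto simp: cut_def)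
      have "\<psi> e \<notin> U" using e[simplified] by (rule K33_cases) (use nU in \<open>simp_all add: \<psi>_vals\<close>)
      then show False using zero[OF e] * by simp
    qed
    show "{e, e'} \<notin> range (cut K33)" if ne: "e \<noteq> e'" for e e'
    proof
      assume *: "{e, e'} \<in> range (cut K33)"
      then have e: "{e, e'} \<subseteq> K33" by (auto simp: cut_def)
      have "e = {0, 3} \<or> e = {0, 4} \<or> e = {0, 5} \<or> e = {1, 3} \<or> e = {1, 4} \<or> e = {1, 5} \<or> e = {2, 3} \<or> e = {2, 4} \<or> e = {2, 5}"
        "e' = {0, 3} \<or> e' = {0, 4} \<or> e' = {0, 5} \<or> e' = {1, 3} \<or> e' = {1, 4} \<or> e' = {1, 5} \<or> e' = {2, 3} \<or> e' = {2, 4} \<or> e' = {2, 5}"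
        using e by (simp_all only: K33_eq insert_subset insert_iff empty_iff simp_thms)
      then show False
        using ne *[unfolded cut_K33_iff[OF e]] by (elim disjE) (simp_all add: doubleton_eq_iff)
    qed
  qed
qed

subsection \<open>Flats determine a matroid\<close>

context matroid
begin

lemma finite_indep: "finite {I \<in> indep M. I \<subseteq> X}"
  using finite_ground indep_subset by (auto intro: finite_subset[of _ "Pow (ground M)"])

lemma card_le_rank: "I \<in> indep M \<Longrightarrow> I \<subseteq> X \<Longrightarrow> card I \<le> rank M X"
  unfolding rank_def by (intro Max_ge finite_imageI finite_indep) auto

lemma rank_attained: "\<exists>I\<in>indep M. I \<subseteq> X \<and> card I = rank M X"
proof -
  have "rank M X \<in> card ` {I \<in> indep M. I \<subseteq> X}"
    unfolding rank_def using indep_empty by (intro Max_in finite_imageI finite_indep) auto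
  then show ?thesis by auto
qed

lemma rank_mono: "X \<subseteq> Y \<Longrightarrow> rank M X \<le> rank M Y"
  using rank_attained[of X] card_le_rank[of _ Y] by (metis subset_trans)

lemma extend_indep:
  assumes "I \<in> indep M" "I \<subseteq> Y"
  shows "\<exists>J\<in>indep M. I \<subseteq> J \<and> J \<subseteq> Y \<and> card J = rank M Y"
  using assms
proof (induction "rank M Y - card I" arbitrary: I rule: less_induct)
  case less
  show ?case
  proof (cases "card I = rank M Y")
    case False
    then have lt: "card I < rank M Y" using card_le_rank[OF less.prems] by simp
    obtain K where K: "K \<in> indep M" "K \<subseteq> Y" "card K = rank M Y" using rank_attained by blast
    then obtain y where y: "y \<in> K - I" "insert y I \<in> indep M"
      using indep_augment[OF less.prems(1) K(1)] lt by auto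
    have "finite I" using indep_subset[OF less.prems(1)] finite_ground finite_subset by blast
    then have "card (insert y I) = Suc (card I)" using y by simp
    then have "rank M Y - card (insert y I) < rank M Y - card I" using lt by simp
    moreover have "insert y I \<subseteq> Y" using y K less.prems by blast
    ultimately show ?thesis using less.hyps[of "insert y I"] y(2) by blast
  qed (use less.prems in blast)
qed

lemma finite_indepD: "I \<in> indep M \<Longrightarrow> finite I"
  using indep_subset finite_ground finite_subset by blast

lemma closure_mono:
  assumes "X \<subseteq> Y" shows "closure M X \<subseteq> closure M Y"
proof
  fix x assume x: "x \<in> closure M X"
  then have xg: "x \<in> ground M" and rx: "rank M (insert x X) = rank M X" by (auto simp: closure_def)
  obtain I where I: "I \<in> indep M" "I \<subseteq> X" "card I = rank M X" using rank_attained by blast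
  obtain J where J: "J \<in> indep M" "I \<subseteq> J" "J \<subseteq> Y" "card J = rank M Y"
    using extend_indep[OF I(1)] I(2) assms by (metis subset_trans)
  have "rank M (insert x Y) \<le> rank M Y"
  proof (rule ccontr)
    assume "\<not> ?thesis"
    then obtain K where K: "K \<in> indep M" "K \<subseteq> insert x Y" "card J < card K"
      using rank_attained[of "insert x Y"] J(4) by auto
    then obtain y where y: "y \<in> K - J" "insert y J \<in> indep M" using indep_augment[OF J(1)] by blast
    have "y \<notin> Y"
    proof
      assume "y \<in> Y"
      then have "card (insert y J) \<le> rank M Y" using card_le_rank[OF y(2)] J(3) by blast
      then show False using y(1) J(4) finite_indepD[OF J(1)] by simp
    qed
    then have "y = x" using y(1) K(2) by blast
    then have "insert x I \<in> indep M" using indep_mono[OF y(2), of "insert x I"] J(2) by blast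
    then have "card (insert x I) \<le> rank M (insert x X)" using card_le_rank I(2) by blast
    moreover have "x \<notin> I" using y(1) J(2) \<open>y = x\<close> by blast
    ultimately show False using I(3) rx finite_indepD[OF I(1)] by simp
  qed
  moreover have "rank M Y \<le> rank M (insert x Y)" by (rule rank_mono) blast
  ultimately show "x \<in> closure M Y" using xg by (simp add: closure_def)
qed

lemma subset_closure: "X \<subseteq> ground M \<Longrightarrow> X \<subseteq> closure M X"
  by (auto simp: closure_def insert_absorb)

lemma rank_closure: assumes "X \<subseteq> ground M" shows "rank M (closure M X) = rank M X"
proof (rule antisym)
  obtain J where J: "J \<in> indep M" "J \<subseteq> X" "card J = rank M X" using rank_attained by blast
  show "rank M (closure M X) \<le> rank M X"
  proof (rule ccontr)
    assume "\<not> ?thesis"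
    then obtain K where K: "K \<in> indep M" "K \<subseteq> closure M X" "card J < card K"
      using rank_attained[of "closure M X"] J(3) by auto
    then obtain y where y: "y \<in> K - J" "insert y J \<in> indep M" using indep_augment[OF J(1)] by blast
    have "rank M (insert y X) = rank M X" using y(1) K(2) by (auto simp: closure_def)
    moreover have "card (insert y J) \<le> rank M (insert y X)" using card_le_rank[OF y(2)] J(2) by blast
    ultimately show False using J(3) y(1) finite_indepD[OF J(1)] by simp
  qed
qed (rule rank_mono[OF subset_closure[OF assms]])

lemma flat_closure: assumes "X \<subseteq> ground M" shows "flat M (closure M X)"
proof -
  have "closure M (closure M X) \<subseteq> closure M X"
  proof
    fix x assume x: "x \<in> closure M (closure M X)"
    then have "rank M (insert x (closure M X)) = rank M X"
      using rank_closure[OF assms] by (simp add: closure_def)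
    moreover have "rank M (insert x X) \<le> rank M (insert x (closure M X))"
      using subset_closure[OF assms] by (intro rank_mono) blast
    moreover have "rank M X \<le> rank M (insert x X)" by (intro rank_mono) blast
    ultimately have "rank M (insert x X) = rank M X" by simp
    then show "x \<in> closure M X" using x by (simp add: closure_def)
  qed
  moreover have "closure M X \<subseteq> ground M" by (auto simp: closure_def)
  ultimately show ?thesis using subset_closure by (auto simp: flat_def)
qed

text \<open>In an independent set no member lies in the closure of the others, and that closure is a
  flat missing it. This is how the flats prescribed by a connection pin down the matroid.\<close>

lemma indep_iff_flats:
  "I \<in> indep M \<longleftrightarrow> I \<subseteq> ground M \<and> (\<forall>x\<in>I. \<exists>F. flat M F \<and> I - {x} \<subseteq> F \<and> x \<notin> F)"
proof (intro iffI conjI ballI)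
  assume I: "I \<in> indep M"
  then show sub: "I \<subseteq> ground M" by (rule indep_subset)
  fix x assume x: "x \<in> I"
  have subx: "I - {x} \<subseteq> ground M" using sub by blast
  have "x \<notin> closure M (I - {x})"
  proof
    assume "x \<in> closure M (I - {x})"
    then have "rank M I = rank M (I - {x})" using x by (simp add: closure_def insert_absorb)
    moreover obtain J where "J \<subseteq> I - {x}" "card J = rank M (I - {x})" using rank_attained by blast
    then have "rank M (I - {x}) \<le> card (I - {x})" using card_mono[of "I - {x}" J] finite_indepD[OF I] by simp
    moreover have "card I \<le> rank M I" using card_le_rank[OF I] by blast
    moreover have "card (I - {x}) < card I" using finite_indepD[OF I] x by (intro psubset_card_mono) auto
    ultimately show False by simp
  qed
  then show "\<exists>F. flat M F \<and> I - {x} \<subseteq> F \<and> x \<notin> F"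
    using flat_closure[OF subx] subset_closure[OF subx] by blast
next
  assume "I \<subseteq> ground M \<and> (\<forall>x\<in>I. \<exists>F. flat M F \<and> I - {x} \<subseteq> F \<and> x \<notin> F)"
  then have sub: "I \<subseteq> ground M" and ex: "\<And>x. x \<in> I \<Longrightarrow> \<exists>F. flat M F \<and> I - {x} \<subseteq> F \<and> x \<notin> F" by blast+
  show "I \<in> indep M"
  proof (rule ccontr)
    assume dep: "I \<notin> indep M"
    obtain J where J: "J \<in> indep M" "J \<subseteq> I" "card J = rank M I" using rank_attained by blast
    then have "J \<noteq> I" using dep by blast
    then obtain x where x: "x \<in> I" "x \<notin> J" using J(2) by blast
    then have "card J \<le> rank M (I - {x})" using J by (intro card_le_rank) auto
    then have "rank M (insert x (I - {x})) = rank M (I - {x})"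
      using J(3) rank_mono[of "I - {x}" I] x by (simp add: insert_absorb)
    then have "x \<in> closure M (I - {x})" using x sub by (auto simp: closure_def)
    moreover obtain F where "flat M F" "I - {x} \<subseteq> F" "x \<notin> F" using ex[OF x(1)] by blast
    ultimately show False using closure_mono[of "I - {x}" F] by (auto simp: flat_def)
  qed
qed

lemma flat_ground: "flat M (ground M)"
  using subset_closure[of "ground M"] by (auto simp: flat_def closure_def)

end

lemma matroid_eqI_flats:
  fixes M N :: "'a matroid"
  assumes "matroid M" "matroid N" "ground M = ground N" "\<And>F. flat M F \<longleftrightarrow> flat N F"
  shows "M = N"
proof -
  have "indep M = indep N"
    unfolding set_eq_iff matroid.indep_iff_flats[OF assms(1)] matroid.indep_iff_flats[OF assms(2)]
    by (simp only: assms(3,4)) simp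
  then show ?thesis using assms(3) by simp
qed

lemma rank_restriction: "X \<subseteq> T \<Longrightarrow> rank (restriction M T) X = rank M X"
proof -
  assume "X \<subseteq> T"
  then have "{I \<in> indep (restriction M T). I \<subseteq> X} = {I \<in> indep M. I \<subseteq> X}"
    by (auto simp: restriction_def)
  then show ?thesis by (simp add: rank_def)
qed

text \<open>Closure inside \<open>T\<close> is computed from ranks of subsets of \<open>T\<close>,
  on which both matroids agree. A flat of one piece can thus be recognised as a flat of the
  connection.\<close>

lemma flat_trace:
  assumes M1: "matroid M1" and M2: "matroid M2" and T: "restriction M1 T = restriction M2 T"
    and TM: "T \<subseteq> ground M2" and flatT: "flat M1 T" and F: "flat M2 F"
  shows "flat M1 (F \<inter> T)"
proof -
  have TG: "T \<subseteq> ground M1" using flatT by (simp add: flat_def)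
  have "closure M1 (F \<inter> T) \<subseteq> F \<inter> T"
  proof
    fix x assume x: "x \<in> closure M1 (F \<inter> T)"
    then have xT: "x \<in> T" using matroid.closure_mono[OF M1, of "F \<inter> T" T] flatT by (auto simp: flat_def)
    have "rank M1 (insert x (F \<inter> T)) = rank M1 (F \<inter> T)" using x by (simp add: closure_def)
    moreover have "insert x (F \<inter> T) \<subseteq> T" "F \<inter> T \<subseteq> T" using xT by blast+
    ultimately have "rank M2 (insert x (F \<inter> T)) = rank M2 (F \<inter> T)"
      using rank_restriction[of _ T M1] rank_restriction[of _ T M2] T by metis
    then have "x \<in> closure M2 (F \<inter> T)" using xT TM by (auto simp: closure_def)
    then show "x \<in> F \<inter> T" using matroid.closure_mono[OF M2, of "F \<inter> T" F] F xT by (auto simp: flat_def)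
  qed
  moreover have "F \<inter> T \<subseteq> ground M1" using TG by blast
  ultimately show ?thesis using matroid.subset_closure[OF M1] by (auto simp: flat_def)
qed

subsection \<open>Binary matroids\<close>

lemma rep_cong:
  assumes "rep N \<phi> U" "\<And>x. x \<in> ground N \<Longrightarrow> \<phi> x = \<psi> x" shows "rep N \<psi> U"
proof -
  have "sum \<phi> D = sum \<psi> D" if "D \<subseteq> ground N" for D using assms(2) that by (intro sum.cong) auto
  then have "I \<subseteq> ground N \<and> (\<forall>D\<subseteq>I. sum \<phi> D \<in> U \<longrightarrow> D = {}) \<longleftrightarrow>
      I \<subseteq> ground N \<and> (\<forall>D\<subseteq>I. sum \<psi> D \<in> U \<longrightarrow> D = {})" for I
    by (metis subset_trans)
  then show ?thesis using assms(1) unfolding rep_def by simp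
qed

text \<open>A coefficient family over GF(2) is the indicator of a subset, so linear combinations
  become subset sums. Coordinates from \<open>n\<close> on are cleared, as the vector matroid
  ignores them.\<close>

lemma rep_vector_matroid:
  fixes v :: "'a \<Rightarrow> nat \<Rightarrow> bit"
  assumes E: "finite E"
  shows "rep (vector_matroid n v E) (\<lambda>x i. if i < n then v x i else 0) {0}"
proof -
  let ?\<phi> = "\<lambda>x i. if i < n then v x i else 0"
  have "(\<forall>c. (\<forall>i<n. (\<Sum>x\<in>X. c x * v x i) = 0) \<longrightarrow> (\<forall>x\<in>X. c x = 0)) \<longleftrightarrow>
      (\<forall>D\<subseteq>X. sum ?\<phi> D \<in> {0} \<longrightarrow> D = {})" if X: "X \<subseteq> E" for X
  proof -
    have finX: "finite X" using X E finite_subset by blast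
    have zero: "sum ?\<phi> D = 0 \<longleftrightarrow> (\<forall>i<n. (\<Sum>x\<in>D. v x i) = 0)" for D
    proof -
      have "(\<Sum>x\<in>D. ?\<phi> x i) = (if i < n then \<Sum>x\<in>D. v x i else 0)" for i by simp
      then show ?thesis unfolding fun_eq_iff sum_fun_apply by auto
    qed
    have coeff: "(\<Sum>x\<in>X. c x * v x i) = (\<Sum>x\<in>{x \<in> X. c x = 1}. v x i)" for c i
    proof -
      have "(\<Sum>x\<in>{x \<in> X. c x = 1}. v x i) = (\<Sum>x\<in>X. if c x = 1 then v x i else 0)"
        using finX by (rule sum.inter_filter)
      also have "\<dots> = (\<Sum>x\<in>X. c x * v x i)"
      proof (rule sum.cong)
        fix x show "(if c x = 1 then v x i else 0) = c x * v x i" by (cases "c x") simp_all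
      qed simp
      finally show ?thesis ..
    qed
    show ?thesis
    proof
      assume *: "\<forall>c. (\<forall>i<n. (\<Sum>x\<in>X. c x * v x i) = 0) \<longrightarrow> (\<forall>x\<in>X. c x = 0)"
      show "\<forall>D\<subseteq>X. sum ?\<phi> D \<in> {0} \<longrightarrow> D = {}"
      proof (intro allI impI)
        fix D assume D: "D \<subseteq> X" "sum ?\<phi> D \<in> {0}"
        define c :: "'a \<Rightarrow> bit" where "c x = (if x \<in> D then 1 else 0)" for x
        have "{x \<in> X. c x = 1} = D" using D(1) by (auto simp: c_def)
        then have "\<forall>i<n. (\<Sum>x\<in>X. c x * v x i) = 0" using D(2) zero[of D] unfolding coeff by simp
        then have "\<forall>x\<in>X. c x = 0" using * by blast
        then have "x \<notin> D" if "x \<in> X" for x using that unfolding c_def by (metis zero_neq_one)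
        then show "D = {}" using D(1) by blast
      qed
    next
      assume *: "\<forall>D\<subseteq>X. sum ?\<phi> D \<in> {0} \<longrightarrow> D = {}"
      show "\<forall>c. (\<forall>i<n. (\<Sum>x\<in>X. c x * v x i) = 0) \<longrightarrow> (\<forall>x\<in>X. c x = 0)"
      proof (intro allI impI ballI)
        fix c x assume c: "\<forall>i<n. (\<Sum>x\<in>X. c x * v x i) = 0" and x: "x \<in> X"
        have "sum ?\<phi> {x \<in> X. c x = 1} = 0" unfolding zero using c unfolding coeff .
        then have "{x \<in> X. c x = 1} = {}" using *[rule_format, of "{x \<in> X. c x = 1}"] by simp
        then show "c x = 0" using x bit_not_one_iff by blast
      qed
    qed
  qed
  then have "indep (vector_matroid n v E) = {I. I \<subseteq> E \<and> (\<forall>D\<subseteq>I. sum ?\<phi> D \<in> {0} \<longrightarrow> D = {})}"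
    unfolding vector_matroid_def matroid.simps by (intro Collect_cong conj_cong HOL.refl)
  moreover have "ground (vector_matroid n v E) = E" by (simp add: vector_matroid_def)
  ultimately show ?thesis unfolding rep_def using E subsp_singleton by auto
qed

lemma binary_rep:
  assumes "matroid M" "binary M"
  shows "\<exists>\<phi> :: 'a \<Rightarrow> nat \<Rightarrow> bit. rep (M :: 'a matroid) \<phi> {0}"
  using assms rep_vector_matroid[of "ground M"] matroid.finite_ground[OF assms(1)]
  unfolding representable_def by metis

subsection \<open>Projective geometries over the two-element field\<close>

abbreviation vecs :: "nat \<Rightarrow> (nat \<Rightarrow> bit) set" where
  "vecs n \<equiv> {v. \<forall>i\<ge>n. v i = 0}"

lemma finite_vecs: "finite (vecs n)"
proof -
  have "vecs n \<subseteq> ind ` Pow {..<n}"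
  proof
    fix v :: "nat \<Rightarrow> bit" assume v: "v \<in> vecs n"
    have "v i = ind {i. v i = 1} i" for i by (cases "v i") (simp_all add: ind_def)
    then have "v = ind {i. v i = 1}" by (rule ext)
    moreover have "{i. v i = 1} \<subseteq> {..<n}" using v by (auto simp: not_le[symmetric])
    ultimately show "v \<in> ind ` Pow {..<n}" by blast
  qed
  then show ?thesis using finite_subset by blast
qed

lemma ground_full_vector_matroid [simp]: "ground (full_vector_matroid n) = {v. \<forall>i\<ge>n. v i = 0}"
  by (simp add: full_vector_matroid_def vector_matroid_def)

lemma rep_full_vector_matroid: "rep (full_vector_matroid n) (\<lambda>v :: nat \<Rightarrow> bit. v) {0}"
proof (rule rep_cong)
  show "rep (full_vector_matroid n) (\<lambda>(x :: nat \<Rightarrow> bit) i. if i < n then x i else 0) {0}"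
    unfolding full_vector_matroid_def by (rule rep_vector_matroid[OF finite_vecs])
  show "(\<lambda>i. if i < n then x i else 0) = x" if "x \<in> ground (full_vector_matroid n)" for x :: "nat \<Rightarrow> bit"
    using that by (auto simp: fun_eq_iff not_less)
qed

lemma elems_zero: "elems N \<phi> {0} = insert 0 (\<phi> ` ground N)"
  by (auto simp: mem_elems add_eq_0_iff_eq)

text \<open>Any two points \<open>e\<close>, \<open>e'\<close> complete to the triangle
  \<open>e, e', e + e'\<close>. An isomorphism keeps this relation, so any representation maps the
  third point to the sum of the first two.\<close>

lemma projective_geometry_subsp:
  assumes M: "projective_geometry TYPE(bit) M" and r: "rep M \<phi> {0}"
  shows "subsp (elems M \<phi> {0})"
proof -
  obtain n and N :: "(nat \<Rightarrow> bit) matroid"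
    where N: "is_simplification (full_vector_matroid n) N" and iso: "matroid_iso M N"
    using M by (auto simp: projective_geometry_def)
  have rN: "rep N (\<lambda>v. v) {0}" and eN: "elems N (\<lambda>v. v) {0} = elems (full_vector_matroid n) (\<lambda>v. v) {0}"
    using rep_simplification[OF rep_full_vector_matroid N] by (auto simp: simple_rep_def)
  have gN: "insert 0 (ground N) = vecs n"
    using eN unfolding elems_zero by (simp add: image_ident insert_absorb)
  obtain \<psi> where \<psi>: "\<And>D. D \<subseteq> ground N \<Longrightarrow> sum \<psi> D \<in> {0} \<longleftrightarrow> D \<in> {D. D \<subseteq> ground N \<and> sum (\<lambda>v. v) D \<in> {0}}"
    "\<And>v. v \<in> elems M \<phi> {0} \<longleftrightarrow> v \<in> {0} \<or> (\<exists>e\<in>ground N. v + \<psi> e \<in> {0})"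
    by (rule iso_transfer[OF iso r rep_cycles[OF rN]]) (rule that)
  have E: "v \<in> elems M \<phi> {0} \<longleftrightarrow> v = 0 \<or> (\<exists>e\<in>ground N. v = \<psi> e)" for v
    using \<psi>(2)[of v] by (simp add: add_eq_0_iff_eq)
  have "\<psi> e + \<psi> e' \<in> elems M \<phi> {0}" if e: "e \<in> ground N" "e' \<in> ground N" for e e'
  proof (cases "e = e'")
    case False
    have "e \<in> vecs n" "e' \<in> vecs n" using e gN by blast+
    then have "e + e' \<in> insert 0 (ground N)" unfolding gN by simp
    moreover have "e + e' \<noteq> 0" using False by (simp add: add_eq_0_iff_eq)
    ultimately have g: "e + e' \<in> ground N" by blast
    have nz: "e \<noteq> 0" "e' \<noteq> 0"
      using rep_indep_single[OF rN, of e] rep_simplification(1)[OF rep_full_vector_matroid N] e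
      by (auto simp: simple_rep_def)
    have ne: "e \<noteq> e + e'" "e' \<noteq> e + e'" using nz by (metis add_self_left add_self add.commute add_0_right)+
    have "\<Sum>{e, e', e + e'} = e + (e' + (e + e'))" "sum \<psi> {e, e', e + e'} = \<psi> e + (\<psi> e' + \<psi> (e + e'))"
      using False ne by simp_all
    then have "\<psi> e + (\<psi> e' + \<psi> (e + e')) = 0"
      using \<psi>(1)[of "{e, e', e + e'}"] e g by (simp add: ac_simps)
    then have "\<psi> e + \<psi> e' = \<psi> (e + e')" by (simp add: add_eq_0_iff_eq flip: add.assoc)
    then show ?thesis using E g by blast
  qed (simp add: E)
  then have add: "x + y \<in> elems M \<phi> {0}" if "x = 0 \<or> (\<exists>e\<in>ground N. x = \<psi> e)" "y = 0 \<or> (\<exists>e\<in>ground N. y = \<psi> e)" for x y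
    using that E by fastforce
  show ?thesis
    unfolding subsp_def
  proof (intro conjI ballI)
    show "x + y \<in> elems M \<phi> {0}" if "x \<in> elems M \<phi> {0}" "y \<in> elems M \<phi> {0}" for x y
      using that unfolding E[of x] E[of y] by (rule add)
  qed (simp add: E)
qed

lemma subsp_projective_geometry:
  fixes \<phi> :: "'a \<Rightarrow> 'v::xor_group"
  assumes M: "simple_rep M \<phi> {0}" and S: "subsp (elems M \<phi> {0})"
  shows "projective_geometry TYPE(bit) M"
proof -
  have r: "rep M \<phi> {0}" and nz: "\<And>x. x \<in> ground M \<Longrightarrow> \<phi> x \<noteq> 0" and inj: "inj_on \<phi> (ground M)"
    using M by (auto simp: simple_rep_def add_eq_0_iff_eq inj_on_def)
  have plus0: "A + {0} = A" for A :: "'v set" by simp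
  obtain I where I: "I \<in> indep M" "I \<subseteq> ground M" "sp (\<phi> ` I) = sp (\<phi> ` ground M)"
    using rep_max_indep[OF r order_refl] unfolding plus0 by metis
  have finI: "finite I" by (rule rep_indep_finite[OF r I(1)])
  have E: "insert 0 (\<phi> ` ground M) = sp (\<phi> ` I)"
  proof -
    have "sp (\<phi> ` ground M) \<subseteq> elems M \<phi> {0}" by (intro sp_least S) (auto simp: elems_zero)
    moreover have "elems M \<phi> {0} \<subseteq> sp (\<phi> ` ground M)" unfolding elems_zero using zero_in_sp[of "\<phi> ` ground M"] sp_superset[of "\<phi> ` ground M"] by blast
    ultimately show ?thesis unfolding I(3) elems_zero by (rule subset_antisym[rotated])
  qed
  define n where "n = card I"
  obtain b where b: "bij_betw b {..<n} I"
    using finite_same_card_bij[of "{..<n}" I] finI by (auto simp: n_def)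
  have binj: "inj_on b {..<n}" and bim: "b ` {..<n} = I" using b by (auto simp: bij_betw_def)
  \<comment> \<open>Reads a 0-1 vector as coordinates with respect to the basis \<open>I\<close> in
    the order given by \<open>b\<close>.\<close>
  define L where "L h = (\<Sum>i<n. if h i = 1 then \<phi> (b i) else 0)" for h :: "nat \<Rightarrow> bit"
  have L_add: "L (h + k) = L h + L k" for h k
    unfolding L_def sum.distrib[symmetric]
  proof (rule sum.cong)
    fix i show "(if (h + k) i = 1 then \<phi> (b i) else 0) = (if h i = 1 then \<phi> (b i) else 0) + (if k i = 1 then \<phi> (b i) else 0)"
      by (cases "h i"; cases "k i") simp_all
  qed simp
  have L_0: "L 0 = 0" by (simp add: L_def)
  have L_sum: "L (sum f D) = (\<Sum>x\<in>D. L (f x))" if "finite D" for f :: "'a \<Rightarrow> nat \<Rightarrow> bit" and D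
    using that
  proof (induction D rule: finite_induct)
    case empty show ?case by (simp only: sum.empty L_0)
  next
    case (insert x D)
    have "sum f (insert x D) = f x + sum f D" by (rule sum.insert[OF insert.hyps])
    then have "L (sum f (insert x D)) = L (f x) + L (sum f D)" by (simp only: L_add)
    then show ?case unfolding insert.IH sum.insert[OF insert.hyps] .
  qed
  have L_set: "L h = sum \<phi> (b ` {i \<in> {..<n}. h i = 1})" for h
  proof -
    have "sum \<phi> (b ` {i \<in> {..<n}. h i = 1}) = (\<Sum>i\<in>{i \<in> {..<n}. h i = 1}. \<phi> (b i))"
      using inj_on_subset[OF binj, of "{i \<in> {..<n}. h i = 1}"] by (subst sum.reindex) auto
    also have "\<dots> = L h" unfolding L_def by (rule sum.inter_filter) simp
    finally show ?thesis ..
  qed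
  have L_zero: "L h = 0 \<longleftrightarrow> h = 0" if h: "h \<in> vecs n" for h
  proof
    assume "L h = 0"
    moreover have "b ` {i \<in> {..<n}. h i = 1} \<subseteq> I" using bim by blast
    ultimately have "b ` {i \<in> {..<n}. h i = 1} = {}"
      unfolding L_set by (intro rep_indepD[OF r I(1)]) simp_all
    then have "h i \<noteq> 1" if "i < n" for i using that by blast
    then have "h i = 0" for i using h by (cases "i < n") (auto simp: bit_not_one_iff)
    then show "h = 0" by (simp add: fun_eq_iff)
  qed (simp add: L_0)
  have "\<exists>h. h \<in> vecs n \<and> L h = \<phi> x" if x: "x \<in> ground M" for x
  proof -
    have "\<phi> x \<in> sp (\<phi> ` I)" using x E by blast
    then obtain Y where Y: "Y \<subseteq> I" "\<phi> x = sum \<phi> Y" using sp_image_eq[OF finI] by blast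
    define h :: "nat \<Rightarrow> bit" where "h i = (if i < n \<and> b i \<in> Y then 1 else 0)" for i
    have "b ` {i \<in> {..<n}. h i = 1} = Y" using Y(1) bim by (auto simp: h_def)
    then show ?thesis using Y(2) by (intro exI[of _ h]) (simp add: L_set h_def[abs_def])
  qed
  then obtain f where f: "f x \<in> vecs n" "L (f x) = \<phi> x" if "x \<in> ground M" for x by metis
  have finj: "inj_on f (ground M)"
    using inj f(2) by (auto simp: inj_on_def) metis
  \<comment> \<open>Over GF(2) a line through the origin has one nonzero vector, so simplification
    only deletes 0.\<close>
  define N :: "(nat \<Rightarrow> bit) matroid" where "N = restriction (full_vector_matroid n) (vecs n - {0})"
  have gN: "ground N = vecs n - {0}" by (simp add: N_def restriction_def)
  have rN: "rep N (\<lambda>v. v) {0}" unfolding N_def by (rule rep_restriction[OF rep_full_vector_matroid]) simp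
  have simplification: "is_simplification (full_vector_matroid n) N"
    unfolding is_simplification_def
  proof (intro exI[of _ "vecs n - {0}"] conjI ballI impI)
    show "N = restriction (full_vector_matroid n) (vecs n - {0})" by (rule N_def)
    show "\<not> loop (full_vector_matroid n) x" if "x \<in> vecs n - {0}" for x
      using that by (simp add: rep_loop[OF rep_full_vector_matroid])
    fix y :: "nat \<Rightarrow> bit" assume "y \<in> ground (full_vector_matroid n)" "\<not> loop (full_vector_matroid n) y"
    then have "y \<in> vecs n - {0}" by (simp add: rep_loop[OF rep_full_vector_matroid])
    then show "\<exists>!x. x \<in> vecs n - {0} \<and> parallel (full_vector_matroid n) x y"
      unfolding rep_parallel[OF rep_full_vector_matroid] by (intro ex1I[of _ y]) (simp_all add: add_eq_0_iff_eq)
  qed auto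
  have fsum: "sum f D \<in> vecs n" if "D \<subseteq> ground M" for D
  proof -
    have "sum f D i = 0" if i: "i \<ge> n" for i
      unfolding sum_fun_apply using f(1) \<open>D \<subseteq> ground M\<close> i by (intro sum.neutral) auto
    then show ?thesis by simp
  qed
  have bij: "bij_betw f (ground M) (ground N)"
    unfolding bij_betw_def
  proof (intro conjI finj equalityI subsetI)
    fix v assume "v \<in> f ` ground M"
    then obtain x where x: "x \<in> ground M" "v = f x" by blast
    then have "v \<noteq> 0" using nz[OF x(1)] f(2)[OF x(1)] L_0 by auto
    then show "v \<in> ground N" using x f(1) gN by simp
  next
    fix v assume v: "v \<in> ground N"
    then have vn: "v \<in> vecs n" "v \<noteq> 0" by (simp_all add: gN)
    have "b ` {i \<in> {..<n}. v i = 1} \<subseteq> I" using bim by blast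
    then have "L v \<in> sp (\<phi> ` I)" using sp_image_eq[OF finI] unfolding L_set by blast
    moreover have "L v \<noteq> 0" using L_zero vn by blast
    ultimately obtain x where x: "x \<in> ground M" "L v = \<phi> x" using E by blast
    have "L (v + f x) = 0" using x f(2) by (simp add: L_add)
    moreover have "v + f x \<in> vecs n" using vn(1) f(1)[OF x(1)] by simp
    ultimately have "v = f x" using L_zero by (simp add: add_eq_0_iff_eq)
    then show "v \<in> f ` ground M" using x(1) by blast
  qed
  have "matroid_iso M N"
  proof (rule matroid_isoI_cycles[OF rep_cycles[OF r] rep_cycles[OF rN] bij])
    fix D assume D: "D \<subseteq> ground M"
    have finD: "finite D" using D repD(1)[OF r] finite_subset by blast
    have "\<Sum>(f ` D) = sum f D" using inj_on_subset[OF finj D] by (simp add: sum.reindex)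
    moreover have "sum f D = 0 \<longleftrightarrow> sum \<phi> D = 0"
    proof -
      have "(\<Sum>x\<in>D. L (f x)) = sum \<phi> D" using f(2) D by (intro sum.cong) auto
      then show ?thesis using L_zero[OF fsum[OF D]] L_sum[OF finD, of f] by simp
    qed
    moreover have "f ` D \<subseteq> ground N" using bij D by (auto simp: bij_betw_def)
    ultimately show "D \<in> {D. D \<subseteq> ground M \<and> sum \<phi> D \<in> {0}} \<longleftrightarrow> f ` D \<in> {D. D \<subseteq> ground N \<and> \<Sum>D \<in> {0}}"
      using D by simp
  qed
  then show ?thesis
    unfolding projective_geometry_def using rep_matroid[OF r] simplification by blast
qed

subsection \<open>Chordal matroids and chordal sets of vectors\<close>

lemma card_subsp_plus:
  fixes A B :: "'v::xor_group set"
  assumes "subsp A" "subsp B"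
  shows "card (A + B) * card (A \<inter> B) = card A * card B"
proof -
  define r where "r v = (SOME a. a \<in> A \<and> v + a \<in> B)" for v
  have r: "r v \<in> A" "v + r v \<in> B" if "v \<in> A + B" for v
    using someI_ex[of "\<lambda>a. a \<in> A \<and> v + a \<in> B"] that by (auto simp: r_def mem_plus_iff)
  \<comment> \<open>\<open>r v\<close> is a fixed summand of \<open>v\<close> from \<open>A\<close>.
    A pair \<open>(a, b)\<close> is recovered from \<open>v = a + b\<close> and the common vector
    \<open>t = a + r v\<close>.\<close>
  define f where "f p = (r (fst p) + snd p, fst p + r (fst p) + snd p)" for p :: "'v \<times> 'v"
  have "bij_betw f ((A + B) \<times> (A \<inter> B)) (A \<times> B)"
  proof (rule bij_betwI')
    fix p q assume "p \<in> (A + B) \<times> (A \<inter> B)" "q \<in> (A + B) \<times> (A \<inter> B)"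
    obtain v t w s where pq: "p = (v, t)" "q = (w, s)" by (meson surj_pair)
    show "f p = f q \<longleftrightarrow> p = q"
    proof
      assume "f p = f q"
      then have eq: "r v + t = r w + s" "v + r v + t = w + r w + s" by (simp_all add: f_def pq)
      then have "v + (r v + t) = w + (r v + t)" by (simp add: add.assoc)
      then have "v = w" by simp
      then show "p = q" using eq(1) by (simp add: pq)
    qed simp
  next
    fix p assume "p \<in> (A + B) \<times> (A \<inter> B)"
    then obtain v t where vt: "p = (v, t)" "v \<in> A + B" "t \<in> A" "t \<in> B" by (elim SigmaE) simp
    then show "f p \<in> A \<times> B"
      using subsp_add[OF assms(1) r(1)[OF vt(2)] vt(3)] subsp_add[OF assms(2) r(2)[OF vt(2)] vt(4)] by (simp add: f_def)
  next
    fix p assume "p \<in> A \<times> B"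
    then obtain a b where ab: "p = (a, b)" "a \<in> A" "b \<in> B" by (elim SigmaE) simp
    let ?v = "a + b"
    have v: "?v \<in> A + B" using ab by (intro set_plus_intro)
    have "a + r ?v \<in> A" by (rule subsp_add[OF assms(1) ab(2) r(1)[OF v]])
    moreover have "b + (?v + r ?v) \<in> B" by (rule subsp_add[OF assms(2) ab(3) r(2)[OF v]])
    then have "a + r ?v \<in> B" by (simp add: ac_simps)
    ultimately have "(?v, a + r ?v) \<in> (A + B) \<times> (A \<inter> B)" using v by simp
    moreover have "p = f (?v, a + r ?v)" by (simp add: ab(1) f_def ac_simps)
    ultimately show "\<exists>q \<in> (A + B) \<times> (A \<inter> B). p = f q" by (intro bexI)
  qed
  from bij_betw_same_card[OF this] show ?thesis by (simp add: card_cartesian_product)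
qed

lemma rep_rank_zero:
  assumes "rep N \<phi> {0}" "X \<subseteq> ground N" shows "card (sp (\<phi> ` X)) = 2 ^ rank N X"
  using rep_rank[OF assms] by simp

lemma rep_flat_zero:
  "rep N \<phi> {0} \<Longrightarrow> flat N F \<longleftrightarrow> F \<subseteq> ground N \<and> (\<forall>x\<in>ground N. \<phi> x \<in> sp (\<phi> ` F) \<longrightarrow> x \<in> F)"
  using rep_flat[of N \<phi> "{0}" F] by simp

lemma modular_flat_of_subsp:
  assumes r: "rep N \<phi> {0}" and T: "T \<subseteq> ground N" and W: "subsp (insert 0 (\<phi> ` T))"
    and inj: "inj_on \<phi> (ground N)" and nz: "\<And>x. x \<in> ground N \<Longrightarrow> \<phi> x \<noteq> 0"
  shows "modular_flat N T"
  unfolding modular_flat_def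
proof (intro conjI allI impI)
  have spT: "sp (\<phi> ` T) = insert 0 (\<phi> ` T)"
  proof
    show "sp (\<phi> ` T) \<subseteq> insert 0 (\<phi> ` T)" by (intro sp_least W) auto
    show "insert 0 (\<phi> ` T) \<subseteq> sp (\<phi> ` T)" using zero_in_sp sp_superset by blast
  qed
  have inT: "x \<in> T" if "x \<in> ground N" "\<phi> x \<in> sp (\<phi> ` T)" for x
    using that nz[OF that(1)] inj T unfolding spT inj_on_def by blast
  show "flat N T" using rep_flat_zero[OF r] T inT by blast
  fix F assume F: "flat N F"
  have FG: "F \<subseteq> ground N" and inF: "\<And>x. x \<in> ground N \<Longrightarrow> \<phi> x \<in> sp (\<phi> ` F) \<Longrightarrow> x \<in> F"
    using F rep_flat_zero[OF r] by blast+
  have "sp (\<phi> ` (T \<inter> F)) = sp (\<phi> ` T) \<inter> sp (\<phi> ` F)"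
  proof
    show "sp (\<phi> ` (T \<inter> F)) \<subseteq> sp (\<phi> ` T) \<inter> sp (\<phi> ` F)"
      using sp_mono[of "\<phi> ` (T \<inter> F)" "\<phi> ` T"] sp_mono[of "\<phi> ` (T \<inter> F)" "\<phi> ` F"] by blast
    show "sp (\<phi> ` T) \<inter> sp (\<phi> ` F) \<subseteq> sp (\<phi> ` (T \<inter> F))"
    proof
      fix v assume v: "v \<in> sp (\<phi> ` T) \<inter> sp (\<phi> ` F)"
      then consider "v = 0" | x where "x \<in> T" "v = \<phi> x" unfolding spT by blast
      then show "v \<in> sp (\<phi> ` (T \<inter> F))"
      proof cases
        case 1
        then show ?thesis by (simp add: zero_in_sp)
      next
        case (2 x)
        then have "x \<in> F" using inF v T by blast
        then show ?thesis using 2 by (auto intro: sp_incl)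
      qed
    qed
  qed
  moreover have "sp (\<phi> ` (T \<union> F)) = sp (\<phi> ` T) + sp (\<phi> ` F)" by (simp add: image_Un sp_Un)
  ultimately have "card (sp (\<phi> ` (T \<union> F))) * card (sp (\<phi> ` (T \<inter> F))) = card (sp (\<phi> ` T)) * card (sp (\<phi> ` F))"
    using card_subsp_plus[OF subsp_sp subsp_sp] by metis
  moreover have "T \<union> F \<subseteq> ground N" "T \<inter> F \<subseteq> ground N" using T FG by blast+
  ultimately have "(2::nat) ^ (rank N T + rank N F) = 2 ^ (rank N (T \<inter> F) + rank N (T \<union> F))"
    using rep_rank_zero[OF r] T FG by (simp add: power_add mult.commute)
  then show "rank N T + rank N F = rank N (T \<inter> F) + rank N (T \<union> F)"
    by (simp add: power_inject_exp)
qed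

lemma simple_repD_zero:
  assumes "simple_rep N \<phi> {0}"
  shows "rep N \<phi> {0}" "inj_on \<phi> (ground N)" "x \<in> ground N \<Longrightarrow> \<phi> x \<noteq> 0"
  using assms by (auto simp: simple_rep_def add_eq_0_iff_eq inj_on_def)

lemma simple_rep_restriction:
  assumes "simple_rep N \<phi> U" "X \<subseteq> ground N" shows "simple_rep (restriction N X) \<phi> U"
proof -
  have "ground (restriction N X) = X" by (simp add: restriction_def)
  then show ?thesis using assms rep_restriction[of N \<phi> U X] unfolding simple_rep_def by blast
qed

lemma ground_restriction: "ground (restriction N X) = X"
  by (simp add: restriction_def)

lemma restriction_restriction: "Y \<subseteq> X \<Longrightarrow> restriction (restriction N X) Y = restriction N Y"
  by (auto simp: restriction_def)

lemma chordal_gf_chordal: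
  fixes M :: "'a matroid" and \<phi> :: "'a \<Rightarrow> 'v::xor_group"
  assumes "chordal S" "simple_rep M \<phi> {0}" "insert 0 (\<phi> ` ground M) = S"
  shows "gf_chordal TYPE(bit) M"
  using assms
proof (induction arbitrary: M rule: chordal.induct)
  case (subspace W)
  then have "subsp (elems M \<phi> {0})" unfolding elems_zero by (simp only:)
  then show ?case by (rule gf_chordal.projective[OF subsp_projective_geometry[OF subspace.prems(1)]])
next
  case (glue S1 S2)
  note r = simple_repD_zero[OF glue.prems(1)]
  define E1 E2 where "E1 = {x \<in> ground M. \<phi> x \<in> S1}" and "E2 = {x \<in> ground M. \<phi> x \<in> S2}"
  have E: "E1 \<subseteq> ground M" "E2 \<subseteq> ground M" "ground M = E1 \<union> E2"
    using glue.prems(2) by (auto simp: E1_def E2_def)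
  have 0: "0 \<in> S1" "0 \<in> S2" using glue.hyps chordal_0 by blast+
  have S1: "insert 0 (\<phi> ` E1) = S1" and S2: "insert 0 (\<phi> ` E2) = S2"
    using glue.prems(2) 0 by (auto simp: E1_def E2_def)
  let ?M1 = "restriction M E1" and ?M2 = "restriction M E2"
  define T where "T = E1 \<inter> E2"
  have TE: "T \<subseteq> E1" "T \<subseteq> E2" "T \<subseteq> ground M" using E by (auto simp: T_def)
  have W: "insert 0 (\<phi> ` T) = S1 \<inter> S2"
    using glue.prems(2) 0 by (auto simp: T_def E1_def E2_def)
  have "S1 \<inter> S2 = sp S1 \<inter> sp S2" using glue.hyps(3) sp_superset by blast
  then have subW: "subsp (insert 0 (\<phi> ` T))" unfolding W by (simp add: subsp_Int subsp_sp)
  have spE: "sp S1 = sp (\<phi> ` E1)" "sp S2 = sp (\<phi> ` E2)"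
  proof -
    show "sp S1 = sp (\<phi> ` E1)" "sp S2 = sp (\<phi> ` E2)" using S1 S2 sp_insert_zero by metis+
  qed
  have s1: "simple_rep ?M1 \<phi> {0}" and s2: "simple_rep ?M2 \<phi> {0}"
    using simple_rep_restriction[OF glue.prems(1)] E by blast+
  note r1 = simple_repD_zero[OF s1] and r2 = simple_repD_zero[OF s2]
  have gf: "gf_chordal TYPE(bit) ?M1" "gf_chordal TYPE(bit) ?M2"
    using glue.IH(1)[OF s1] glue.IH(2)[OF s2] S1 S2 by (simp_all add: ground_restriction)
  have gT: "ground ?M1 \<inter> ground ?M2 = T" by (simp add: ground_restriction T_def)
  have rT: "restriction ?M1 T = restriction M T" "restriction ?M2 T = restriction M T"
    using TE by (simp_all add: restriction_restriction)
  have PG: "projective_geometry TYPE(bit) (restriction ?M1 (ground ?M1 \<inter> ground ?M2))"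
    unfolding gT rT using subW
    by (intro subsp_projective_geometry[OF simple_rep_restriction[OF glue.prems(1) TE(3)]])
      (simp add: elems_zero ground_restriction)
  have flats: "flat M F \<longleftrightarrow> flat ?M1 (F \<inter> E1) \<and> flat ?M2 (F \<inter> E2)" if F: "F \<subseteq> ground M" for F
  proof
    assume "flat M F"
    then have inF: "\<And>x. x \<in> ground M \<Longrightarrow> \<phi> x \<in> sp (\<phi> ` F) \<Longrightarrow> x \<in> F" using rep_flat_zero[OF r(1)] by blast
    have "sp (\<phi> ` (F \<inter> E)) \<subseteq> sp (\<phi> ` F)" for E by (intro sp_mono) blast
    then show "flat ?M1 (F \<inter> E1) \<and> flat ?M2 (F \<inter> E2)"
      unfolding rep_flat_zero[OF r1(1)] rep_flat_zero[OF r2(1)] ground_restriction using inF E by blast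
  next
    assume "flat ?M1 (F \<inter> E1) \<and> flat ?M2 (F \<inter> E2)"
    then have in1: "\<And>x. x \<in> E1 \<Longrightarrow> \<phi> x \<in> sp (\<phi> ` (F \<inter> E1)) \<Longrightarrow> x \<in> F"
      and in2: "\<And>x. x \<in> E2 \<Longrightarrow> \<phi> x \<in> sp (\<phi> ` (F \<inter> E2)) \<Longrightarrow> x \<in> F"
      unfolding rep_flat_zero[OF r1(1)] rep_flat_zero[OF r2(1)] ground_restriction by blast+
    have sub1: "sp (\<phi> ` (F \<inter> E1)) \<subseteq> sp (\<phi> ` E1)" and sub2: "sp (\<phi> ` (F \<inter> E2)) \<subseteq> sp (\<phi> ` E2)"
      by (intro sp_mono; blast)+
    \<comment> \<open>A vector common to both spans is 0 or an element of \<open>T\<close>. If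
      \<open>F\<close> generates it on one side, flatness puts that element into \<open>F\<close>,
      and so \<open>F\<close> generates it on the other side too.\<close>
    have meet: "v \<in> sp (\<phi> ` (F \<inter> E1)) \<and> v \<in> sp (\<phi> ` (F \<inter> E2))"
      if v: "v \<in> sp (\<phi> ` E1)" "v \<in> sp (\<phi> ` E2)" "v \<in> sp (\<phi> ` (F \<inter> E1)) \<or> v \<in> sp (\<phi> ` (F \<inter> E2))" for v
    proof -
      have "v \<in> insert 0 (\<phi> ` T)" using v(1,2) glue.hyps(3) unfolding W spE by blast
      then consider "v = 0" | x where "x \<in> T" "v = \<phi> x" by blast
      then show ?thesis
      proof cases
        case 1
        then show ?thesis by (simp add: zero_in_sp)
      next
        case (2 x)
        then have "x \<in> F" using v(3) in1 in2 TE by blast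
        then show ?thesis using 2 TE by (auto intro!: sp_incl)
      qed
    qed
    have "F = (F \<inter> E1) \<union> (F \<inter> E2)" using F E by blast
    then have spF: "sp (\<phi> ` F) = sp (\<phi> ` (F \<inter> E1)) + sp (\<phi> ` (F \<inter> E2))" by (metis image_Un sp_Un)
    have "x \<in> F" if x: "x \<in> ground M" "\<phi> x \<in> sp (\<phi> ` F)" for x
    proof -
      obtain a b where ab: "\<phi> x = a + b" "a \<in> sp (\<phi> ` (F \<inter> E1))" "b \<in> sp (\<phi> ` (F \<inter> E2))"
        using x(2) unfolding spF by (rule set_plus_elim)
      consider "x \<in> E1" | "x \<in> E2" using x(1) E by blast
      then show ?thesis
      proof cases
        case 1
        have "b = \<phi> x + a" using ab(1) by (simp add: ac_simps)
        then have "b \<in> sp (\<phi> ` E1)" using 1 ab(2) sub1 by (auto intro!: sp_add intro: sp_incl)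
        then have "b \<in> sp (\<phi> ` (F \<inter> E1))" using meet ab(3) sub2 by blast
        then show ?thesis using in1[OF 1] ab(1,2) sp_add by metis
      next
        case 2
        have "a = \<phi> x + b" using ab(1) by (simp add: ac_simps)
        then have "a \<in> sp (\<phi> ` E2)" using 2 ab(3) sub2 by (auto intro!: sp_add intro: sp_incl)
        then have "a \<in> sp (\<phi> ` (F \<inter> E2))" using meet ab(2) sub1 by blast
        then show ?thesis using in2[OF 2] ab(1,3) sp_add by metis
      qed
    qed
    then show "flat M F" using rep_flat_zero[OF r(1)] F by blast
  qed
  have "modular_flat ?M1 T"
    by (rule modular_flat_of_subsp[OF r1(1) _ subW r1(2,3)]) (use TE in \<open>simp add: ground_restriction\<close>)
  then have "gen_parallel_connection ?M1 ?M2 M"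
    unfolding gen_parallel_connection_def Let_def ground_restriction T_def[symmetric] rT
    by (intro conjI allI impI HOL.refl rep_matroid[OF r(1)] E(3) flats)
  then show ?case by (rule gf_chordal.connection[OF gf PG])
qed

lemma gf_chordal_matroid: "gf_chordal F M \<Longrightarrow> matroid M"
  by (induction rule: gf_chordal.induct) (auto simp: projective_geometry_def gen_parallel_connection_def Let_def)

lemma matroid_restriction:
  assumes "matroid M" "X \<subseteq> ground M" shows "matroid (restriction M X)"
proof -
  interpret matroid M by (rule assms(1))
  show ?thesis
  proof
    show "finite (ground (restriction M X))"
      using finite_ground assms(2) finite_subset by (auto simp: ground_restriction)
    fix A B assume A: "A \<in> indep (restriction M X)" and B: "B \<in> indep (restriction M X)" and c: "card A < card B"
    then obtain y where "y \<in> B - A" "insert y A \<in> indep M" using indep_augment[of A B] by (auto simp: restriction_def)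
    then show "\<exists>y\<in>B - A. insert y A \<in> indep (restriction M X)" using A B by (auto simp: restriction_def)
  qed (use indep_empty indep_mono in \<open>auto simp: restriction_def\<close>)
qed

text \<open>Identifies a piece of the connection, known only through its flats, as a restriction of
  \<open>M\<close>, so that \<open>\<phi>\<close> represents it. A flat of \<open>M2\<close> is a
  flat of \<open>M\<close> because its trace on the other piece is flat by
  \<open>flat_trace\<close>.\<close>

lemma gen_parallel_connection_side:
  assumes r: "rep M \<phi> {0}" and M1: "matroid M1" and M2: "matroid M2" and g: "ground M = ground M1 \<union> ground M2"
    and T: "restriction M1 (ground M1 \<inter> ground M2) = restriction M2 (ground M1 \<inter> ground M2)"
    and flatT: "flat M1 (ground M1 \<inter> ground M2)"
    and flats: "\<And>F. F \<subseteq> ground M \<Longrightarrow> flat M F \<longleftrightarrow> flat M1 (F \<inter> ground M1) \<and> flat M2 (F \<inter> ground M2)"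
  shows "M2 = restriction M (ground M2)"
proof (rule matroid_eqI_flats[OF M2])
  let ?E = "ground M2"
  have EG: "?E \<subseteq> ground M" using g by blast
  show "matroid (restriction M ?E)" by (rule matroid_restriction[OF rep_matroid[OF r] EG])
  show "ground M2 = ground (restriction M ?E)" by (simp add: ground_restriction)
  have M_iff: "flat M F \<longleftrightarrow> flat M2 F" if F: "F \<subseteq> ?E" for F
  proof -
    have "F \<inter> ground M1 = F \<inter> (ground M1 \<inter> ?E)" "F \<inter> ?E = F" using F by blast+
    then show ?thesis
      using flats[of F] flat_trace[OF M1 M2 T _ flatT, of F] F EG by (metis inf_le2 subset_trans)
  qed
  have "flat M ?E" using M_iff matroid.flat_ground[OF M2] by blast
  then have flatE: "\<And>x. x \<in> ground M \<Longrightarrow> \<phi> x \<in> sp (\<phi> ` ?E) \<Longrightarrow> x \<in> ?E" using rep_flat_zero[OF r] by blast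
  show "flat M2 F \<longleftrightarrow> flat (restriction M ?E) F" for F
  proof (cases "F \<subseteq> ?E")
    case True
    have "sp (\<phi> ` F) \<subseteq> sp (\<phi> ` ?E)" using True by (intro sp_mono) blast
    then have "flat M F \<longleftrightarrow> flat (restriction M ?E) F"
      unfolding rep_flat_zero[OF r] rep_flat_zero[OF rep_restriction[OF r EG]] ground_restriction
      using flatE True EG by blast
    then show ?thesis using M_iff[OF True] by simp
  next
    case False
    then show ?thesis by (simp add: flat_def ground_restriction)
  qed
qed

lemma gf_chordal_chordal:
  assumes "gf_chordal F M"
  shows "F = TYPE(bit) \<Longrightarrow> simple_rep M \<phi> {0} \<Longrightarrow> chordal (insert 0 (\<phi> ` ground M))"
  using assms
proof (induction rule: gf_chordal.induct)
  case (projective M)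
  then show ?case
    using projective_geometry_subsp[of M \<phi>] by (intro chordal.subspace) (simp add: elems_zero simple_rep_def)
next
  case (connection M1 M2 M)
  note r = simple_repD_zero[OF connection.prems(2)]
  let ?E1 = "ground M1" and ?E2 = "ground M2"
  define T where "T = ?E1 \<inter> ?E2"
  have M12: "matroid M1" "matroid M2" using connection.hyps(1,2) gf_chordal_matroid by blast+
  have gpc: "restriction M1 T = restriction M2 T" "modular_flat M1 T" "ground M = ?E1 \<union> ?E2"
    and flats: "\<And>F. F \<subseteq> ground M \<Longrightarrow> flat M F \<longleftrightarrow> flat M1 (F \<inter> ?E1) \<and> flat M2 (F \<inter> ?E2)"
    using connection.hyps(4) unfolding gen_parallel_connection_def Let_def T_def by blast+
  have T1: "flat M1 T" using gpc(2) by (simp add: modular_flat_def)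
  have M2: "M2 = restriction M ?E2"
    using gen_parallel_connection_side[OF r(1) M12 gpc(3) gpc(1)[unfolded T_def] T1[unfolded T_def] flats] .
  have TE: "T \<subseteq> ?E1" "T \<subseteq> ?E2" "T \<subseteq> ground M" "?E1 \<subseteq> ground M" "?E2 \<subseteq> ground M"
    using gpc(3) by (auto simp: T_def)
  have "restriction M2 T = restriction M T" using M2 restriction_restriction[OF TE(2)] by metis
  then have rT: "restriction M1 T = restriction M T" using gpc(1) by simp
  have "projective_geometry TYPE(bit) (restriction M T)"
    using connection.hyps(3) connection.prems(1) rT by (simp add: T_def)
  then have "subsp (elems (restriction M T) \<phi> {0})"
    by (rule projective_geometry_subsp[OF _ rep_restriction[OF r(1) TE(3)]])
  then have W: "subsp (insert 0 (\<phi> ` T))" by (simp add: elems_zero ground_restriction)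
  \<comment> \<open>The definition states modularity in \<open>M1\<close>. That \<open>T\<close> is
    a flat of \<open>M\<close>, and hence of \<open>M2\<close>, allows the two sides to be
    exchanged.\<close>
  have "modular_flat M T" using modular_flat_of_subsp[OF r(1) TE(3) W r(2,3)] .
  then have "flat M T" by (simp add: modular_flat_def)
  then have T2: "flat M2 T" using flats[OF TE(3)] TE(2) by (simp add: Int_absorb2)
  have M1: "M1 = restriction M ?E1"
  proof (rule gen_parallel_connection_side[OF r(1) M12(2,1)])
    show "ground M = ?E2 \<union> ?E1" using gpc(3) by blast
    show "restriction M2 (?E2 \<inter> ?E1) = restriction M1 (?E2 \<inter> ?E1)" using gpc(1) by (simp add: T_def Int_commute)
    show "flat M2 (?E2 \<inter> ?E1)" using T2 by (simp add: T_def Int_commute)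
    show "flat M F \<longleftrightarrow> flat M2 (F \<inter> ?E2) \<and> flat M1 (F \<inter> ?E1)" if "F \<subseteq> ground M" for F
      using flats[OF that] by blast
  qed
  have s1: "simple_rep M1 \<phi> {0}" and s2: "simple_rep M2 \<phi> {0}"
    using simple_rep_restriction[OF connection.prems(2)] TE(4,5) M1 M2 by metis+
  note r1 = simple_repD_zero(1)[OF s1]
  let ?S1 = "insert 0 (\<phi> ` ?E1)" and ?S2 = "insert 0 (\<phi> ` ?E2)" and ?W = "insert 0 (\<phi> ` T)"
  have ch: "chordal ?S1" "chordal ?S2" using connection.IH connection.prems(1) s1 s2 by blast+

  have fin1: "finite ?E1" using M12(1) by (simp add: matroid.finite_ground)
  have spW: "sp (\<phi> ` T) = ?W" using sp_eq[OF W] sp_insert_zero[of "\<phi> ` T"] by simp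
  have "sp ?S1 \<inter> sp ?S2 \<subseteq> ?W"
  proof
    fix v assume v: "v \<in> sp ?S1 \<inter> sp ?S2"
    show "v \<in> ?W"
    proof (rule ccontr)
      assume vW: "v \<notin> ?W"
      \<comment> \<open>\<open>v\<close> is expressed modulo \<open>?W\<close> by as few elements of
        \<open>?E1\<close> as possible; the flats of the connection will permit one fewer.\<close>
      define rel where "rel A \<longleftrightarrow> A \<subseteq> ?E1 \<and> v + sum \<phi> A \<in> ?W" for A
      obtain A0 where "A0 \<subseteq> ?E1" "v = sum \<phi> A0" using v sp_image_eq[OF fin1] unfolding sp_insert_zero by blast
      then have "rel A0" by (simp add: rel_def)
      then obtain A where A: "rel A" and min: "\<And>B. rel B \<Longrightarrow> card A \<le> card B"
        using arg_min_nat_lemma[of rel A0 card] by blast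
      have AE: "A \<subseteq> ?E1" and AW: "v + sum \<phi> A \<in> ?W" using A by (auto simp: rel_def)
      have finA: "finite A" using AE fin1 finite_subset by blast
      have "A \<noteq> {}" using AW vW by auto
      then obtain a where a: "a \<in> A" by blast
      define B where "B = A - {a}"
      have finB: "finite B" using finA by (simp add: B_def)
      have sumA: "sum \<phi> A = \<phi> a + sum \<phi> B" unfolding B_def using finA a by (rule sum.remove)
      have cardB: "card B < card A" unfolding B_def using finA a by (intro psubset_card_mono) auto
      have BE: "B \<subseteq> ?E1" using AE by (auto simp: B_def)
      \<comment> \<open>\<open>F1 \<union> ?E2\<close> meets both sides in flats, so it is a flat of
        \<open>M\<close>. Its span contains \<open>v\<close>, \<open>?W\<close> and
        \<open>B\<close>, hence \<open>\<phi> a\<close>. So \<open>a\<close> lies in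
        \<open>F1\<close> and can be traded, modulo \<open>?W\<close>, for members of
        \<open>B\<close>.\<close>
      define F1 where "F1 = {x \<in> ?E1. \<phi> x \<in> sp (\<phi> ` (T \<union> B))}"
      have F1: "flat M1 F1"
        unfolding F1_def by (rule rep_flat_of_subsp[OF r1 subsp_sp]) (simp add: zero_in_sp)
      have TF1: "T \<subseteq> F1" "B \<subseteq> F1" using TE BE by (auto simp: F1_def intro: sp_incl)
      let ?F = "F1 \<union> ?E2"
      have "F1 \<subseteq> ?E1" by (auto simp: F1_def)
      then have "?F \<inter> ?E1 = F1" "?F \<inter> ?E2 = ?E2" "?F \<subseteq> ground M" using TF1 TE gpc(3) by (auto simp: T_def)
      then have "flat M ?F" using flats[of ?F] F1 matroid.flat_ground[OF M12(2)] by simp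
      moreover have "\<phi> a \<in> sp (\<phi> ` ?F)"
      proof -
        have vF: "v \<in> sp (\<phi> ` ?F)" using v sp_mono[of "\<phi> ` ?E2" "\<phi> ` ?F"] unfolding sp_insert_zero by blast
        have WF: "?W \<subseteq> sp (\<phi> ` ?F)" unfolding spW[symmetric] using TF1 by (intro sp_mono) blast
        have BF: "sum \<phi> B \<in> sp (\<phi> ` ?F)" using TF1 by (intro subsp_sum subsp_sp sp_incl) blast
        have "(v + sum \<phi> A) + (v + sum \<phi> B) \<in> sp (\<phi> ` ?F)"
          by (rule sp_add[OF subsetD[OF WF AW] sp_add[OF vF BF]])
        then show ?thesis by (simp add: sumA ac_simps)
      qed
      moreover have "a \<in> ground M" using a AE TE by blast
      ultimately have "a \<in> ?F" unfolding rep_flat_zero[OF r(1)] by blast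
      then have "a \<in> T \<or> a \<in> F1" using a AE by (auto simp: T_def)
      then have "\<phi> a \<in> sp (\<phi> ` T) + sp (\<phi> ` B)"
        using TF1(1) unfolding F1_def image_Un sp_Un by blast
      then have "\<phi> a \<in> sp (\<phi> ` B) + ?W" by (simp only: spW add.commute)
      then obtain Y where Y: "Y \<subseteq> B" "\<phi> a + sum \<phi> Y \<in> ?W"
        unfolding mem_span_plus[OF finB] by blast
      have finY: "finite Y" using Y(1) finB finite_subset by blast
      have "(v + sum \<phi> A) + (\<phi> a + sum \<phi> Y) \<in> ?W" by (rule subsp_add[OF W AW Y(2)])
      then have "v + sum \<phi> (symdiff B Y) \<in> ?W"
        unfolding sumA sum_symdiff[OF finB finY] by (simp add: ac_simps)
      moreover have "symdiff B Y \<subseteq> B" using Y(1) by blast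
      ultimately have "rel (symdiff B Y)" "card (symdiff B Y) \<le> card B"
        using BE finB by (auto simp: rel_def intro!: card_mono)
      then show False using min cardB by fastforce
    qed
  qed
  moreover have "?W \<subseteq> ?S1 \<inter> ?S2" using TE by blast
  ultimately have "chordal (?S1 \<union> ?S2)" using ch by (intro chordal.glue) blast+
  moreover have "?S1 \<union> ?S2 = insert 0 (\<phi> ` ground M)" using gpc(3) by auto
  ultimately show ?case by simp
qed

theorem theorem1p1:
  fixes M :: "'a matroid"
  assumes "matroid M" and "simple_matroid M" and "binary M"
  shows "(gf_chordal TYPE(bit) M \<longleftrightarrow>
           \<not> (\<exists>N. induced_minor M N \<and>
                 (matroid_iso N (cycle_matroid (cycle_graph 4)) \<or>
                  matroid_iso N (cycle_matroid K4)))) \<and>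
         (gf_chordal TYPE(bit) M \<longleftrightarrow>
           \<not> (\<exists>N. induced_restriction M N \<and>
                 ((\<exists>n\<ge>4. matroid_iso N (cycle_matroid (cycle_graph n))) \<or>
                  matroid_iso N (cycle_matroid K4) \<or>
                  matroid_iso N (dual (cycle_matroid K33)))))"
proof -
  obtain \<phi> :: "'a \<Rightarrow> nat \<Rightarrow> bit" where r: "rep M \<phi> {0}" using binary_rep[OF assms(1,3)] by blast
  have s: "simple_rep M \<phi> {0}" by (rule simple_rep_if_simple[OF r assms(2)])
  let ?S = "elems M \<phi> {0}"
  have finS: "finite ?S" by (rule rep_finite_elems[OF r])
  have S0: "0 \<in> ?S" by (simp add: elems_zero)
  have gf: "gf_chordal TYPE(bit) M \<longleftrightarrow> chordal ?S"
    using chordal_gf_chordal[OF _ s HOL.refl] gf_chordal_chordal[OF _ HOL.refl s] by (auto simp: elems_zero)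
  have minor: "\<not> matroid_iso N (cycle_matroid (cycle_graph n))" "\<not> matroid_iso N (cycle_matroid K4)"
      "\<not> matroid_iso N (dual (cycle_matroid K33))"
    if "chordal ?S" "induced_minor M N" "4 \<le> n" for N n
    using induced_minor_chordal[OF that(2) r that(1)] that(3)
      chordal_no_long_cycle chordal_no_K4 chordal_no_K33 by blast+
  have restr: "induced_minor M N" if "induced_restriction M N" for N
    using induced_minor.restrict[OF induced_minor.refl that] .
  have "chordal ?S" if no: "\<not> (\<exists>N. induced_minor M N \<and>
      (matroid_iso N (cycle_matroid (cycle_graph 4)) \<or> matroid_iso N (cycle_matroid K4)))"
  proof (rule odd_minors_chordal[OF finS S0])
    show "odd_minors ?S"
      unfolding odd_minors_def
    proof (intro allI impI, rule ccontr)
      fix Y assume Y: "Y \<subseteq> ?S" and odd: "\<not> odd_diag (?S + sp Y)"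
      \<comment> \<open>\<open>Y\<close> may contain 0, which represents no element of
        \<open>M\<close>; the span is not affected.\<close>
      define X where "X = {x \<in> ground M. \<phi> x \<in> Y}"
      have XG: "X \<subseteq> ground M" by (auto simp: X_def)
      have "insert 0 Y = insert 0 (\<phi> ` X)" using Y by (auto simp: X_def elems_zero)
      then have sp: "sp Y = sp (\<phi> ` X)" using sp_insert_zero by metis
      note rc = rep_contraction[OF r XG]
      obtain N where N: "is_simplification (contraction M X) N"
        using rep_simplification_exists[OF rc] by blast
      have "elems N \<phi> (sp (\<phi> ` X) + {0}) = ?S + sp Y"
        using rep_simplification(2)[OF rc N] elems_contraction[OF r XG] sp by simp
      then have "\<not> odd_diag (elems N \<phi> (sp (\<phi> ` X) + {0}))" using odd by simp
      then obtain N0 where N0: "induced_restriction N N0"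
          "matroid_iso N0 (cycle_matroid (cycle_graph 4)) \<or> matroid_iso N0 (cycle_matroid K4)"
        using not_odd_diag_iso[OF rep_simplification(1)[OF rc N]] by blast
      have "induced_minor M N0"
        by (rule induced_minor.restrict[OF induced_minor.contract[OF induced_minor.refl XG N] N0(1)])
      then show False using no N0(2) by blast
    qed
  qed
  moreover have "chordal ?S" if no: "\<not> (\<exists>N. induced_restriction M N \<and>
      ((\<exists>n\<ge>4. matroid_iso N (cycle_matroid (cycle_graph n))) \<or>
       matroid_iso N (cycle_matroid K4) \<or> matroid_iso N (dual (cycle_matroid K33))))"
  proof (rule odd_minors_chordal[OF finS S0 no_induced_odd_minors[OF _ S0 finS]])
    have "odd_diag ?S" using not_odd_diag_iso[OF s] no by blast
    moreover have "\<not> chordless ?S {0} C" for C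
      using chordless_iso[OF s, of C] no by (auto simp: chordless_def)
    moreover have "\<not> grid ?S {0} a b c d" for a b c d
      using grid_iso[OF s, of a b c d] no by blast
    ultimately show "no_induced ?S {0}" by (simp add: no_induced_def)
  qed
  ultimately show ?thesis
    unfolding gf using minor[of _ 4] minor restr by blast
qed

end
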